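(* Let $n \geq 3$ and $d \geq 3$ be integers. Then for a generic hypersurface $V \subset \mathbb{P}^n$ of degree $d$ there is a hyperplane section of $V$ which has exactly $n$ singularities, all of them nodes, in general position. Explicitly: there is a Zariski open and dense subset $U \subset \mathbb{P}(S_d)$, consisting of classes of polynomials $f$ with $V(f)$ smooth, such that for every $f \in U$ there is a hyperplane $H \subset \mathbb{P}^n$ for which the hyperplane section $V(f)\cap H$ has exactly $n$ singular points, each of them is a node, and these $n$ points are in general position in $H$.
   Context: We work over $\mathbb{C}$. $S=\mathbb{C}[x_0,\ldots,x_n]$ is the graded polynomial ring, $S_d$ is its space of homogeneous polynomials of degree $d$, and $\mathbb{P}(S_d)$ is the associated projective space, which parametrizes the degree $d$ hypersurfaces $V(f): f=0$ in $\mathbb{P}^n=\mathbb{P}^n_{\mathbb{C}}$. A property is generic if it holds for a Zariski open and dense subset of the parameter space $\mathbb{P}(S_d)$. The hyperplane section $V(f)\cap H$ is the hypersurface of $H\cong\mathbb{P}^{n-1}$ defined by the restriction of $f$ to $H$. A node (an $A_1$ singularity) is a non-degenerate quadratic hypersurface singularity: in local coordinates at the point, the local defining equation has zero constant and linear part and its Hessian matrix at the point is nondegenerate. Points of $H$ are in general position if the corresponding vectors in the $n$-dimensional vector space whose projectivization is $H$ are linearly independent. *)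

theory Defs
  imports
    "HOL-Analysis.Abstract_Topology"
    "HOL-Library.Poly_Mapping"
    "Jordan_Normal_Form.VS_Connect"
begin

section \<open>Multivariate polynomials\<close>

text \<open>
  A polynomial is the finitely supported function from exponent vectors to coefficients;
  multiplication is the convolution product of \<^theory>\<open>HOL-Library.Poly_Mapping\<close>.
\<close>

type_synonym 'v mpoly = "('v \<Rightarrow>\<^sub>0 nat) \<Rightarrow>\<^sub>0 complex"

abbreviation Const :: "complex \<Rightarrow> 'v mpoly" where
  "Const c \<equiv> Poly_Mapping.single 0 c"

abbreviation Var :: "'v \<Rightarrow> 'v mpoly" where
  "Var v \<equiv> Poly_Mapping.single (Poly_Mapping.single v 1) 1"

definition mdeg :: "('v \<Rightarrow>\<^sub>0 nat) \<Rightarrow> nat" where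
  "mdeg m = (\<Sum>v\<in>Poly_Mapping.keys m. Poly_Mapping.lookup m v)"

definition monoms :: "'v set \<Rightarrow> nat \<Rightarrow> ('v \<Rightarrow>\<^sub>0 nat) set" where
  "monoms I d = {m. Poly_Mapping.keys m \<subseteq> I \<and> mdeg m = d}"

text \<open>Homogeneous polynomials of degree \<open>d\<close> in the variables indexed by \<open>I\<close>, including \<open>0\<close>.\<close>

definition forms :: "'v set \<Rightarrow> nat \<Rightarrow> 'v mpoly set" where
  "forms I d = {f. Poly_Mapping.keys f \<subseteq> monoms I d}"

definition mono_val :: "('v \<Rightarrow> 'r::comm_semiring_1) \<Rightarrow> ('v \<Rightarrow>\<^sub>0 nat) \<Rightarrow> 'r" where
  "mono_val \<sigma> m = (\<Prod>v\<in>Poly_Mapping.keys m. \<sigma> v ^ Poly_Mapping.lookup m v)"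

definition poly_val :: "('v \<Rightarrow> complex) \<Rightarrow> 'v mpoly \<Rightarrow> complex" where
  "poly_val x f = (\<Sum>m\<in>Poly_Mapping.keys f. Poly_Mapping.lookup f m * mono_val x m)"

definition poly_subst :: "('v \<Rightarrow> 'w mpoly) \<Rightarrow> 'v mpoly \<Rightarrow> 'w mpoly" where
  "poly_subst \<sigma> f = (\<Sum>m\<in>Poly_Mapping.keys f. Const (Poly_Mapping.lookup f m) * mono_val \<sigma> m)"

text \<open>
  In the terms with \<open>lookup m v = 0\<close> the truncated subtraction is harmless, as their
  coefficient vanishes.
\<close>

definition mpderiv :: "'v \<Rightarrow> 'v mpoly \<Rightarrow> 'v mpoly" where
  "mpderiv v f = (\<Sum>m\<in>Poly_Mapping.keys f.
     Poly_Mapping.single (m - Poly_Mapping.single v 1)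
       (of_nat (Poly_Mapping.lookup m v) * Poly_Mapping.lookup f m))"

lemma mono_val_superset:
  assumes "finite A" "Poly_Mapping.keys m \<subseteq> A"
  shows "mono_val \<sigma> m = (\<Prod>v\<in>A. \<sigma> v ^ Poly_Mapping.lookup m v)"
  unfolding mono_val_def using assms
  by (intro prod.mono_neutral_left) (auto simp: in_keys_iff)

lemma mono_val_zero: "mono_val \<sigma> 0 = 1"
  by (simp add: mono_val_def)

lemma mono_val_add: "mono_val \<sigma> (m + m') = mono_val \<sigma> m * mono_val \<sigma> m'"
proof -
  let ?A = "Poly_Mapping.keys m \<union> Poly_Mapping.keys m'"
  have "Poly_Mapping.keys (m + m') \<subseteq> ?A" by (rule Poly_Mapping.keys_add)
  then show ?thesis
    by (simp add: mono_val_superset[of ?A] lookup_add power_add prod.distrib)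
qed

lemma mdeg_add: "mdeg (m + m') = mdeg m + mdeg m'"
  unfolding mdeg_def by (subst setsum_keys_plus_distrib) auto

lemma mono_val_scale: "mono_val (\<lambda>v. c * x v) m = c ^ mdeg m * mono_val x m"
  by (simp add: mono_val_def mdeg_def power_mult_distrib prod.distrib power_sum)

lemma poly_val_add: "poly_val x (f + g) = poly_val x f + poly_val x g"
  unfolding poly_val_def
  by (rule setsum_keys_plus_distrib) (auto simp: algebra_simps)

lemma poly_val_sum: "poly_val x (\<Sum>i\<in>A. f i) = (\<Sum>i\<in>A. poly_val x (f i))"
proof (cases "finite A")
  case True
  then show ?thesis
    by (induction A) (simp_all add: poly_val_add, simp add: poly_val_def)
qed (simp add: poly_val_def)

lemma poly_val_single: "poly_val x (Poly_Mapping.single m c) = c * mono_val x m"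
  by (simp add: poly_val_def)

lemma poly_mapping_eq_sum_single:
  "f = (\<Sum>m\<in>Poly_Mapping.keys f. Poly_Mapping.single m (Poly_Mapping.lookup f m))"
proof (rule poly_mapping_eqI)
  fix k
  show "Poly_Mapping.lookup f k =
    Poly_Mapping.lookup (\<Sum>m\<in>Poly_Mapping.keys f. Poly_Mapping.single m (Poly_Mapping.lookup f m)) k"
    by (simp add: lookup_sum lookup_single when_def in_keys_iff)
qed

lemma poly_val_mult: "poly_val x (f * g) = poly_val x f * poly_val x g"
proof -
  let ?l = Poly_Mapping.lookup and ?k = Poly_Mapping.keys and ?s = Poly_Mapping.single
  have "f * g = (\<Sum>m\<in>?k f. \<Sum>m'\<in>?k g. ?s (m + m') (?l f m * ?l g m'))"
    by (subst poly_mapping_eq_sum_single[of f], subst poly_mapping_eq_sum_single[of g])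
      (simp add: sum_product mult_single)
  then have "poly_val x (f * g) =
      (\<Sum>m\<in>?k f. \<Sum>m'\<in>?k g. ?l f m * ?l g m' * mono_val x (m + m'))"
    by (simp add: poly_val_sum poly_val_single)
  also have "\<dots> = poly_val x f * poly_val x g"
    by (simp add: poly_val_def sum_product mono_val_add mult_ac)
  finally show ?thesis .
qed

lemma forms_mult: "f \<in> forms I d \<Longrightarrow> g \<in> forms I e \<Longrightarrow> f * g \<in> forms I (d + e)"
  unfolding forms_def monoms_def
  using Poly_Mapping.keys_mult[of f g] Poly_Mapping.keys_add
  by (fastforce simp: mdeg_add)

lemma poly_val_scale:
  assumes "f \<in> forms I d"
  shows "poly_val (\<lambda>v. c * x v) f = c ^ d * poly_val x f"
  using assms unfolding poly_val_def forms_def monoms_def sum_distrib_left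
  by (intro sum.cong) (auto simp: mono_val_scale mult_ac)


section \<open>The parameter space \<open>\<P>(S\<^sub>d)\<close> and its Zariski topology\<close>

text \<open>
  Throughout, \<open>N\<close> is the number of homogeneous coordinates, so that the ambient space is
  \<open>\<P>\<^bsup>N-1\<^esup>\<close>, and points of projective spaces are classes of non-zero vectors up to scalars.
\<close>

definition form_class :: "'v mpoly \<Rightarrow> 'v mpoly set" where
  "form_class f = {Const c * f | c. c \<noteq> 0}"

definition proj_forms :: "nat \<Rightarrow> nat \<Rightarrow> nat mpoly set set" where
  "proj_forms N d = form_class ` (forms {..<N} d - {0})"

text \<open>
  The homogeneous coordinates of the class of \<open>f\<close> are the coefficients of \<open>f\<close>, so the
  coordinate ring of \<open>\<P>(S\<^sub>d)\<close> is the polynomial ring in variables indexed by the monomials of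
  degree \<open>d\<close>.
\<close>

definition zero_locus :: "nat \<Rightarrow> nat \<Rightarrow> (nat \<Rightarrow>\<^sub>0 nat) mpoly set \<Rightarrow> nat mpoly set set" where
  "zero_locus N d G =
     {C \<in> proj_forms N d. \<forall>F\<in>G. \<forall>f\<in>C. poly_val (Poly_Mapping.lookup f) F = 0}"

definition zariski_open :: "nat \<Rightarrow> nat \<Rightarrow> nat mpoly set set \<Rightarrow> bool" where
  "zariski_open N d U \<longleftrightarrow> U \<subseteq> proj_forms N d \<and>
     (\<exists>G \<subseteq> (\<Union>e. forms (monoms {..<N} d) e). proj_forms N d - U = zero_locus N d G)"

definition zariski :: "nat \<Rightarrow> nat \<Rightarrow> nat mpoly set topology" where
  "zariski N d = topology (zariski_open N d)"

lemma lookup_Const_mult: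
  "Poly_Mapping.lookup (Const c * f) = (\<lambda>m. c * Poly_Mapping.lookup f m)"
  by (simp add: mult_map_scale_conv_mult[symmetric] Poly_Mapping.map.rep_eq when_def fun_eq_iff)

lemma zero_locus_class:
  assumes "f \<in> forms {..<N} d - {0}" "G \<subseteq> (\<Union>e. forms (monoms {..<N} d) e)"
  shows "form_class f \<in> zero_locus N d G \<longleftrightarrow>
    (\<forall>F\<in>G. poly_val (Poly_Mapping.lookup f) F = 0)"
proof -
  have *: "(\<forall>g\<in>form_class f. poly_val (Poly_Mapping.lookup g) F = 0) \<longleftrightarrow>
      poly_val (Poly_Mapping.lookup f) F = 0" if F: "F \<in> G" for F
  proof -
    from F assms(2) obtain e where "F \<in> forms (monoms {..<N} d) e" by blast
    then show ?thesis
      by (auto simp: form_class_def lookup_Const_mult poly_val_scale intro: exI[of _ 1])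
  qed
  have "form_class f \<in> proj_forms N d"
    using assms(1) by (simp add: proj_forms_def)
  then show ?thesis
    using * by (simp add: zero_locus_def)
qed

lemma istopology_zariski: "istopology (zariski_open N d)"
  unfolding istopology_def
proof (intro conjI allI impI)
  fix S T assume S: "zariski_open N d S" and T: "zariski_open N d T"
  let ?R = "\<Union>e. forms (monoms {..<N} d) e"
  from S obtain G where G: "G \<subseteq> ?R" "proj_forms N d - S = zero_locus N d G"
    unfolding zariski_open_def by blast
  from T obtain G' where G': "G' \<subseteq> ?R" "proj_forms N d - T = zero_locus N d G'"
    unfolding zariski_open_def by blast
  let ?P = "(\<lambda>(F, F'). F * F') ` (G \<times> G')"
  have P: "?P \<subseteq> ?R" using G(1) G'(1) by (fastforce intro: forms_mult)
  have "C \<in> zero_locus N d G \<union> zero_locus N d G' \<longleftrightarrow> C \<in> zero_locus N d ?P"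
    if "C \<in> proj_forms N d" for C
  proof -
    from that obtain f where f: "f \<in> forms {..<N} d - {0}" "C = form_class f"
      unfolding proj_forms_def by blast
    show ?thesis
      using f(1) unfolding f(2)
      by (auto simp: zero_locus_class[OF f(1) G(1)] zero_locus_class[OF f(1) G'(1)]
          zero_locus_class[OF f(1) P] poly_val_mult)
  qed
  moreover have "zero_locus N d X \<subseteq> proj_forms N d" for X
    by (auto simp: zero_locus_def)
  ultimately have "zero_locus N d G \<union> zero_locus N d G' = zero_locus N d ?P"
    by blast
  then have "proj_forms N d - S \<inter> T = zero_locus N d ?P"
    using G(2) G'(2) by blast
  with P S show "zariski_open N d (S \<inter> T)"
    unfolding zariski_open_def by blast
next
  fix K assume K: "\<forall>T\<in>K. zariski_open N d T"
  let ?R = "\<Union>e. forms (monoms {..<N} d) e"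
  from K have "\<forall>T\<in>K. \<exists>G. G \<subseteq> ?R \<and> proj_forms N d - T = zero_locus N d G"
    unfolding zariski_open_def by blast
  then obtain G where G: "\<And>T. T \<in> K \<Longrightarrow> G T \<subseteq> ?R"
    "\<And>T. T \<in> K \<Longrightarrow> proj_forms N d - T = zero_locus N d (G T)"
    by metis
  have "proj_forms N d - \<Union> K = zero_locus N d (\<Union> (G ` K))"
  proof -
    have "C \<notin> \<Union> K \<longleftrightarrow> C \<in> zero_locus N d (\<Union> (G ` K))"
      if "C \<in> proj_forms N d" for C
    proof -
      have "C \<notin> \<Union> K \<longleftrightarrow> (\<forall>T\<in>K. C \<in> zero_locus N d (G T))"
        using that G(2) by blast
      also have "\<dots> \<longleftrightarrow> C \<in> zero_locus N d (\<Union> (G ` K))"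
        using that by (auto simp: zero_locus_def)
      finally show ?thesis .
    qed
    moreover have "zero_locus N d (\<Union> (G ` K)) \<subseteq> proj_forms N d"
      by (auto simp: zero_locus_def)
    ultimately show ?thesis by blast
  qed
  moreover have "\<Union> (G ` K) \<subseteq> ?R" using G(1) by blast
  moreover have "\<Union> K \<subseteq> proj_forms N d" using K unfolding zariski_open_def by blast
  ultimately show "zariski_open N d (\<Union> K)" unfolding zariski_open_def by blast
qed

lemma openin_zariski: "openin (zariski N d) U \<longleftrightarrow> zariski_open N d U"
  by (simp add: zariski_def istopology_zariski)

lemma topspace_zariski: "topspace (zariski N d) = proj_forms N d"
proof -
  have "zariski_open N d (proj_forms N d)"
    unfolding zariski_open_def
  proof (intro conjI exI[of _ "{1}"])
    show "{1} \<subseteq> (\<Union>e. forms (monoms {..<N} d) e)"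
      by (auto simp: forms_def monoms_def mdeg_def intro!: exI[of _ 0])
    have one: "poly_val x 1 = 1" for x :: "(nat \<Rightarrow>\<^sub>0 nat) \<Rightarrow> complex"
      using poly_val_single[of x 0 1] by (simp add: mono_val_zero)
    have "C \<noteq> {}" if "C \<in> proj_forms N d" for C
    proof -
      from that obtain f where "C = form_class f" unfolding proj_forms_def by blast
      then have "Const 1 * f \<in> C" unfolding form_class_def using one_neq_zero by blast
      then show ?thesis by blast
    qed
    then show "proj_forms N d - proj_forms N d = zero_locus N d {1}"
      unfolding zero_locus_def by (simp add: one) blast
  qed simp
  then show ?thesis
    unfolding topspace_def openin_zariski by (auto simp: zariski_open_def)
qed


section \<open>Hypersurfaces in projective space and their singularities\<close>

definition point_class :: "complex vec \<Rightarrow> complex vec set" where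
  "point_class v = {c \<cdot>\<^sub>v v | c. c \<noteq> 0}"

definition proj_points :: "nat \<Rightarrow> complex vec set set" where
  "proj_points N = point_class ` (carrier_vec N - {0\<^sub>v N})"

definition singular_points :: "nat \<Rightarrow> nat mpoly \<Rightarrow> complex vec set set" where
  "singular_points N g = {P \<in> proj_points N. \<forall>v\<in>P.
     poly_val (($) v) g = 0 \<and> (\<forall>i<N. poly_val (($) v) (mpderiv i g) = 0)}"

definition smooth_hypersurface :: "nat \<Rightarrow> nat mpoly \<Rightarrow> bool" where
  "smooth_hypersurface N g \<longleftrightarrow> singular_points N g = {}"

text \<open>
  The equation of \<open>V(g)\<close> in the chart \<open>x\<^sub>k = 1\<close>, in the \<open>N - 1\<close> affine coordinates
  \<open>t\<^sub>0, \<dots>, t\<^bsub>N-2\<^esub>\<close> centred at the point \<open>[v]\<close> (where \<open>v\<^sub>k \<noteq> 0\<close>).  The coordinate \<open>x\<^sub>i\<close> is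
  replaced by \<open>v\<^sub>i / v\<^sub>k + t\<^sub>i\<close> for \<open>i < k\<close> and by \<open>v\<^sub>i / v\<^sub>k + t\<^bsub>i-1\<^esub>\<close> for \<open>i > k\<close>.
\<close>

definition local_equation :: "nat \<Rightarrow> complex vec \<Rightarrow> nat mpoly \<Rightarrow> nat mpoly" where
  "local_equation k v g = poly_subst (\<lambda>i. if i = k then 1
     else Const (v $ i / v $ k) + Var (if i < k then i else i - 1)) g"

definition hessian_at_0 :: "nat \<Rightarrow> nat mpoly \<Rightarrow> complex mat" where
  "hessian_at_0 M h = mat M M (\<lambda>(i, j). poly_val (\<lambda>_. 0) (mpderiv i (mpderiv j h)))"

definition node :: "nat \<Rightarrow> nat mpoly \<Rightarrow> complex vec set \<Rightarrow> bool" where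
  "node N g P \<longleftrightarrow> (\<forall>v\<in>P. \<exists>k<N. v $ k \<noteq> 0 \<and>
     (let h = local_equation k v g in
       (\<forall>m. mdeg m \<le> 1 \<longrightarrow> Poly_Mapping.lookup h m = 0) \<and>
       det (hessian_at_0 (N - 1) h) \<noteq> 0))"

text \<open>
  Distinct points have disjoint classes, so a choice \<open>r\<close> of representatives is injective and
  linear independence of its image set is linear independence of the family.
\<close>

definition general_position :: "nat \<Rightarrow> complex vec set set \<Rightarrow> bool" where
  "general_position N X \<longleftrightarrow> (\<forall>r. (\<forall>P\<in>X. r P \<in> P) \<longrightarrow>
     \<not> module.lin_dep class_ring (module_vec TYPE(complex) N) (r ` X))"


section \<open>Hyperplane sections\<close>

text \<open>
  A hyperplane \<open>H\<close> of \<open>\<P>\<^bsup>N-1\<^esup>\<close> is represented by the linear subspace of \<open>\<complex>\<^sup>N\<close> whose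
  projectivization it is.
\<close>

definition hyperplane :: "nat \<Rightarrow> complex vec set \<Rightarrow> bool" where
  "hyperplane N H \<longleftrightarrow>
     (\<exists>a \<in> carrier_vec N. a \<noteq> 0\<^sub>v N \<and> H = {x \<in> carrier_vec N. a \<bullet> x = 0})"

text \<open>
  An identification \<open>H \<cong> \<P>\<^bsup>N-2\<^esup>\<close>: the matrix \<open>B\<close> is a linear isomorphism from \<open>\<complex>\<^bsup>N-1\<^esup>\<close> onto \<open>H\<close>,
  that is, its columns are a basis of \<open>H\<close>.  Two such matrices differ by an invertible matrix,
  hence by a projective linear change of coordinates on \<open>\<P>\<^bsup>N-2\<^esup>\<close>.
\<close>

definition hyperplane_coords :: "nat \<Rightarrow> complex vec set \<Rightarrow> complex mat \<Rightarrow> bool" where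
  "hyperplane_coords N H B \<longleftrightarrow> B \<in> carrier_mat N (N - 1) \<and>
     bij_betw (\<lambda>y. B *\<^sub>v y) (carrier_vec (N - 1)) H"

text \<open>The restriction of \<open>f\<close> to \<open>H\<close> in the coordinates \<open>B\<close>, i.e. the polynomial \<open>f (B y)\<close>.\<close>

definition restrict_form :: "complex mat \<Rightarrow> nat mpoly \<Rightarrow> nat mpoly" where
  "restrict_form B f = poly_subst (\<lambda>i. \<Sum>j<dim_col B. Const (B $$ (i, j)) * Var j) f"

end

(*
  Let L be the space of forms f of degree d whose restriction to the hyperplane x_n = 0 is singular
  at the n coordinate points of that hyperplane.  Composing f in L with shears g depending on n^2
  parameters gives a polynomial map (f, g) |-> f o g between affine spaces of the same dimension.
  Its derivative is bijective at a suitable point, because the nodes are non-degenerate and V(f) is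
  smooth at them; so its components are algebraically independent.  By the extension theorem for
  homomorphisms from a finitely generated domain to an algebraically closed field, the image of
  every non-empty principal open set then contains a non-empty principal open set.  It is applied to
  the set where g is invertible, the Hessians at the coordinate points are non-degenerate and the
  section has no further singular point.  That the last condition is generic, and likewise
  smoothness of V(f), is a dimension count: the torus moves a singular point with support A to the
  point (1, ..., 1), where being singular imposes at least |A| independent linear conditions (in the
  few cases where it does not, a single coefficient must vanish), while the torus orbit has
  dimension |A| - 1.  Finally, a homogeneous part of the polynomial obtained gives an open dense
  subset of the projective space.
*)
theory Submission
  imports Defs "HOL-Computational_Algebra.Fundamental_Theorem_Algebra"
begin

text \<open>The number n^2 counts the conditions that define L: at each of the n coordinate points,
  the value and the n - 1 derivatives along the hyperplane vanish. On the side of the group, n shear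
  parameters tilt the hyperplane and n (n - 1) move the coordinate points inside it. Indexing the
  shear parameters by the n^2 monomials missing from L makes source and target the same coefficient
  space. The test form has, at each coordinate point, the Hessian with 0 on and 1 off the diagonal,
  and derivative 1 in direction x_n. The linearized equations then split into n small systems,
  solvable because n >= 3. The test form is not asked to have a section free of further
  singularities: that condition is a separate non-zero polynomial on L, and a product of non-zero
  polynomials is non-zero. Accordingly every genericity statement has the shape "some non-zero
  polynomial F exists such that F(c) non-zero implies the property", which is stable under finite
  products and under passing to the image of a dominant map.\<close>

abbreviation lookup :: "('a \<Rightarrow>\<^sub>0 'b::zero) \<Rightarrow> 'a \<Rightarrow> 'b" where
  "lookup \<equiv> Poly_Mapping.lookup"

abbreviation keys :: "('a \<Rightarrow>\<^sub>0 'b::zero) \<Rightarrow> 'a set" where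
  "keys \<equiv> Poly_Mapping.keys"

abbreviation single :: "'a \<Rightarrow> 'b \<Rightarrow> 'a \<Rightarrow>\<^sub>0 'b::zero" where
  "single \<equiv> Poly_Mapping.single"

section \<open>Extension of homomorphisms to finitely generated domains\<close>

text \<open>Subrings are subsets of one ambient ring, so that adjoining elements repeatedly stays
  within one type; homomorphisms are accordingly total functions, constrained only on such a
  subset.\<close>

definition is_subring :: "'a::comm_ring_1 set \<Rightarrow> bool" where
  "is_subring A \<longleftrightarrow> 0 \<in> A \<and> 1 \<in> A \<and> (\<forall>x\<in>A. - x \<in> A) \<and>
     (\<forall>x\<in>A. \<forall>y\<in>A. x + y \<in> A \<and> x * y \<in> A)"

definition hom_on :: "'a::comm_ring_1 set \<Rightarrow> ('a \<Rightarrow> complex) \<Rightarrow> bool" where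
  "hom_on A h \<longleftrightarrow> h 1 = 1 \<and> (\<forall>x\<in>A. \<forall>y\<in>A. h (x + y) = h x + h y \<and> h (x * y) = h x * h y)"

definition coeffs_in :: "'a::comm_ring_1 set \<Rightarrow> 'a poly \<Rightarrow> bool" where
  "coeffs_in A p \<longleftrightarrow> (\<forall>i. poly.coeff p i \<in> A)"

definition adjoin :: "'a::comm_ring_1 set \<Rightarrow> 'a \<Rightarrow> 'a set" where
  "adjoin A x = {poly p x | p. coeffs_in A p}"

lemma subring_sum: "is_subring A \<Longrightarrow> (\<And>i. i \<in> I \<Longrightarrow> f i \<in> A) \<Longrightarrow> sum f I \<in> A"
  by (induction I rule: infinite_finite_induct) (auto simp: is_subring_def)

lemma subring_prod: "is_subring A \<Longrightarrow> (\<And>i. i \<in> I \<Longrightarrow> f i \<in> A) \<Longrightarrow> prod f I \<in> A"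
  by (induction I rule: infinite_finite_induct) (auto simp: is_subring_def)

lemma subring_power: "is_subring A \<Longrightarrow> x \<in> A \<Longrightarrow> x ^ k \<in> A"
  by (induction k) (auto simp: is_subring_def)

lemma hom_on_0: "is_subring A \<Longrightarrow> hom_on A h \<Longrightarrow> h 0 = 0"
  unfolding is_subring_def hom_on_def by (metis add.right_neutral add_left_cancel)

lemma hom_on_minus: "is_subring A \<Longrightarrow> hom_on A h \<Longrightarrow> x \<in> A \<Longrightarrow> h (- x) = - h x"
  using hom_on_0[of A h] unfolding is_subring_def hom_on_def
  by (metis add.right_inverse minus_unique)

lemma hom_on_diff:
  assumes "is_subring A" "hom_on A h" "x \<in> A" "y \<in> A"
  shows "h (x - y) = h x - h y"
proof -
  have "- y \<in> A" using assms by (auto simp: is_subring_def)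
  then have "h (x + - y) = h x + h (- y)" using assms by (auto simp: hom_on_def)
  then show ?thesis using assms by (simp add: hom_on_minus)
qed

lemma hom_on_sum:
  assumes "is_subring A" "hom_on A h" "\<And>i. i \<in> I \<Longrightarrow> f i \<in> A"
  shows "h (sum f I) = (\<Sum>i\<in>I. h (f i))"
  using assms(3)
proof (induction I rule: infinite_finite_induct)
  case (insert x F)
  then show ?case using assms(1,2) subring_sum[of A F f] by (simp add: hom_on_def)
qed (use assms in \<open>auto simp: hom_on_0\<close>)

lemma hom_on_prod:
  assumes "is_subring A" "hom_on A h" "\<And>i. i \<in> I \<Longrightarrow> f i \<in> A"
  shows "h (prod f I) = (\<Prod>i\<in>I. h (f i))"
  using assms(3)
proof (induction I rule: infinite_finite_induct)
  case (insert x F)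
  then show ?case using assms(1,2) subring_prod[of A F f] by (simp add: hom_on_def)
qed (use assms in \<open>auto simp: hom_on_def\<close>)

lemma hom_on_power:
  assumes "is_subring A" "hom_on A h" "x \<in> A"
  shows "h (x ^ k) = h x ^ k"
  using assms by (induction k) (auto simp: hom_on_def subring_power)

section \<open>Polynomials with coefficients in a subring, and simple extensions\<close>

context
  fixes A :: "'a::comm_ring_1 set"
  assumes A: "is_subring A"
begin

lemma coeffs_in_0: "coeffs_in A 0"
  using A by (simp add: coeffs_in_def is_subring_def)

lemma coeffs_in_monom: "c \<in> A \<Longrightarrow> coeffs_in A (Polynomial.monom c k)"
  using A by (simp add: coeffs_in_def is_subring_def)

lemma coeffs_in_const: "c \<in> A \<Longrightarrow> coeffs_in A [:c:]"
  using coeffs_in_monom[of c 0] by (simp add: monom_0)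

lemma coeffs_in_add: "coeffs_in A p \<Longrightarrow> coeffs_in A q \<Longrightarrow> coeffs_in A (p + q)"
  using A by (simp add: coeffs_in_def is_subring_def)

lemma coeffs_in_minus: "coeffs_in A p \<Longrightarrow> coeffs_in A (- p)"
  using A by (simp add: coeffs_in_def is_subring_def)

lemma coeffs_in_diff: "coeffs_in A p \<Longrightarrow> coeffs_in A q \<Longrightarrow> coeffs_in A (p - q)"
  using coeffs_in_add[of p "- q"] coeffs_in_minus[of q] by simp

lemma coeffs_in_mult: "coeffs_in A p \<Longrightarrow> coeffs_in A q \<Longrightarrow> coeffs_in A (p * q)"
  unfolding coeffs_in_def coeff_mult
  using A by (intro allI subring_sum[OF A]) (auto simp: is_subring_def)

lemma coeffs_in_smult: "c \<in> A \<Longrightarrow> coeffs_in A p \<Longrightarrow> coeffs_in A (Polynomial.smult c p)"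
  using A by (auto simp: coeffs_in_def is_subring_def)

lemma adjoin_poly: "coeffs_in A p \<Longrightarrow> poly p x \<in> adjoin A x"
  by (auto simp: adjoin_def)

lemma adjoin_superset: "A \<subseteq> adjoin A x"
proof
  fix a assume "a \<in> A"
  then show "a \<in> adjoin A x" using adjoin_poly[OF coeffs_in_const[of a], of x] by simp
qed

lemma adjoin_generator: "x \<in> adjoin A x"
proof -
  have "1 \<in> A" using A by (simp add: is_subring_def)
  then show ?thesis using adjoin_poly[OF coeffs_in_monom[of 1 1], of x] by (simp add: poly_monom)
qed

lemma is_subring_adjoin: "is_subring (adjoin A x)"
  unfolding is_subring_def
proof (intro conjI ballI)
  show "0 \<in> adjoin A x" "1 \<in> adjoin A x"
    using A adjoin_superset by (auto simp: is_subring_def)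
next
  fix y assume "y \<in> adjoin A x"
  then obtain p where p: "coeffs_in A p" "y = poly p x" by (auto simp: adjoin_def)
  then show "- y \<in> adjoin A x"
    using adjoin_poly[OF coeffs_in_minus[OF p(1)], of x] by simp
next
  fix y z assume "y \<in> adjoin A x" "z \<in> adjoin A x"
  then obtain p q where p: "coeffs_in A p" "y = poly p x" and q: "coeffs_in A q" "z = poly q x"
    by (auto simp: adjoin_def)
  show "y + z \<in> adjoin A x" "y * z \<in> adjoin A x"
    using adjoin_poly[OF coeffs_in_add[OF p(1) q(1)], of x]
      adjoin_poly[OF coeffs_in_mult[OF p(1) q(1)], of x] p(2) q(2) by simp_all
qed

context
  fixes h :: "'a \<Rightarrow> complex"
  assumes h: "hom_on A h"
begin

lemma coeff_map_hom: "poly.coeff (map_poly h p) i = h (poly.coeff p i)"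
  by (simp add: coeff_map_poly hom_on_0[OF A h])

lemma map_hom_add: "coeffs_in A p \<Longrightarrow> coeffs_in A q \<Longrightarrow> map_poly h (p + q) = map_poly h p + map_poly h q"
  using h by (intro poly_eqI) (simp add: coeff_map_hom coeffs_in_def hom_on_def)

lemma map_hom_mult:
  assumes "coeffs_in A p" "coeffs_in A q"
  shows "map_poly h (p * q) = map_poly h p * map_poly h q"
proof (rule poly_eqI)
  fix k
  have "h (poly.coeff (p * q) k) = (\<Sum>i\<le>k. h (poly.coeff p i * poly.coeff q (k - i)))"
    unfolding coeff_mult using assms A
    by (intro hom_on_sum[OF A h]) (auto simp: coeffs_in_def is_subring_def)
  also have "\<dots> = poly.coeff (map_poly h p * map_poly h q) k"
    using assms h by (auto simp: coeff_mult coeff_map_hom coeffs_in_def hom_on_def intro!: sum.cong)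
  finally show "poly.coeff (map_poly h (p * q)) k = \<dots>" by (simp add: coeff_map_hom)
qed

lemma map_hom_smult: "c \<in> A \<Longrightarrow> coeffs_in A p \<Longrightarrow> map_poly h (Polynomial.smult c p) = Polynomial.smult (h c) (map_poly h p)"
  using h by (intro poly_eqI) (simp add: coeff_map_hom coeffs_in_def hom_on_def)

lemma map_hom_diff: "coeffs_in A p \<Longrightarrow> coeffs_in A q \<Longrightarrow> map_poly h (p - q) = map_poly h p - map_poly h q"
  by (intro poly_eqI) (simp add: coeff_map_hom coeffs_in_def hom_on_diff[OF A h])

text \<open>The extension sends \<open>x\<close> to \<open>t\<close>. Two polynomials with the same
  value at \<open>x\<close> differ by a relation of \<open>x\<close>, and \<open>t\<close> satisfies
  the image of every relation, so the choice made by \<open>SOME\<close> does not matter.\<close>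

lemma hom_on_adjoinI:
  assumes t: "\<And>p. coeffs_in A p \<Longrightarrow> poly p x = 0 \<Longrightarrow> poly (map_poly h p) t = 0"
  obtains h' where "hom_on (adjoin A x) h'" "\<And>a. a \<in> A \<Longrightarrow> h' a = h a"
    "\<And>p. coeffs_in A p \<Longrightarrow> h' (poly p x) = poly (map_poly h p) t"
proof
  define h' where "h' z = poly (map_poly h (SOME p. coeffs_in A p \<and> z = poly p x)) t" for z
  show *: "h' (poly p x) = poly (map_poly h p) t" if p: "coeffs_in A p" for p
  proof -
    define q where "q = (SOME q. coeffs_in A q \<and> poly p x = poly q x)"
    have "coeffs_in A q \<and> poly p x = poly q x"
      unfolding q_def by (rule someI[of _ p]) (use p in simp)
    then have "poly (map_poly h (p - q)) t = 0"
      using p by (intro t coeffs_in_diff) auto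
    moreover have "h' (poly p x) = poly (map_poly h q) t" by (simp only: h'_def q_def)
    ultimately show ?thesis
      using \<open>coeffs_in A q \<and> _\<close> p by (simp add: map_hom_diff)
  qed
  show const: "h' a = h a" if "a \<in> A" for a
    using *[OF coeffs_in_const[OF that]] by (simp add: map_poly_pCons hom_on_0[OF A h])
  show "hom_on (adjoin A x) h'"
    unfolding hom_on_def
  proof (intro conjI ballI)
    show "h' 1 = 1" using const[of 1] A h by (simp add: is_subring_def hom_on_def)
  next
    fix y z assume "y \<in> adjoin A x" "z \<in> adjoin A x"
    then obtain p q where p: "coeffs_in A p" "y = poly p x" and q: "coeffs_in A q" "z = poly q x"
      by (auto simp: adjoin_def)
    show "h' (y + z) = h' y + h' z" "h' (y * z) = h' y * h' z"
      using *[OF coeffs_in_add[OF p(1) q(1)]] *[OF coeffs_in_mult[OF p(1) q(1)]]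
        *[OF p(1)] *[OF q(1)] p q by (simp_all add: map_hom_add map_hom_mult)
  qed
qed

end

text \<open>The leading coefficient of the divisor need not be invertible in \<open>A\<close>, so
  each reduction step multiplies the dividend by it instead of dividing by it.\<close>

lemma pseudo_division:
  assumes g: "coeffs_in A g" "g \<noteq> 0" and f: "coeffs_in A f"
  shows "\<exists>k q r. coeffs_in A q \<and> coeffs_in A r \<and> Polynomial.smult (lead_coeff g ^ k) f = g * q + r \<and>
    (r = 0 \<or> degree r < degree g)"
  using f
\<comment> \<open>Placing 0 below the constants lets the measure drop also when a constant is
  reduced by a constant, where the degree stays 0.\<close>
proof (induction "if f = 0 then 0 else Suc (degree f)" arbitrary: f rule: less_induct)
  case less
  show ?case
  proof (cases "f = 0 \<or> degree f < degree g")
    case True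
    then show ?thesis
      using less.prems by (intro exI[of _ 0] exI[of _ "0::'a poly"] exI[of _ f]) (auto simp: coeffs_in_0)
  next
    case False
    define m where "m = Polynomial.monom (lead_coeff f) (degree f - degree g)"
    define f1 where "f1 = Polynomial.smult (lead_coeff g) f - g * m"
    have m: "coeffs_in A m"
      unfolding m_def using less.prems by (intro coeffs_in_monom) (auto simp: coeffs_in_def)
    have lg: "lead_coeff g \<in> A" using g by (auto simp: coeffs_in_def)
    have f1: "coeffs_in A f1"
      unfolding f1_def using less.prems g m lg by (intro coeffs_in_diff coeffs_in_mult coeffs_in_smult)
    have le: "degree f1 \<le> degree f"
      unfolding f1_def using False
      by (intro degree_diff_le degree_smult_le order.trans[OF degree_mult_le])
        (auto simp: m_def intro: order.trans[OF add_left_mono[OF degree_monom_le]])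
    have "poly.coeff (g * m) (degree f) = poly.coeff (m * g) (degree f)" by (simp add: mult.commute)
    also have "\<dots> = lead_coeff f * lead_coeff g"
      using False by (simp add: m_def coeff_monom_mult)
    finally have "poly.coeff f1 (degree f) = 0"
      by (simp add: f1_def)
    then have "f1 = 0 \<or> degree f1 < degree f"
      using le by (metis leading_coeff_0_iff le_neq_implies_less)
    then have "(if f1 = 0 then 0 else Suc (degree f1)) < (if f = 0 then 0 else Suc (degree f))"
      using False by auto
    from less.hyps[OF this f1] obtain k q r where *: "coeffs_in A q" "coeffs_in A r"
      "Polynomial.smult (lead_coeff g ^ k) f1 = g * q + r" "r = 0 \<or> degree r < degree g" by blast
    have "Polynomial.smult (lead_coeff g ^ Suc k) f = Polynomial.smult (lead_coeff g ^ k) (f1 + g * m)"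
      by (simp add: f1_def smult_add_right mult.commute)
    also have "\<dots> = g * (q + Polynomial.smult (lead_coeff g ^ k) m) + r"
      using *(3) by (simp add: smult_add_right algebra_simps)
    finally show ?thesis
      using * m lg A by (intro exI[of _ "Suc k"] exI[of _ "q + Polynomial.smult (lead_coeff g ^ k) m"] exI[of _ r])
        (auto intro!: coeffs_in_add coeffs_in_smult subring_power)
  qed
qed

end

text \<open>
  Among the polynomials whose value at \<open>x\<close> is a non-zero multiple of \<open>b\<close>, one of least degree
  turns out to be constant.
\<close>

lemma algebraic_multiple_in_base:
  fixes A :: "'a::idom set"
  assumes A: "is_subring A" and p: "coeffs_in A p" "p \<noteq> 0" "poly p x = 0"
    and min: "\<And>r. coeffs_in A r \<Longrightarrow> r \<noteq> 0 \<Longrightarrow> poly r x = 0 \<Longrightarrow> degree p \<le> degree r"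
    and b: "b \<in> adjoin A x" "b \<noteq> 0"
  shows "\<exists>b'\<in>adjoin A x. b * b' \<in> A \<and> b * b' \<noteq> 0"
proof -
  define P where "P r \<longleftrightarrow> coeffs_in A r \<and> poly r x \<noteq> 0 \<and> (\<exists>b'\<in>adjoin A x. poly r x = b * b')" for r
  have B: "is_subring (adjoin A x)" by (rule is_subring_adjoin[OF A])
  obtain q where q: "coeffs_in A q" "b = poly q x" using b by (auto simp: adjoin_def)
  have "P q" unfolding P_def using q b B by (auto simp: is_subring_def intro!: bexI[of _ 1])
  define r where "r = arg_min degree P"
  have Pr: "P r" and rmin: "\<And>s. P s \<Longrightarrow> degree r \<le> degree s"
    unfolding r_def using arg_min_natI[of P q degree, OF \<open>P q\<close>] arg_min_nat_le[of P _ degree] by auto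
  from Pr obtain b' where b': "b' \<in> adjoin A x" "poly r x = b * b'"
    and rA: "coeffs_in A r" and r0: "poly r x \<noteq> 0" by (auto simp: P_def)
  \<comment> \<open>Otherwise the pseudo-remainder of \<open>r\<close> modulo \<open>p\<close> has
    smaller degree, and its value at \<open>x\<close> is that of \<open>r\<close> times a power of
    the leading coefficient of \<open>p\<close>: still a non-zero multiple of
    \<open>b\<close>.\<close>
  have rlp: "degree r \<le> degree p"
  proof (rule ccontr)
    assume gt: "\<not> ?thesis"
    from pseudo_division[OF A p(1,2) rA] obtain k u v where *: "coeffs_in A u" "coeffs_in A v"
      "Polynomial.smult (lead_coeff p ^ k) r = p * u + v" "v = 0 \<or> degree v < degree p" by blast
    have l: "lead_coeff p ^ k \<in> A" using p(1) by (intro subring_power[OF A]) (auto simp: coeffs_in_def)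
    have "poly v x = lead_coeff p ^ k * poly r x"
      using arg_cong[OF *(3), of "\<lambda>f. poly f x"] p(3) by simp
    then have "poly v x = b * (b' * lead_coeff p ^ k)" "poly v x \<noteq> 0"
      using b'(2) r0 p(2) by (simp_all add: mult_ac)
    then have "P v" unfolding P_def using *(2) b'(1) B l adjoin_superset[OF A, of x]
      by (auto simp: is_subring_def)
    then have "degree r \<le> degree v" by (rule rmin)
    then show False using *(4) gt \<open>poly v x \<noteq> 0\<close> by auto
  qed
  \<comment> \<open>Divide \<open>p\<close> by \<open>r\<close>. The remainder takes a multiple of
    \<open>b\<close> as value, so minimality of \<open>r\<close> makes this value 0 and minimality
    of \<open>p\<close> makes the remainder 0. Then the quotient is a relation of \<open>x\<close>,
    of degree less than \<open>p\<close> unless \<open>r\<close> is constant.\<close>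
  have "degree r = 0"
  proof (rule ccontr)
    assume deg: "degree r \<noteq> 0"
    then have "r \<noteq> 0" by auto
    from pseudo_division[OF A rA this p(1)] obtain k u v where *: "coeffs_in A u" "coeffs_in A v"
      "Polynomial.smult (lead_coeff r ^ k) p = r * u + v" "v = 0 \<or> degree v < degree r" by blast
    have e: "poly r x * poly u x + poly v x = 0"
      using arg_cong[OF *(3), of "\<lambda>f. poly f x"] p(3) by simp
    then have "poly v x = b * (b' * - poly u x)" using b'(2) by (simp add: algebra_simps eq_neg_iff_add_eq_0)
    moreover have nu: "- poly u x \<in> adjoin A x"
      using B adjoin_poly[OF A *(1)] by (auto simp: is_subring_def)
    moreover from nu have "b' * - poly u x \<in> adjoin A x"
      using B b'(1) unfolding is_subring_def by blast
    ultimately have "P v" if "poly v x \<noteq> 0"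
      unfolding P_def using that *(2) by blast
    then have v0: "poly v x = 0" using rmin[of v] *(4) by fastforce
    have "v = 0"
      using min[OF *(2) _ v0] *(4) rlp by linarith
    have ux: "poly u x = 0" using e v0 r0 by simp
    have "Polynomial.smult (lead_coeff r ^ k) p \<noteq> 0" using \<open>r \<noteq> 0\<close> p(2) by simp
    then have u0: "u \<noteq> 0" using *(3) \<open>v = 0\<close> by auto
    have "degree p = degree r + degree u"
      using arg_cong[OF *(3), of degree] \<open>v = 0\<close> \<open>r \<noteq> 0\<close> u0
      by (simp add: degree_mult_eq)
    moreover have "degree p \<le> degree u" by (rule min[OF *(1) u0 ux])
    ultimately show False using deg by simp
  qed
  then obtain c where "r = [:c:]" using degree_eq_zeroE by blast
  then have "b * b' \<in> A" using rA b'(2) by (auto simp: coeffs_in_def dest: spec[of _ 0])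
  then show ?thesis using b' r0 by metis
qed

text \<open>If \<open>x\<close> is transcendental over \<open>A\<close>, \<open>a\<close> is the
  leading coefficient of a polynomial representing \<open>b\<close>, and \<open>x\<close> may go to
  any non-root of its image. If \<open>x\<close> is algebraic, \<open>a\<close> is a non-zero
  multiple \<open>b * b'\<close> of \<open>b\<close> lying in \<open>A\<close>, times the leading
  coefficient of a relation \<open>p\<close> of least degree: the second factor keeps the image of
  \<open>p\<close> non-constant, so that it has a root, and the first keeps the image of
  \<open>b\<close> non-zero.\<close>

lemma extend_hom_adjoin:
  fixes A :: "'a::idom set"
  assumes A: "is_subring A" and b: "b \<in> adjoin A x" "b \<noteq> 0"
  shows "\<exists>a\<in>A. a \<noteq> 0 \<and> (\<forall>h. hom_on A h \<and> h a \<noteq> 0 \<longrightarrow>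
    (\<exists>h'. hom_on (adjoin A x) h' \<and> (\<forall>y\<in>A. h' y = h y) \<and> h' b \<noteq> 0))"
proof (cases "\<exists>p. coeffs_in A p \<and> p \<noteq> 0 \<and> poly p x = 0")
  case False
  obtain q where q: "coeffs_in A q" "b = poly q x" using b by (auto simp: adjoin_def)
  then have "q \<noteq> 0" using b by auto
  show ?thesis
  proof (intro bexI[of _ "lead_coeff q"] conjI allI impI)
    show "lead_coeff q \<noteq> 0" using \<open>q \<noteq> 0\<close> by simp
    show "lead_coeff q \<in> A" using q by (auto simp: coeffs_in_def)
    fix h assume h: "hom_on A h \<and> h (lead_coeff q) \<noteq> 0"
    then have h1: "hom_on A h" by simp
    have "map_poly h q \<noteq> 0"
      using h coeff_map_hom[OF A h1, of q "degree q"] by auto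
    then have "finite {t. poly (map_poly h q) t = 0}" by (rule poly_roots_finite)
    then obtain t where t: "poly (map_poly h q) t \<noteq> 0"
      using infinite_UNIV_char_0 by (metis (mono_tags, lifting) UNIV_I finite_subset mem_Collect_eq subsetI)
    have "poly (map_poly h p) t = 0" if "coeffs_in A p" "poly p x = 0" for p
      using that False by fastforce
    from hom_on_adjoinI[OF A h1 this] obtain h' where "hom_on (adjoin A x) h'"
      "\<And>a. a \<in> A \<Longrightarrow> h' a = h a" "\<And>p. coeffs_in A p \<Longrightarrow> h' (poly p x) = poly (map_poly h p) t"
      by blast
    then show "\<exists>h'. hom_on (adjoin A x) h' \<and> (\<forall>y\<in>A. h' y = h y) \<and> h' b \<noteq> 0"
      using q t by auto
  qed
next
  case True
  define P where "P p \<longleftrightarrow> coeffs_in A p \<and> p \<noteq> 0 \<and> poly p x = 0" for p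
  define p where "p = arg_min degree P"
  from True obtain p0 where "P p0" by (auto simp: P_def)
  have Pp: "P p" and pmin: "\<And>s. P s \<Longrightarrow> degree p \<le> degree s"
    unfolding p_def using arg_min_natI[of P p0 degree, OF \<open>P p0\<close>] arg_min_nat_le[of P _ degree] by auto
  have p: "coeffs_in A p" "p \<noteq> 0" "poly p x = 0" using Pp by (auto simp: P_def)
  have min: "degree p \<le> degree r" if "coeffs_in A r" "r \<noteq> 0" "poly r x = 0" for r
    using that pmin by (auto simp: P_def)
  from algebraic_multiple_in_base[OF A p min b] obtain b' where b': "b' \<in> adjoin A x"
    "b * b' \<in> A" "b * b' \<noteq> 0" by blast
  have lA: "lead_coeff p \<in> A" using p by (auto simp: coeffs_in_def)
  have dp: "degree p > 0"
    using p by (metis degree_eq_zeroE gr0I mult_zero_right poly_0 poly_pCons add.right_neutral pCons_0_0)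
  show ?thesis
  proof (intro bexI[of _ "b * b' * lead_coeff p"] conjI allI impI)
    show "b * b' * lead_coeff p \<in> A" using b' lA A by (auto simp: is_subring_def)
    show "b * b' * lead_coeff p \<noteq> 0" using b' p by simp
    fix h assume h: "hom_on A h \<and> h (b * b' * lead_coeff p) \<noteq> 0"
    then have h1: "hom_on A h" by simp
    have "h (b * b' * lead_coeff p) = h (b * b') * h (lead_coeff p)"
      using h1 b'(2) lA by (auto simp: hom_on_def)
    then have hb: "h (b * b') \<noteq> 0" and hl: "h (lead_coeff p) \<noteq> 0" using h by auto
    have "degree (map_poly h p) \<ge> degree p"
      using hl by (intro le_degree) (simp add: coeff_map_hom[OF A h1])
    then obtain t where t: "poly (map_poly h p) t = 0"
      using fundamental_theorem_of_algebra[of "map_poly h p"] dp by (auto simp: constant_degree)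
    \<comment> \<open>A power of the leading coefficient of \<open>p\<close> times a relation
      \<open>s\<close> is a multiple of \<open>p\<close>, since the pseudo-remainder is a relation
      of smaller degree; \<open>h\<close> does not kill that power.\<close>
    have t': "poly (map_poly h s) t = 0" if s: "coeffs_in A s" "poly s x = 0" for s
    proof -
      from pseudo_division[OF A p(1,2) s(1)] obtain k u v where *: "coeffs_in A u" "coeffs_in A v"
        "Polynomial.smult (lead_coeff p ^ k) s = p * u + v" "v = 0 \<or> degree v < degree p" by blast
      have "poly v x = 0" using arg_cong[OF *(3), of "\<lambda>f. poly f x"] p(3) s(2) by simp
      then have "v = 0" using min[OF *(2)] *(4) by fastforce
      have lk: "lead_coeff p ^ k \<in> A" by (rule subring_power[OF A lA])
      have "Polynomial.smult (h (lead_coeff p ^ k)) (map_poly h s) = map_poly h p * map_poly h u"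
        using arg_cong[OF *(3), of "map_poly h"] \<open>v = 0\<close> map_hom_smult[OF A h1 lk s(1)]
          map_hom_mult[OF A h1 p(1) *(1)] by simp
      then have "h (lead_coeff p ^ k) * poly (map_poly h s) t = 0"
        using t by (metis mult_zero_left poly_mult poly_smult)
      then show ?thesis using hl by (simp add: hom_on_power[OF A h1 lA])
    qed
    from hom_on_adjoinI[OF A h1 t'] obtain h' where h': "hom_on (adjoin A x) h'"
      "\<And>a. a \<in> A \<Longrightarrow> h' a = h a" by blast
    have "h' (b * b') = h' b * h' b'" using h'(1) b(1) b'(1) by (auto simp: hom_on_def)
    then have "h' b \<noteq> 0" using h'(2)[OF b'(2)] hb by auto
    then show "\<exists>h'. hom_on (adjoin A x) h' \<and> (\<forall>y\<in>A. h' y = h y) \<and> h' b \<noteq> 0"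
      using h' by blast
  qed
qed

section \<open>Polynomial functions\<close>

lemma poly_val_0 [simp]: "poly_val x 0 = 0"
  by (simp add: poly_val_def)

lemma poly_val_Const [simp]: "poly_val x (Const c) = c"
  by (simp add: poly_val_single mono_val_zero)

lemma poly_val_1 [simp]: "poly_val x 1 = 1"
  using poly_val_Const[of x 1] by simp

lemma poly_val_Var: "poly_val x (Var v) = x v"
  by (simp add: poly_val_single mono_val_def)

lemma poly_val_Var_Suc [simp]: "poly_val x (single (single v (Suc 0)) 1) = x v"
  using poly_val_Var[of x v] by simp

lemma poly_val_uminus [simp]: "poly_val x (- p) = - poly_val x p"
  using poly_val_add[of x p "- p"] by (simp add: minus_unique)

lemma poly_val_diff: "poly_val x (p - q) = poly_val x p - poly_val x q"
  using poly_val_add[of x p "- q"] by simp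

lemma poly_val_prod: "poly_val x (\<Prod>i\<in>I. p i) = (\<Prod>i\<in>I. poly_val x (p i))"
  by (induction I rule: infinite_finite_induct) (simp_all add: poly_val_mult)

lemma poly_val_power: "poly_val x (p ^ k) = poly_val x p ^ k"
  by (induction k) (simp_all add: poly_val_mult)

lemma poly_val_mono_val: "poly_val x (mono_val \<sigma> m) = mono_val (\<lambda>v. poly_val x (\<sigma> v)) m"
  by (simp add: mono_val_def poly_val_prod poly_val_power)

lemma poly_val_subst: "poly_val x (poly_subst \<sigma> p) = poly_val (\<lambda>v. poly_val x (\<sigma> v)) p"
  unfolding poly_subst_def poly_val_sum poly_val_mult poly_val_mono_val poly_val_Const poly_val_def[of _ p] ..

lemma poly_val_superset:
  assumes "finite K" "keys p \<subseteq> K"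
  shows "poly_val x p = (\<Sum>m\<in>K. lookup p m * mono_val x m)"
  unfolding poly_val_def using assms
  by (intro sum.mono_neutral_left) (auto simp: in_keys_iff)

lemma mono_val_cong: "(\<And>v. v \<in> keys m \<Longrightarrow> x v = y v) \<Longrightarrow> mono_val x m = mono_val y m"
  unfolding mono_val_def by (intro prod.cong) auto

lemma poly_val_at_0: "poly_val (\<lambda>_. 0) p = lookup p 0"
proof -
  have "mono_val (\<lambda>_. 0) m = (if m = 0 then 1 else 0 :: complex)" for m :: "'a \<Rightarrow>\<^sub>0 nat"
  proof (cases "m = 0")
    case False
    then obtain v where "v \<in> keys m" by fastforce
    then show ?thesis using False by (auto simp: mono_val_def in_keys_iff)
  qed (simp add: mono_val_zero)
  then show ?thesis
    by (simp add: poly_val_def if_distrib[of "\<lambda>a. _ * a"] sum.If_cases Int_def in_keys_iff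
        cong: if_cong)
qed

text \<open>Induction on the variables: the sum is a polynomial in the value of the new variable
  that vanishes identically, so each of its coefficients does. Injectivity on the restricted
  exponents, rather than a bound on the supports, is what passes to the monomials sharing one
  exponent of the new variable.\<close>

lemma monomials_independent:
  assumes "finite V" "finite K" "inj_on (\<lambda>m. restrict (lookup m) V) K"
    and "\<And>x::'v \<Rightarrow> complex. (\<Sum>m\<in>K. c m * (\<Prod>v\<in>V. x v ^ lookup m v)) = 0"
    and "m \<in> K"
  shows "c m = 0"
  using assms
proof (induction V arbitrary: K m rule: finite_induct)
  case empty
  then have "K = {m}" by (auto simp: inj_on_def)
  then show ?case using empty by simp
next
  case (insert v V)
  let ?l = lookup
  define K' where "K' = {m' \<in> K. ?l m' v = ?l m v}"
  show ?case
  proof (rule insert.IH)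
    show "finite K'" "m \<in> K'" using insert.prems by (auto simp: K'_def)
    show "inj_on (\<lambda>m. restrict (?l m) V) K'"
    proof (rule inj_onI)
      fix a b assume ab: "a \<in> K'" "b \<in> K'" "restrict (?l a) V = restrict (?l b) V"
      then have "restrict (?l a) (insert v V) = restrict (?l b) (insert v V)"
        by (auto simp: K'_def restrict_def fun_eq_iff split: if_splits)
      then show "a = b" using ab(1,2) by (intro inj_onD[OF insert.prems(2)]) (simp_all add: K'_def)
    qed
    fix x :: "'v \<Rightarrow> complex"
    define q where "q = (\<Sum>m\<in>K. Polynomial.monom (c m * (\<Prod>u\<in>V. x u ^ ?l m u)) (?l m v))"
    have "poly q t = 0" for t
    proof -
      have "poly q t = (\<Sum>m\<in>K. c m * (\<Prod>u\<in>insert v V. (x(v := t)) u ^ ?l m u))"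
        unfolding q_def poly_sum
      proof (intro sum.cong refl)
        fix a assume "a \<in> K"
        have "(\<Prod>u\<in>V. (x(v := t)) u ^ ?l a u) = (\<Prod>u\<in>V. x u ^ ?l a u)"
          using insert.hyps by (intro prod.cong) auto
        then show "poly (Polynomial.monom (c a * (\<Prod>u\<in>V. x u ^ ?l a u)) (?l a v)) t =
            c a * (\<Prod>u\<in>insert v V. (x(v := t)) u ^ ?l a u)"
          using insert.hyps by (simp add: poly_monom mult_ac)
      qed
      then show ?thesis using insert.prems(3) by simp
    qed
    then have "q = 0" using poly_all_0_iff_0 by blast
    then have "0 = poly.coeff q (?l m v)" by simp
    also have "\<dots> = (\<Sum>a\<in>K. if ?l a v = ?l m v then c a * (\<Prod>u\<in>V. x u ^ ?l a u) else 0)"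
      by (simp add: q_def coeff_sum)
    also have "\<dots> = (\<Sum>a\<in>K'. c a * (\<Prod>u\<in>V. x u ^ ?l a u))"
      using insert.prems(1) by (simp add: K'_def sum.inter_filter)
    finally show "(\<Sum>a\<in>K'. c a * (\<Prod>u\<in>V. x u ^ ?l a u)) = 0" by simp
  qed
qed

lemma poly_val_eq_0_imp: "(\<And>x. poly_val x p = 0) \<Longrightarrow> p = 0"
proof -
  assume 0: "\<And>x. poly_val x p = 0"
  let ?l = lookup and ?k = keys
  define V where "V = \<Union> (?k ` ?k p)"
  have "?l p m = 0" if "m \<in> ?k p" for m
  proof (rule monomials_independent[of V "?k p" "?l p"])
    show "finite V" by (simp add: V_def)
    show "inj_on (\<lambda>m. restrict (?l m) V) (?k p)"
    proof (rule inj_onI)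
      fix a b assume *: "a \<in> ?k p" "b \<in> ?k p" and ab: "restrict (?l a) V = restrict (?l b) V"
      show "a = b"
      proof (rule poly_mapping_eqI)
        fix v show "?l a v = ?l b v"
        proof (cases "v \<in> V")
          case True then show ?thesis using fun_cong[OF ab, of v] by simp
        next
          case False
          then have "v \<notin> ?k a" "v \<notin> ?k b" using * by (auto simp: V_def)
          then show ?thesis by (simp add: in_keys_iff)
        qed
      qed
    qed
    fix x :: "'a \<Rightarrow> complex"
    have "(\<Sum>m\<in>?k p. ?l p m * (\<Prod>v\<in>V. x v ^ ?l m v)) = poly_val x p"
      unfolding poly_val_def
    proof (intro sum.cong refl)
      fix m assume "m \<in> ?k p"
      then have "mono_val x m = (\<Prod>v\<in>V. x v ^ ?l m v)"
        by (intro mono_val_superset) (auto simp: V_def)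
      then show "?l p m * (\<Prod>v\<in>V. x v ^ ?l m v) = ?l p m * mono_val x m" by simp
    qed
    then show "(\<Sum>m\<in>?k p. ?l p m * (\<Prod>v\<in>V. x v ^ ?l m v)) = 0" using 0 by simp
  qed (use that in simp_all)
  then show "p = 0" by (metis keys_eq_empty ex_in_conv in_keys_iff)
qed

text \<open>Polynomials over an infinite field are determined by their values; identities about
  substitution are therefore proved by evaluation.\<close>

lemma mpoly_eqI: "(\<And>x. poly_val x p = poly_val x q) \<Longrightarrow> p = q"
  using poly_val_eq_0_imp[of "p - q"] by (simp add: poly_val_diff)

lemma poly_subst_add: "poly_subst \<sigma> (p + q) = poly_subst \<sigma> p + poly_subst \<sigma> q"
  by (rule mpoly_eqI) (simp add: poly_val_subst poly_val_add)

lemma poly_subst_mult: "poly_subst \<sigma> (p * q) = poly_subst \<sigma> p * poly_subst \<sigma> q"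
  by (rule mpoly_eqI) (simp add: poly_val_subst poly_val_mult)

lemma poly_subst_Const [simp]: "poly_subst \<sigma> (Const c) = Const c"
  by (rule mpoly_eqI) (simp add: poly_val_subst)

lemma poly_subst_Var [simp]:
  "poly_subst \<sigma> (single (single v (Suc 0)) 1) = \<sigma> v"
  by (rule mpoly_eqI) (simp add: poly_val_subst)

lemma lookup_mpderiv:
  "lookup (mpderiv v f) m =
    of_nat (lookup m v + 1) * lookup f (m + single v 1)"
proof -
  let ?l = lookup and ?k = keys and ?e = "single v (1::nat)"
  have *: "(of_nat (?l a v) * ?l f a when a - ?e = m) =
      (of_nat (?l a v) * ?l f a when a = m + ?e)" for a
  proof (cases "?l a v = 0")
    case False
    have "a - ?e = m \<longleftrightarrow> a = m + ?e"
    proof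
      assume "a - ?e = m"
      show "a = m + ?e"
        using False unfolding \<open>a - ?e = m\<close>[symmetric]
        by (intro poly_mapping_eqI) (auto simp: lookup_add lookup_minus lookup_single when_def)
    qed simp
    then show ?thesis by (simp add: when_def)
  qed (simp add: when_def)
  have "?l (mpderiv v f) m = (\<Sum>a\<in>?k f. of_nat (?l a v) * ?l f a when a - ?e = m)"
    by (simp add: mpderiv_def lookup_sum lookup_single)
  also have "\<dots> = (\<Sum>a\<in>?k f. if m + ?e = a then of_nat (?l a v) * ?l f a else 0)"
    unfolding * by (intro sum.cong) (auto simp: when_def)
  also have "\<dots> = of_nat (?l (m + ?e) v) * ?l f (m + ?e)"
    by (auto simp: in_keys_iff)
  finally show ?thesis by (simp add: lookup_add)
qed

lemma poly_val_mpderiv: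
  "poly_val x (mpderiv v f) = (\<Sum>m\<in>keys f. of_nat (lookup m v) *
     lookup f m * mono_val x (m - single v 1))"
  by (simp add: mpderiv_def poly_val_sum poly_val_single)

lemma mdeg_superset:
  assumes "finite A" "keys m \<subseteq> A"
  shows "mdeg m = (\<Sum>v\<in>A. lookup m v)"
  unfolding mdeg_def using assms
  by (intro sum.mono_neutral_left) (auto simp: in_keys_iff)

lemma mdeg_single [simp]: "mdeg (single v k) = k"
  by (simp add: mdeg_def)

lemma lookup_le_mdeg: "lookup m v \<le> mdeg m"
proof (cases "v \<in> keys m")
  case True
  then show ?thesis unfolding mdeg_def by (intro member_le_sum) auto
qed (simp add: in_keys_iff)

lemma finite_bounded_monomials:
  assumes "finite I"
  shows "finite {m :: 'v \<Rightarrow>\<^sub>0 nat. keys m \<subseteq> I \<and> (\<forall>v. lookup m v \<le> D)}"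
proof (rule finite_subset)
  let ?S = "{f. (\<forall>x. (x \<in> I \<longrightarrow> f x \<in> {..D}) \<and> (x \<notin> I \<longrightarrow> f x = 0))}"
  show "{m. keys m \<subseteq> I \<and> (\<forall>v. lookup m v \<le> D)} \<subseteq> lookup -` ?S"
    by (auto simp: in_keys_iff)
  show "finite (lookup -` ?S)"
    using assms by (intro finite_vimageI finite_set_of_finite_funs injI) (auto intro: poly_mapping_eqI)
qed

lemma finite_monoms: "finite I \<Longrightarrow> finite (monoms I d)"
  by (rule finite_subset[OF _ finite_bounded_monomials[of I d]])
    (auto simp: monoms_def intro: lookup_le_mdeg)

section \<open>Polynomials in given variables, polynomial functions, homogeneous parts\<close>

definition mpolys_in :: "'v set \<Rightarrow> 'v mpoly set" where
  "mpolys_in I = {p. \<forall>m\<in>keys p. keys m \<subseteq> I}"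

lemma mpolys_in_Const [simp]: "Const c \<in> mpolys_in I"
  by (simp add: mpolys_in_def)

lemma mpolys_in_0 [simp]: "0 \<in> mpolys_in I"
  by (simp add: mpolys_in_def)

lemma mpolys_in_1 [simp]: "1 \<in> mpolys_in I"
  by (simp add: mpolys_in_def)

lemma mpolys_in_Var [simp]: "single (single v (Suc 0)) 1 \<in> mpolys_in I \<longleftrightarrow> v \<in> I"
  by (simp add: mpolys_in_def)

lemma mpolys_in_add: "p \<in> mpolys_in I \<Longrightarrow> q \<in> mpolys_in I \<Longrightarrow> p + q \<in> mpolys_in I"
  using keys_add[of p q] by (auto simp: mpolys_in_def)

lemma mpolys_in_uminus: "p \<in> mpolys_in I \<Longrightarrow> - p \<in> mpolys_in I"
  by (simp add: mpolys_in_def in_keys_iff)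

lemma mpolys_in_mult:
  assumes "p \<in> mpolys_in I" "q \<in> mpolys_in I"
  shows "p * q \<in> mpolys_in I"
  unfolding mpolys_in_def
proof (intro CollectI ballI)
  fix m assume "m \<in> keys (p * q)"
  then obtain a b where "m = a + b" "a \<in> keys p" "b \<in> keys q"
    using Poly_Mapping.keys_mult[of p q] by blast
  then show "keys m \<subseteq> I" using assms Poly_Mapping.keys_add[of a b] by (fastforce simp: mpolys_in_def)
qed

lemma forms_subset_mpolys_in: "forms I d \<subseteq> mpolys_in I"
  by (auto simp: forms_def mpolys_in_def monoms_def)

lemma poly_val_cong:
  assumes "p \<in> mpolys_in I" "\<And>v. v \<in> I \<Longrightarrow> x v = y v"
  shows "poly_val x p = poly_val y p"
  unfolding poly_val_def using assms
  by (intro sum.cong refl arg_cong2[where f = "(*)"] mono_val_cong) (auto simp: mpolys_in_def)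

text \<open>The extensional view yields polynomials for determinants and for coefficients of
  compositions from closure properties, without writing them down.\<close>

definition polyfun :: "'v set \<Rightarrow> (('v \<Rightarrow> complex) \<Rightarrow> complex) \<Rightarrow> bool" where
  "polyfun I \<phi> \<longleftrightarrow> (\<exists>p\<in>mpolys_in I. \<forall>x. \<phi> x = poly_val x p)"

lemma polyfun_const [intro!]: "polyfun I (\<lambda>x. c)"
  unfolding polyfun_def by (intro bexI[of _ "Const c"]) auto

lemma polyfun_var [intro]: "v \<in> I \<Longrightarrow> polyfun I (\<lambda>x. x v)"
  unfolding polyfun_def by (intro bexI[of _ "Var v"]) auto

lemma polyfun_add [intro]: "polyfun I f \<Longrightarrow> polyfun I g \<Longrightarrow> polyfun I (\<lambda>x. f x + g x)"
  unfolding polyfun_def using mpolys_in_add poly_val_add by metis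

lemma polyfun_mult [intro]: "polyfun I f \<Longrightarrow> polyfun I g \<Longrightarrow> polyfun I (\<lambda>x. f x * g x)"
  unfolding polyfun_def using mpolys_in_mult poly_val_mult by metis

lemma polyfun_sum [intro]: "(\<And>i. i \<in> S \<Longrightarrow> polyfun I (f i)) \<Longrightarrow> polyfun I (\<lambda>x. \<Sum>i\<in>S. f i x)"
  by (induction S rule: infinite_finite_induct) auto

lemma polyfun_prod [intro]: "(\<And>i. i \<in> S \<Longrightarrow> polyfun I (f i)) \<Longrightarrow> polyfun I (\<lambda>x. \<Prod>i\<in>S. f i x)"
  by (induction S rule: infinite_finite_induct) auto

definition homog_part :: "nat \<Rightarrow> 'v mpoly \<Rightarrow> 'v mpoly" where
  "homog_part e p = (\<Sum>m | m \<in> keys p \<and> mdeg m = e.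
     single m (lookup p m))"

lemma lookup_homog_part:
  "lookup (homog_part e p) m = (if mdeg m = e then lookup p m else 0)"
proof -
  have "lookup (homog_part e p) m =
      (\<Sum>a | a \<in> keys p \<and> mdeg a = e. if m = a then lookup p a else 0)"
    unfolding homog_part_def lookup_sum lookup_single when_def by (intro sum.cong) auto
  also have "\<dots> = (if m \<in> {a. a \<in> keys p \<and> mdeg a = e} then lookup p m else 0)"
    by (rule sum.delta') simp
  finally show ?thesis by (auto simp: in_keys_iff)
qed

lemma homog_part_in_forms:
  assumes "p \<in> mpolys_in I"
  shows "homog_part e p \<in> forms I e"
  unfolding forms_def monoms_def
proof (intro CollectI, rule subsetI, intro CollectI conjI)
  fix m assume "m \<in> keys (homog_part e p)"
  then have m: "mdeg m = e" "m \<in> keys p"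
    by (simp_all add: in_keys_iff[of m] lookup_homog_part split: if_splits)
  then show "mdeg m = e" by simp
  show "keys m \<subseteq> I" using m assms by (auto simp: mpolys_in_def)
qed

lemma poly_val_homog_parts:
  obtains D where "\<And>x. poly_val x p = (\<Sum>e\<le>D. poly_val x (homog_part e p))"
proof
  fix x
  have "(\<Sum>m | m \<in> keys p \<and> mdeg m = e. lookup p m * mono_val x m) =
      poly_val x (homog_part e p)" for e
    unfolding homog_part_def poly_val_sum poly_val_single ..
  moreover have "(\<Sum>e\<in>{..Max (mdeg ` keys p)}.
      \<Sum>m | m \<in> keys p \<and> mdeg m = e. lookup p m * mono_val x m) = poly_val x p"
    unfolding poly_val_def by (rule sum.group) (simp_all add: image_subset_iff)
  ultimately show "poly_val x p = (\<Sum>e\<le>Max (mdeg ` keys p). poly_val x (homog_part e p))"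
    by simp
qed

section \<open>Dominant polynomial maps\<close>

lemma mpolys_in_prod: "(\<And>i. i \<in> S \<Longrightarrow> f i \<in> mpolys_in I) \<Longrightarrow> (\<Prod>i\<in>S. f i) \<in> mpolys_in I"
  by (induction S rule: infinite_finite_induct) (auto intro: mpolys_in_mult)

lemma mpolys_in_sum: "(\<And>i. i \<in> S \<Longrightarrow> f i \<in> mpolys_in I) \<Longrightarrow> (\<Sum>i\<in>S. f i) \<in> mpolys_in I"
  by (induction S rule: infinite_finite_induct) (auto intro: mpolys_in_add)

lemma mpolys_in_power: "p \<in> mpolys_in I \<Longrightarrow> p ^ k \<in> mpolys_in I"
  by (induction k) (auto intro: mpolys_in_mult)

lemma mpolys_in_subst:
  assumes "p \<in> mpolys_in J" "\<And>v. v \<in> J \<Longrightarrow> \<sigma> v \<in> mpolys_in I"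
  shows "poly_subst \<sigma> p \<in> mpolys_in I"
  unfolding poly_subst_def mono_val_def using assms
  by (intro mpolys_in_sum mpolys_in_mult mpolys_in_prod mpolys_in_power)
    (auto simp: mpolys_in_def[of J])

lemma poly_subst_0 [simp]: "poly_subst \<sigma> 0 = 0"
  by (simp add: poly_subst_def)

lemma poly_subst_1 [simp]: "poly_subst \<sigma> 1 = 1"
  using poly_subst_Const[of \<sigma> 1] by simp

lemma poly_subst_uminus: "poly_subst \<sigma> (- p) = - poly_subst \<sigma> p"
  by (rule mpoly_eqI) (simp add: poly_val_subst)

lemma poly_subst_diff: "poly_subst \<sigma> (p - q) = poly_subst \<sigma> p - poly_subst \<sigma> q"
  by (rule mpoly_eqI) (simp add: poly_val_subst poly_val_diff)

lemma mpolys_in_diff: "p \<in> mpolys_in I \<Longrightarrow> q \<in> mpolys_in I \<Longrightarrow> p - q \<in> mpolys_in I"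
  using mpolys_in_add[of p I "- q"] mpolys_in_uminus[of q I] by simp

lemma is_subring_subst_image: "is_subring (poly_subst \<Phi> ` mpolys_in I)"
  unfolding is_subring_def
proof (intro conjI ballI)
  show "0 \<in> poly_subst \<Phi> ` mpolys_in I" by (rule image_eqI[of _ _ 0]) auto
  show "1 \<in> poly_subst \<Phi> ` mpolys_in I" by (rule image_eqI[of _ _ 1]) auto
next
  fix x assume "x \<in> poly_subst \<Phi> ` mpolys_in I"
  then obtain p where "p \<in> mpolys_in I" "x = poly_subst \<Phi> p" by blast
  then show "- x \<in> poly_subst \<Phi> ` mpolys_in I"
    by (intro image_eqI[of _ _ "- p"]) (simp_all add: poly_subst_uminus mpolys_in_uminus)
next
  fix x y assume "x \<in> poly_subst \<Phi> ` mpolys_in I" "y \<in> poly_subst \<Phi> ` mpolys_in I"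
  then obtain p q where "p \<in> mpolys_in I" "x = poly_subst \<Phi> p" "q \<in> mpolys_in I" "y = poly_subst \<Phi> q"
    by blast
  then show "x + y \<in> poly_subst \<Phi> ` mpolys_in I" "x * y \<in> poly_subst \<Phi> ` mpolys_in I"
    by (intro image_eqI[of _ _ "p + q"] image_eqI[of _ _ "p * q"];
        simp add: poly_subst_add poly_subst_mult mpolys_in_add mpolys_in_mult)+
qed

lemma poly_subst_monomials:
  "poly_subst \<sigma> p = (\<Sum>m\<in>keys p. Const (lookup p m) *
     (\<Prod>v\<in>keys m. \<sigma> v ^ lookup m v))"
  by (simp add: poly_subst_def mono_val_def)

lemma poly_subst_Vars: "poly_subst Var p = p"
  by (rule mpoly_eqI) (simp add: poly_val_subst poly_val_Var)

lemma mpoly_as_Var_sum: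
  "p = (\<Sum>m\<in>keys p. Const (lookup p m) *
     (\<Prod>v\<in>keys m. Var v ^ lookup m v))"
  using poly_subst_Vars[of p] poly_subst_monomials[of Var p] by simp

context
  fixes R :: "'v mpoly set" and I :: "'v set" and p :: "'v mpoly"
  assumes R: "is_subring R" and c: "\<And>c. Const c \<in> R"
    and v: "\<And>v. v \<in> I \<Longrightarrow> Var v \<in> R" and p: "p \<in> mpolys_in I"
begin

lemma subring_monomial:
  assumes "m \<in> keys p"
  shows "(\<Prod>v\<in>keys m. Var v ^ lookup m v) \<in> R"
  using assms p v by (intro subring_prod[OF R] subring_power[OF R]) (auto simp: mpolys_in_def)

lemma subring_term:
  assumes "m \<in> keys p"
  shows "Const (lookup p m) *
    (\<Prod>v\<in>keys m. Var v ^ lookup m v) \<in> R"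
  using subring_monomial[OF assms] c R unfolding is_subring_def by blast

lemma mpolys_in_subring: "p \<in> R"
  by (subst mpoly_as_Var_sum) (rule subring_sum[OF R subring_term])

text \<open>This turns homomorphisms back into points: one that fixes the constants is the
  evaluation at the images of the variables.\<close>

lemma hom_on_mpolys_in:
  assumes h: "hom_on R h" "\<And>c. h (Const c) = c"
  shows "h p = poly_val (\<lambda>v. h (Var v)) p"
proof -
  let ?k = "keys" and ?l = "lookup"
  have "h p = (\<Sum>m\<in>?k p. h (Const (?l p m) * (\<Prod>v\<in>?k m. Var v ^ ?l m v)))"
    by (subst mpoly_as_Var_sum) (rule hom_on_sum[OF R h(1) subring_term])
  also have "\<dots> = poly_val (\<lambda>v. h (Var v)) p"
    unfolding poly_val_def
  proof (intro sum.cong refl)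
    fix m assume m: "m \<in> ?k p"
    have V: "Var v \<in> R" if "v \<in> ?k m" for v
      using m p v that by (auto simp: mpolys_in_def)
    have "h (Const (?l p m) * (\<Prod>v\<in>?k m. Var v ^ ?l m v)) =
        ?l p m * h (\<Prod>v\<in>?k m. Var v ^ ?l m v)"
      using subring_monomial[OF m] c h by (auto simp: hom_on_def)
    also have "h (\<Prod>v\<in>?k m. Var v ^ ?l m v) = (\<Prod>v\<in>?k m. h (Var v ^ ?l m v))"
      using V by (intro hom_on_prod[OF R h(1)] subring_power[OF R])
    also have "\<dots> = mono_val (\<lambda>v. h (Var v)) m"
      unfolding mono_val_def using V by (intro prod.cong refl hom_on_power[OF R h(1)])
    finally show "h (Const (?l p m) * (\<Prod>v\<in>?k m. Var v ^ ?l m v)) =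
        ?l p m * mono_val (\<lambda>v. h (Var v)) m" .
  qed
  finally show ?thesis .
qed

end

text \<open>The elements of \<open>X\<close> are adjoined one at a time; a non-zero element of the
  last ring is traded for one of the ring before it, until \<open>A\<close> is reached.\<close>

lemma extend_hom_adjoin_finite:
  fixes A :: "'a::idom set"
  assumes "finite X" and A: "is_subring A"
  shows "\<exists>R. is_subring R \<and> A \<subseteq> R \<and> X \<subseteq> R \<and>
    (\<forall>b\<in>R. b \<noteq> 0 \<longrightarrow> (\<exists>a\<in>A. a \<noteq> 0 \<and> (\<forall>h. hom_on A h \<and> h a \<noteq> 0 \<longrightarrow>
      (\<exists>h'. hom_on R h' \<and> (\<forall>y\<in>A. h' y = h y) \<and> h' b \<noteq> 0))))"
  using assms(1)
proof (induction X rule: finite_induct)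
  case empty
  show ?case using A by (intro exI[of _ A]) blast
next
  case (insert x X)
  then obtain R where R: "is_subring R" "A \<subseteq> R" "X \<subseteq> R"
    and ext: "\<And>b. b \<in> R \<Longrightarrow> b \<noteq> 0 \<Longrightarrow> \<exists>a\<in>A. a \<noteq> 0 \<and> (\<forall>h. hom_on A h \<and> h a \<noteq> 0 \<longrightarrow>
      (\<exists>h'. hom_on R h' \<and> (\<forall>y\<in>A. h' y = h y) \<and> h' b \<noteq> 0))" by blast
  show ?case
  proof (intro exI[of _ "adjoin R x"] conjI ballI impI)
    show "is_subring (adjoin R x)" by (rule is_subring_adjoin[OF R(1)])
    show "A \<subseteq> adjoin R x" "insert x X \<subseteq> adjoin R x"
      using adjoin_superset[OF R(1), of x] adjoin_generator[OF R(1), of x] R by auto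
    fix b assume "b \<in> adjoin R x" "b \<noteq> 0"
    from extend_hom_adjoin[OF R(1) this] obtain c where c: "c \<in> R" "c \<noteq> 0"
      "\<And>h. hom_on R h \<Longrightarrow> h c \<noteq> 0 \<Longrightarrow>
        \<exists>h'. hom_on (adjoin R x) h' \<and> (\<forall>y\<in>R. h' y = h y) \<and> h' b \<noteq> 0" by blast
    from ext[OF c(1,2)] obtain a where a: "a \<in> A" "a \<noteq> 0"
      "\<And>h. hom_on A h \<Longrightarrow> h a \<noteq> 0 \<Longrightarrow> \<exists>h'. hom_on R h' \<and> (\<forall>y\<in>A. h' y = h y) \<and> h' c \<noteq> 0" by blast
    have "\<exists>h'. hom_on (adjoin R x) h' \<and> (\<forall>y\<in>A. h' y = h y) \<and> h' b \<noteq> 0"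
      if h: "hom_on A h" "h a \<noteq> 0" for h
    proof -
      from a(3)[OF h] obtain h1 where h1: "hom_on R h1" "\<forall>y\<in>A. h1 y = h y" "h1 c \<noteq> 0" by blast
      from c(3)[OF h1(1,3)] obtain h2 where "hom_on (adjoin R x) h2" "\<forall>y\<in>R. h2 y = h1 y" "h2 b \<noteq> 0"
        by blast
      then show ?thesis using h1(2) R(2) by (metis subsetD)
    qed
    then show "\<exists>a\<in>A. a \<noteq> 0 \<and> (\<forall>h. hom_on A h \<and> h a \<noteq> 0 \<longrightarrow>
        (\<exists>h'. hom_on (adjoin R x) h' \<and> (\<forall>y\<in>A. h' y = h y) \<and> h' b \<noteq> 0))"
      using a by blast
  qed
qed

text \<open>Independence makes the ring generated by the \<open>\<Phi> m\<close> a polynomial ring,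
  so every \<open>y\<close> defines a homomorphism on it. Extended to a ring containing the
  variables so that \<open>q\<close> is not killed, it yields a preimage of \<open>y\<close>: the
  images of the variables. \<open>F\<close> expresses the element \<open>a\<close> of the extension
  theorem through the \<open>\<Phi> m\<close>. The order on the variables makes the polynomial ring
  an instance of \<open>idom\<close>.\<close>

lemma polynomial_map_dominant:
  fixes \<Phi> :: "'m \<Rightarrow> ('v::linorder) mpoly"
  assumes I: "finite I" and \<Phi>: "\<And>m. m \<in> M \<Longrightarrow> \<Phi> m \<in> mpolys_in I"
    and indep: "\<And>G. G \<in> mpolys_in M \<Longrightarrow> poly_subst \<Phi> G = 0 \<Longrightarrow> G = 0"
    and q: "q \<in> mpolys_in I" "q \<noteq> 0"
  shows "\<exists>F\<in>mpolys_in M. F \<noteq> 0 \<and> (\<forall>y. poly_val y F \<noteq> 0 \<longrightarrow>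
    (\<exists>z. (\<forall>m\<in>M. poly_val z (\<Phi> m) = y m) \<and> poly_val z q \<noteq> 0))"
proof -
  define A where "A = poly_subst \<Phi> ` mpolys_in M"
  have A: "is_subring A" unfolding A_def by (rule is_subring_subst_image)
  have inj: "G = G'" if "G \<in> mpolys_in M" "G' \<in> mpolys_in M" "poly_subst \<Phi> G = poly_subst \<Phi> G'" for G G'
  proof -
    have "poly_subst \<Phi> (G - G') = 0" using that(3) by (simp add: poly_subst_diff)
    then have "G - G' = 0" by (rule indep[OF mpolys_in_diff[OF that(1,2)]])
    then show ?thesis by simp
  qed
  from extend_hom_adjoin_finite[OF finite_imageI[OF I, of Var] A]
  obtain R where R: "is_subring R" "A \<subseteq> R" "Var ` I \<subseteq> R"
    and ext: "\<forall>b\<in>R. b \<noteq> 0 \<longrightarrow> (\<exists>a\<in>A. a \<noteq> 0 \<and> (\<forall>h. hom_on A h \<and> h a \<noteq> 0 \<longrightarrow>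
      (\<exists>h'. hom_on R h' \<and> (\<forall>y\<in>A. h' y = h y) \<and> h' b \<noteq> 0)))" by (elim exE conjE)
  have cA: "Const c \<in> A" for c
    unfolding A_def by (rule image_eqI[of _ _ "Const c"]) simp_all
  have cR: "Const c \<in> R" for c using cA R(2) by blast
  have VR: "Var v \<in> R" if "v \<in> I" for v using R(3) that by blast
  from ext[rule_format, OF mpolys_in_subring[OF R(1) cR VR q(1)] q(2)] obtain a where a: "a \<in> A" "a \<noteq> 0"
    "\<And>h. hom_on A h \<Longrightarrow> h a \<noteq> 0 \<Longrightarrow> \<exists>h'. hom_on R h' \<and> (\<forall>y\<in>A. h' y = h y) \<and> h' q \<noteq> 0" by blast
  from a(1) obtain F where F: "F \<in> mpolys_in M" "a = poly_subst \<Phi> F" by (auto simp: A_def)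
  show ?thesis
  proof (intro bexI[of _ F] conjI allI impI)
    show "F \<noteq> 0" using a F by auto
    show "F \<in> mpolys_in M" by (rule F)
    fix y assume y: "poly_val y F \<noteq> 0"
    define h where "h g = poly_val y (SOME G. G \<in> mpolys_in M \<and> g = poly_subst \<Phi> G)" for g
    have h: "h (poly_subst \<Phi> G) = poly_val y G" if "G \<in> mpolys_in M" for G
    proof -
      have "(SOME G'. G' \<in> mpolys_in M \<and> poly_subst \<Phi> G = poly_subst \<Phi> G') = G"
      proof (rule some_equality)
        fix G' assume "G' \<in> mpolys_in M \<and> poly_subst \<Phi> G = poly_subst \<Phi> G'"
        then show "G' = G" using inj[of G' G] that by simp
      qed (use that in simp)
      then show ?thesis by (simp add: h_def)
    qed
    have "hom_on A h"
      unfolding hom_on_def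
    proof (intro conjI ballI)
      show "h 1 = 1" using h[of 1] by simp
      fix g g' assume "g \<in> A" "g' \<in> A"
      then obtain G G' where G: "G \<in> mpolys_in M" "g = poly_subst \<Phi> G"
        "G' \<in> mpolys_in M" "g' = poly_subst \<Phi> G'" by (auto simp: A_def)
      have "h (g + g') = poly_val y (G + G')" "h (g * g') = poly_val y (G * G')"
        using h[OF mpolys_in_add[OF G(1,3)]] h[OF mpolys_in_mult[OF G(1,3)]] G(2,4)
        by (simp_all add: poly_subst_add poly_subst_mult)
      then show "h (g + g') = h g + h g'" "h (g * g') = h g * h g'"
        using h[OF G(1)] h[OF G(3)] G(2,4) by (simp_all add: poly_val_add poly_val_mult)
    qed
    moreover have "h a \<noteq> 0" using h[OF F(1)] F(2) y by simp
    ultimately obtain h' where h': "hom_on R h'" "\<forall>y\<in>A. h' y = h y" "h' q \<noteq> 0" using a(3) by blast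
    have c: "h' (Const c) = c" for c
      using h'(2) cA h[of "Const c"] by simp
    have val: "h' p = poly_val (\<lambda>v. h' (Var v)) p" if "p \<in> mpolys_in I" for p
      by (rule hom_on_mpolys_in[OF R(1) cR VR that h'(1) c])
    show "\<exists>z. (\<forall>m\<in>M. poly_val z (\<Phi> m) = y m) \<and> poly_val z q \<noteq> 0"
    proof (intro exI[of _ "\<lambda>v. h' (Var v)"] conjI ballI)
      show "poly_val (\<lambda>v. h' (Var v)) q \<noteq> 0" using val[OF q(1)] h'(3) by metis
      fix m assume m: "m \<in> M"
      have V: "Var m \<in> mpolys_in M" using m by simp
      have "\<Phi> m \<in> A" unfolding A_def by (rule image_eqI[OF _ V]) simp
      moreover have "h (\<Phi> m) = y m" using h[OF V] by simp
      ultimately show "poly_val (\<lambda>v. h' (Var v)) (\<Phi> m) = y m"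
        using val[OF \<Phi>[OF m]] h'(2) by metis
    qed
  qed
qed

text \<open>
  A relation between the \<open>\<Phi> m\<close>, expanded at the image of \<open>z\<close>, has a non-zero homogeneous part of
  lowest degree, which would vanish on the image of the derivative.
\<close>

lemma algebraically_independent_of_derivative:
  fixes \<Phi> :: "'m \<Rightarrow> 'v mpoly"
  assumes surj: "\<And>y :: 'm \<Rightarrow> complex. \<exists>w. \<forall>m\<in>M.
      ((\<lambda>t. poly_val (\<lambda>v. z v + t * w v) (\<Phi> m)) has_field_derivative y m) (at 0)"
    and G: "G \<in> mpolys_in M" "poly_subst \<Phi> G = 0"
  shows "G = 0"
proof (rule ccontr)
  assume "G \<noteq> 0"
  define y0 where "y0 m = poly_val z (\<Phi> m)" for m
  define H where "H = poly_subst (\<lambda>m. Const (y0 m) + Var m) G"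
  have Hval: "poly_val y H = poly_val (\<lambda>m. y0 m + y m) G" for y
    by (simp add: H_def poly_val_subst poly_val_add poly_val_Var)
  have HM: "H \<in> mpolys_in M"
    unfolding H_def using G by (intro mpolys_in_subst[of G M]) (auto intro!: mpolys_in_add)
  obtain D where D: "\<And>y. poly_val y H = (\<Sum>e\<le>D. poly_val y (homog_part e H))"
    using poly_val_homog_parts by blast
  define P where "P e \<longleftrightarrow> homog_part e H \<noteq> 0" for e
  have "\<exists>e\<le>D. P e"
  proof (rule ccontr)
    assume "\<not> (\<exists>e\<le>D. P e)"
    then have "poly_val y H = 0" for y using D[of y] by (simp add: P_def)
    then have "poly_val y G = 0" for y using Hval[of "\<lambda>m. y m - y0 m"] by simp
    then show False using \<open>G \<noteq> 0\<close> poly_val_eq_0_imp by blast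
  qed
  then obtain e0 where "e0 \<le> D" "P e0" by blast
  define k where "k = (LEAST e. P e)"
  have "P k" using \<open>P e0\<close> unfolding k_def by (rule LeastI)
  have "k \<le> D" using Least_le[of P e0] \<open>P e0\<close> \<open>e0 \<le> D\<close> by (simp add: k_def)
  have below: "homog_part e H = 0" if "e < k" for e
    using not_less_Least[of e P] that by (auto simp: k_def P_def)
  from \<open>P k\<close> obtain y1 where y1: "poly_val y1 (homog_part k H) \<noteq> 0"
    unfolding P_def using poly_val_eq_0_imp by blast
  obtain w where w: "\<And>m. m \<in> M \<Longrightarrow>
      ((\<lambda>t. poly_val (\<lambda>v. z v + t * w v) (\<Phi> m)) has_field_derivative y1 m) (at 0)"
    using surj[of y1] by blast
  \<comment> \<open>The difference quotient of the map along \<open>w\<close> tends to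
    \<open>y1\<close>. Dividing the relation by \<open>t ^ k\<close> and letting \<open>t\<close>
    tend to 0 isolates the lowest homogeneous part at \<open>y1\<close>.\<close>
  define \<delta> where "\<delta> t m = (poly_val (\<lambda>v. z v + t * w v) (\<Phi> m) - y0 m) / t" for t m
  have \<delta>: "((\<lambda>t. \<delta> t m) \<longlongrightarrow> y1 m) (at 0)" if "m \<in> M" for m
    using w[OF that] by (simp add: has_field_derivative_iff \<delta>_def y0_def)
  have lim: "((\<lambda>t. poly_val (\<delta> t) (homog_part e H)) \<longlongrightarrow> poly_val y1 (homog_part e H)) (at 0)" for e
    unfolding poly_val_def mono_val_def
  proof (intro tendsto_sum tendsto_mult tendsto_const tendsto_prod tendsto_power \<delta>)
    fix a v assume "a \<in> keys (homog_part e H)" "v \<in> keys a"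
    then show "v \<in> M"
      using homog_part_in_forms[OF HM, of e] by (auto simp: forms_def monoms_def)
  qed
  have "((\<lambda>t. \<Sum>e\<in>{k..D}. t ^ (e - k) * poly_val (\<delta> t) (homog_part e H)) \<longlongrightarrow>
      (\<Sum>e\<in>{k..D}. 0 ^ (e - k) * poly_val y1 (homog_part e H))) (at 0)"
    by (intro tendsto_sum tendsto_mult tendsto_power tendsto_ident_at lim)
  also have "(\<Sum>e\<in>{k..D}. 0 ^ (e - k) * poly_val y1 (homog_part e H)) =
      (\<Sum>e\<in>{k..D}. if k = e then poly_val y1 (homog_part e H) else 0)"
    by (intro sum.cong) auto
  also have "\<dots> = poly_val y1 (homog_part k H)"
    using \<open>k \<le> D\<close> by simp
  finally have lim_k: "((\<lambda>t. \<Sum>e\<in>{k..D}. t ^ (e - k) * poly_val (\<delta> t) (homog_part e H)) \<longlongrightarrow>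
      poly_val y1 (homog_part k H)) (at 0)" .
  have "(\<Sum>e\<in>{k..D}. t ^ (e - k) * poly_val (\<delta> t) (homog_part e H)) = 0" if "t \<noteq> 0" for t
  proof -
    have "0 = poly_val (\<lambda>v. z v + t * w v) (poly_subst \<Phi> G)" using G by simp
    also have "\<dots> = poly_val (\<lambda>m. t * \<delta> t m) H"
      using that by (simp add: poly_val_subst Hval \<delta>_def)
    also have "\<dots> = (\<Sum>e\<le>D. t ^ e * poly_val (\<delta> t) (homog_part e H))"
      unfolding D using homog_part_in_forms[OF HM] by (intro sum.cong refl poly_val_scale)
    also have "\<dots> = (\<Sum>e\<in>{k..D}. t ^ e * poly_val (\<delta> t) (homog_part e H))"
      using below by (intro sum.mono_neutral_right) auto
    also have "\<dots> = t ^ k * (\<Sum>e\<in>{k..D}. t ^ (e - k) * poly_val (\<delta> t) (homog_part e H))"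
      unfolding sum_distrib_left
    proof (intro sum.cong refl)
      fix e assume "e \<in> {k..D}"
      then have "t ^ e = t ^ k * t ^ (e - k)" by (simp flip: power_add)
      then show "t ^ e * poly_val (\<delta> t) (homog_part e H) =
          t ^ k * (t ^ (e - k) * poly_val (\<delta> t) (homog_part e H))" by simp
    qed
    finally show ?thesis using that by simp
  qed
  then have "((\<lambda>t. \<Sum>e\<in>{k..D}. t ^ (e - k) * poly_val (\<delta> t) (homog_part e H)) \<longlongrightarrow> 0) (at 0)"
    by (intro tendsto_eventually) (auto simp: eventually_at_filter)
  then have "poly_val y1 (homog_part k H) = 0"
    using tendsto_unique[OF at_neq_bot lim_k] by simp
  then show False using y1 by contradiction
qed

section \<open>Images of small dimension\<close>

text \<open>Gaussian elimination: one equation is solved for a pivot unknown \<open>s0\<close> and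
  substituted into the others, which keeps the surplus of unknowns.\<close>

lemma more_unknowns_than_equations:
  fixes a :: "'s \<Rightarrow> 't \<Rightarrow> complex"
  assumes "finite T" "finite S" "card T < card S"
  shows "\<exists>c. (\<exists>s\<in>S. c s \<noteq> 0) \<and> (\<forall>t\<in>T. (\<Sum>s\<in>S. c s * a s t) = 0)"
  using assms
proof (induction T arbitrary: S a rule: finite_induct)
  case empty
  then obtain s where "s \<in> S" by fastforce
  then show ?case by (intro exI[of _ "\<lambda>_. 1"]) auto
next
  case (insert t T)
  show ?case
  proof (cases "\<exists>s\<in>S. a s t \<noteq> 0")
    case False
    have "card T < card S" using insert.hyps insert.prems by simp
    from insert.IH[OF insert.prems(1) this, of a] obtain c where
      "\<exists>s\<in>S. c s \<noteq> 0" "\<forall>t\<in>T. (\<Sum>s\<in>S. c s * a s t) = 0" by blast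
    then show ?thesis using False by (intro exI[of _ c]) auto
  next
    case True
    then obtain s0 where s0: "s0 \<in> S" "a s0 t \<noteq> 0" by blast
    define a' where "a' s u = a s u - a s t / a s0 t * a s0 u" for s u
    have "card T < card (S - {s0})" using insert.hyps insert.prems s0 by simp
    from insert.IH[OF _ this, of a'] insert.prems obtain c where
      c: "\<exists>s\<in>S - {s0}. c s \<noteq> 0" "\<forall>u\<in>T. (\<Sum>s\<in>S - {s0}. c s * a' s u) = 0" by auto
    define k where "k = - (\<Sum>s\<in>S - {s0}. c s * a s t) / a s0 t"
    have sum: "(\<Sum>s\<in>S. (c(s0 := k)) s * a s u) = (\<Sum>s\<in>S - {s0}. c s * a' s u)" for u
    proof -
      have "(\<Sum>s\<in>S. (c(s0 := k)) s * a s u) = k * a s0 u + (\<Sum>s\<in>S - {s0}. c s * a s u)"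
        using insert.prems s0 by (simp add: sum.remove[of S s0])
      also have "k * a s0 u = - (\<Sum>s\<in>S - {s0}. c s * (a s t / a s0 t * a s0 u))"
        by (simp add: k_def sum_distrib_left sum_distrib_right sum_divide_distrib mult_ac)
      finally show ?thesis by (simp add: a'_def right_diff_distrib sum_subtractf)
    qed
    have "a' s t = 0" for s using s0 by (simp add: a'_def)
    then have "\<forall>u\<in>insert t T. (\<Sum>s\<in>S. (c(s0 := k)) s * a s u) = 0"
      unfolding sum using c(2) by auto
    moreover have "\<exists>s\<in>S. (c(s0 := k)) s \<noteq> 0" using c(1) by auto
    ultimately show ?thesis by blast
  qed
qed

text \<open>The rows \<open>a r\<close> are independent, so each of them eliminates one unknown: row
  \<open>r\<close> is solved for a pivot \<open>m0\<close>, and the pivot column is cleared in the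
  other rows. \<open>K\<close> collects the unknowns that remain free.\<close>

lemma kernel_parametrization:
  fixes a :: "'r \<Rightarrow> 'm \<Rightarrow> complex"
  assumes "finite R" "finite M"
    and "\<And>b. \<forall>m\<in>M. (\<Sum>r\<in>R. b r * a r m) = 0 \<Longrightarrow> \<forall>r\<in>R. b r = 0"
  shows "\<exists>K \<theta>. K \<subseteq> M \<and> card K + card R = card M \<and>
    (\<forall>c. (\<forall>r\<in>R. (\<Sum>m\<in>M. a r m * c m) = 0) \<longrightarrow> (\<forall>m\<in>M. c m = (\<Sum>k\<in>K. \<theta> m k * c k)))"
  using assms
proof (induction R arbitrary: M a rule: finite_induct)
  case empty
  have "c m = (\<Sum>k\<in>M. (if k = m then 1 else 0) * c k)" if "m \<in> M" for m :: 'm and c :: "'m \<Rightarrow> complex"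
    using that empty(1) by (simp add: if_distrib[of "\<lambda>x. x * _"] cong: if_cong)
  then show ?case
    by (intro exI[of _ M] exI[of _ "\<lambda>m k. if k = m then 1 else 0"]) auto
next
  case (insert r R)
  have "\<exists>m0\<in>M. a r m0 \<noteq> 0"
  proof (rule ccontr)
    assume *: "\<not> ?thesis"
    have "\<forall>s\<in>insert r R. (if s = r then 1 else 0 :: complex) = 0"
    proof (rule insert.prems(2), rule ballI)
      fix m assume "m \<in> M"
      then show "(\<Sum>s\<in>insert r R. (if s = r then 1 else 0) * a s m) = 0"
        using * by (intro sum.neutral) auto
    qed
    then show False by auto
  qed
  then obtain m0 where m0: "m0 \<in> M" "a r m0 \<noteq> 0" by blast
  define a' where "a' s m = a s m - a s m0 / a r m0 * a r m" for s m
  have a'0: "a' s m0 = 0" for s using m0 by (simp add: a'_def)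
  have "\<exists>K \<theta>. K \<subseteq> M - {m0} \<and> card K + card R = card (M - {m0}) \<and>
    (\<forall>c. (\<forall>s\<in>R. (\<Sum>m\<in>M - {m0}. a' s m * c m) = 0) \<longrightarrow>
      (\<forall>m\<in>M - {m0}. c m = (\<Sum>k\<in>K. \<theta> m k * c k)))"
  proof (rule insert.IH)
    fix b assume b: "\<forall>m\<in>M - {m0}. (\<Sum>s\<in>R. b s * a' s m) = 0"
    \<comment> \<open>A relation among the reduced rows becomes one among the original rows; the
      coefficient of row \<open>r\<close> accounts for what was subtracted.\<close>
    define b' where "b' = b(r := - (\<Sum>s\<in>R. b s * a s m0) / a r m0)"
    have "\<forall>s\<in>insert r R. b' s = 0"
    proof (rule insert.prems(2), rule ballI)
      fix m assume "m \<in> M"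
      have "(\<Sum>s\<in>R. b' s * a s m) = (\<Sum>s\<in>R. b s * a s m)"
        using insert.hyps by (intro sum.cong) (auto simp: b'_def)
      then have "(\<Sum>s\<in>insert r R. b' s * a s m) = b' r * a r m + (\<Sum>s\<in>R. b s * a s m)"
        using insert.hyps by simp
      also have "b' r * a r m = - (\<Sum>s\<in>R. b s * (a s m0 / a r m0 * a r m))"
        by (simp add: b'_def sum_distrib_left sum_distrib_right sum_divide_distrib mult_ac)
      also have "\<dots> + (\<Sum>s\<in>R. b s * a s m) = (\<Sum>s\<in>R. b s * a' s m)"
        by (simp add: a'_def right_diff_distrib sum_subtractf)
      also have "\<dots> = 0" using b \<open>m \<in> M\<close> a'0 by (cases "m = m0") auto
      finally show "(\<Sum>s\<in>insert r R. b' s * a s m) = 0" .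
    qed
    then show "\<forall>s\<in>R. b s = 0" using insert.hyps by (auto simp: b'_def split: if_splits)
  qed (use insert.prems in simp)
  then obtain K \<theta> where K: "K \<subseteq> M - {m0}" "card K + card R = card (M - {m0})"
    and \<theta>: "\<forall>c. (\<forall>s\<in>R. (\<Sum>m\<in>M - {m0}. a' s m * c m) = 0) \<longrightarrow>
      (\<forall>m\<in>M - {m0}. c m = (\<Sum>k\<in>K. \<theta> m k * c k))" by (elim exE conjE)
  define \<theta>' where "\<theta>' = \<theta>(m0 := \<lambda>k. - (\<Sum>m\<in>M - {m0}. a r m * \<theta> m k) / a r m0)"
  have "c m = (\<Sum>k\<in>K. \<theta>' m k * c k)"
    if c: "\<forall>s\<in>insert r R. (\<Sum>m\<in>M. a s m * c m) = 0" and m: "m \<in> M" for c m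
  proof -
    have rem: "(\<Sum>m\<in>M. f m) = f m0 + (\<Sum>m\<in>M - {m0}. f m)" for f :: "'m \<Rightarrow> complex"
      using insert.prems(1) m0(1) by (rule sum.remove)
    have "(\<Sum>m\<in>M - {m0}. a' s m * c m) = 0" if "s \<in> R" for s
    proof -
      have "(\<Sum>m\<in>M - {m0}. a' s m * c m) = (\<Sum>m\<in>M. a' s m * c m)"
        using rem[of "\<lambda>m. a' s m * c m"] a'0 by simp
      also have "\<dots> = (\<Sum>m\<in>M. a s m * c m) - a s m0 / a r m0 * (\<Sum>m\<in>M. a r m * c m)"
        by (simp add: a'_def left_diff_distrib sum_subtractf sum_distrib_left mult.assoc)
      finally show ?thesis using c that by simp
    qed
    then have c': "c m = (\<Sum>k\<in>K. \<theta> m k * c k)" if "m \<in> M - {m0}" for m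
      using \<theta>[rule_format, OF _ that] by blast
    show ?thesis
    proof (cases "m = m0")
      case False
      then show ?thesis using c'[of m] m by (simp add: \<theta>'_def)
    next
      case True
      have "a r m0 * c m0 = - (\<Sum>m\<in>M - {m0}. a r m * c m)"
        using c rem[of "\<lambda>m. a r m * c m"] by (simp add: eq_neg_iff_add_eq_0)
      also have "(\<Sum>m\<in>M - {m0}. a r m * c m) = (\<Sum>m\<in>M - {m0}. a r m * (\<Sum>k\<in>K. \<theta> m k * c k))"
        using c' by (intro sum.cong) auto
      also have "\<dots> = (\<Sum>k\<in>K. (\<Sum>m\<in>M - {m0}. a r m * \<theta> m k) * c k)"
        by (simp add: sum_distrib_left sum_distrib_right mult.assoc)
          (rule sum.swap)
      finally have "c m0 = - (\<Sum>k\<in>K. (\<Sum>m\<in>M - {m0}. a r m * \<theta> m k) * c k) / a r m0"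
        using m0(2) by (simp add: field_simps)
      then show ?thesis
        using True by (simp add: \<theta>'_def sum_negf sum_divide_distrib[of _ K])
    qed
  qed
  moreover have "card K + card (insert r R) = card M"
    using K(2) insert.hyps insert.prems(1) m0(1) by (simp add: card_Diff_singleton)
      (metis Suc_pred card_gt_0_iff empty_iff)
  ultimately show ?case using K(1) by (intro exI[of _ K] exI[of _ \<theta>']) blast
qed

section \<open>Counting monomials by exponent boxes\<close>

lemma lookup_sum_single:
  "finite I \<Longrightarrow> lookup (\<Sum>i\<in>I. single i (f i)) v = (if v \<in> I then f v else 0)"
  by (simp add: lookup_sum lookup_single when_def)

lemma card_exponent_box:
  assumes "finite I" "0 < D"
  shows "card {m :: 'v \<Rightarrow>\<^sub>0 nat. keys m \<subseteq> I \<and> (\<forall>v. lookup m v < D)} = D ^ card I"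
    (is "card ?B = _")
proof -
  have "bij_betw (\<lambda>m. restrict (lookup m) I) ?B (PiE I (\<lambda>_. {..<D}))"
    unfolding bij_betw_def
  proof
    show "inj_on (\<lambda>m. restrict (lookup m) I) ?B"
    proof (rule inj_onI)
      fix a b assume *: "a \<in> ?B" "b \<in> ?B"
        "restrict (lookup a) I = restrict (lookup b) I"
      show "a = b"
      proof (rule poly_mapping_eqI)
        fix v show "lookup a v = lookup b v"
        proof (cases "v \<in> I")
          case True then show ?thesis using fun_cong[OF *(3), of v] by simp
        next
          case False
          then have "v \<notin> keys a" "v \<notin> keys b" using * by auto
          then show ?thesis by (simp add: in_keys_iff)
        qed
      qed
    qed
    show "(\<lambda>m. restrict (lookup m) I) ` ?B = PiE I (\<lambda>_. {..<D})"
    proof (intro equalityI subsetI)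
      fix f assume f: "f \<in> PiE I (\<lambda>_. {..<D})"
      let ?m = "\<Sum>i\<in>I. single i (f i)"
      have l: "lookup ?m v = (if v \<in> I then f v else 0)" for v
        by (rule lookup_sum_single[OF assms(1)])
      have "keys ?m \<subseteq> I"
        by (auto simp: in_keys_iff l simp del: lookup_not_eq_zero_eq_in_keys split: if_splits)
      moreover have "\<forall>v. lookup ?m v < D" using f assms(2) by (auto simp: l PiE_def Pi_def)
      moreover have "f = restrict (lookup ?m) I"
        using f by (auto simp: fun_eq_iff restrict_def l PiE_def extensional_def)
      ultimately show "f \<in> (\<lambda>m. restrict (lookup m) I) ` ?B" by blast
    qed auto
  qed
  then have "card ?B = card (PiE I (\<lambda>_. {..<D}))" by (rule bij_betw_same_card)
  then show ?thesis using assms by (simp add: card_PiE)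
qed

text \<open>Bounding each exponent separately, instead of the total degree, makes the sets of
  monomials boxes whose sizes are exact powers.\<close>

definition exponents_le :: "nat \<Rightarrow> 'v mpoly set" where
  "exponents_le D = {p. \<forall>m\<in>keys p. \<forall>v. lookup m v \<le> D}"

lemma exponents_le_mult:
  assumes "p \<in> exponents_le D" "q \<in> exponents_le E"
  shows "p * q \<in> exponents_le (D + E)"
  unfolding exponents_le_def
proof (intro CollectI ballI allI)
  fix m v assume "m \<in> keys (p * q)"
  then obtain a b where "m = a + b" "a \<in> keys p" "b \<in> keys q"
    using Poly_Mapping.keys_mult[of p q] by blast
  then show "lookup m v \<le> D + E"
    using assms by (auto simp: exponents_le_def lookup_add intro!: add_mono)
qed

lemma exponents_le_mono: "p \<in> exponents_le D \<Longrightarrow> D \<le> E \<Longrightarrow> p \<in> exponents_le E"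
  unfolding exponents_le_def using le_trans by blast

lemma exponents_le_power:
  assumes "p \<in> exponents_le D"
  shows "p ^ k \<in> exponents_le (k * D)"
proof (induction k)
  case 0
  show ?case by (simp add: exponents_le_def)
next
  case (Suc k)
  show ?case using exponents_le_mult[OF assms Suc.IH] by simp
qed

lemma exponents_le_prod:
  assumes "finite I" "\<And>i. i \<in> I \<Longrightarrow> f i \<in> exponents_le D"
  shows "(\<Prod>i\<in>I. f i) \<in> exponents_le (card I * D)"
  using assms
proof (induction I rule: finite_induct)
  case empty
  show ?case by (simp add: exponents_le_def)
next
  case (insert i I)
  have "f i * (\<Prod>i\<in>I. f i) \<in> exponents_le (D + card I * D)"
    using insert by (intro exponents_le_mult) auto
  then show ?case using insert.hyps by simp
qed

lemma exponents_le_exists: "\<exists>D. p \<in> exponents_le D"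
proof
  show "p \<in> exponents_le (Max (mdeg ` keys p))"
    unfolding exponents_le_def
    by (auto intro: order.trans[OF lookup_le_mdeg])
qed

text \<open>
  Monomials of exponents below \<open>D\<close> in the \<open>\<Psi> i\<close> number \<open>D ^ card I\<close>, but lie in a space whose
  dimension grows only like \<open>D ^ card J\<close>.
\<close>

lemma polynomial_image_thin:
  fixes \<Psi> :: "'i \<Rightarrow> 'j mpoly"
  assumes I: "finite I" and J: "finite J" and lt: "card J < card I"
    and \<Psi>: "\<And>i. i \<in> I \<Longrightarrow> \<Psi> i \<in> mpolys_in J"
  shows "\<exists>F\<in>mpolys_in I. F \<noteq> 0 \<and> (\<forall>z. poly_val (\<lambda>i. poly_val z (\<Psi> i)) F = 0)"
proof -
  let ?l = lookup and ?k = keys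
  have "\<forall>i. \<exists>D. \<Psi> i \<in> exponents_le D" using exponents_le_exists by blast
  then obtain e where e: "\<And>i. \<Psi> i \<in> exponents_le (e i)" by metis
  define E where "E = Max (e ` I)"
  have E: "\<Psi> i \<in> exponents_le E" if "i \<in> I" for i
    using that I by (intro exponents_le_mono[OF e]) (simp add: E_def)
  \<comment> \<open>Products of powers of the \<open>\<Psi> i\<close> have exponents at most
    \<open>B\<close>, and \<open>B + 1 \<le> C * D\<close>. Since \<open>D\<close> exceeds
    \<open>C ^ card J\<close>, the box \<open>T\<close> with \<open>(B + 1) ^ card J\<close>
    elements is smaller than \<open>D ^ Suc (card J)\<close>, hence smaller than
    \<open>S\<close>.\<close>
  define C where "C = card I * E + 1"
  define D where "D = C ^ card J + 1"
  define S where "S = {m. ?k m \<subseteq> I \<and> (\<forall>v. ?l m v < D)}"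
  define B where "B = card I * (D * E)"
  define T where "T = {m. ?k m \<subseteq> J \<and> (\<forall>v. ?l m v < B + 1)}"
  have D0: "0 < D" by (simp add: D_def)
  have cS: "card S = D ^ card I" unfolding S_def by (rule card_exponent_box[OF I D0])
  have cT: "card T = (B + 1) ^ card J" unfolding T_def by (rule card_exponent_box[OF J]) simp
  have fin: "finite S" "finite T"
    using finite_bounded_monomials[OF I, of D] finite_bounded_monomials[OF J, of "B + 1"]
    by (auto simp: S_def T_def elim!: rev_finite_subset intro: less_imp_le)
  have "B + 1 \<le> C * D" using D0 by (simp add: B_def C_def algebra_simps)
  then have "card T \<le> (C * D) ^ card J" unfolding cT by (rule power_mono) simp
  also have "\<dots> = C ^ card J * D ^ card J" by (simp add: power_mult_distrib)
  also have "\<dots> < D * D ^ card J" using D0 by (simp add: D_def)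
  also have "\<dots> \<le> D ^ card I" using lt D0 power_increasing[of "Suc (card J)" "card I" D] by simp
  finally have "card T < card S" using cS by simp
  define P where "P \<alpha> = (\<Prod>i\<in>I. \<Psi> i ^ ?l \<alpha> i)" for \<alpha>
  from more_unknowns_than_equations[OF fin(2,1) \<open>card T < card S\<close>, of "\<lambda>\<alpha>. ?l (P \<alpha>)"]
  obtain c where c: "\<exists>\<alpha>\<in>S. c \<alpha> \<noteq> 0" "\<And>t. t \<in> T \<Longrightarrow> (\<Sum>\<alpha>\<in>S. c \<alpha> * ?l (P \<alpha>) t) = 0" by blast
  have PT: "?k (P \<alpha>) \<subseteq> T" if "\<alpha> \<in> S" for \<alpha>
  proof -
    have "P \<alpha> \<in> exponents_le (card I * (D * E))"
      unfolding P_def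
    proof (rule exponents_le_prod[OF I])
      fix i assume i: "i \<in> I"
      have "?l \<alpha> i * E \<le> D * E" using that by (auto simp: S_def intro: less_imp_le)
      then show "\<Psi> i ^ ?l \<alpha> i \<in> exponents_le (D * E)"
        by (rule exponents_le_mono[OF exponents_le_power[OF E[OF i]]])
    qed
    moreover have "P \<alpha> \<in> mpolys_in J"
      unfolding P_def using \<Psi> by (intro mpolys_in_prod mpolys_in_power)
    ultimately show ?thesis by (auto simp: T_def B_def exponents_le_def mpolys_in_def less_Suc_eq_le)
  qed
  define F where "F = (\<Sum>\<alpha>\<in>S. single \<alpha> (c \<alpha>))"
  have lF: "?l F m = (if m \<in> S then c m else 0)" for m
    unfolding F_def by (rule lookup_sum_single[OF fin(1)])
  have kF: "?k F \<subseteq> S"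
    using lF by (metis in_keys_iff subsetI)
  have rel: "(\<Sum>\<alpha>\<in>S. Const (c \<alpha>) * P \<alpha>) = 0"
  proof (rule poly_mapping_eqI)
    fix t
    have "?l (\<Sum>\<alpha>\<in>S. Const (c \<alpha>) * P \<alpha>) t = (\<Sum>\<alpha>\<in>S. c \<alpha> * ?l (P \<alpha>) t)"
      by (simp add: lookup_sum lookup_Const_mult)
    also have "\<dots> = 0"
    proof (cases "t \<in> T")
      case False
      then have "?l (P \<alpha>) t = 0" if "\<alpha> \<in> S" for \<alpha> using PT[OF that] by (auto simp: in_keys_iff)
      then show ?thesis by simp
    qed (rule c)
    finally show "?l (\<Sum>\<alpha>\<in>S. Const (c \<alpha>) * P \<alpha>) t = ?l 0 t" by simp
  qed
  show ?thesis
  proof (intro bexI[of _ F] conjI allI)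
    show "F \<noteq> 0" using c(1) lF by (metis lookup_zero)
    show "F \<in> mpolys_in I" using kF by (auto simp: mpolys_in_def S_def)
    fix z
    have "poly_val (\<lambda>i. poly_val z (\<Psi> i)) F = (\<Sum>\<alpha>\<in>S. c \<alpha> * mono_val (\<lambda>i. poly_val z (\<Psi> i)) \<alpha>)"
      unfolding poly_val_superset[OF fin(1) kF] by (intro sum.cong) (auto simp: lF)
    also have "\<dots> = (\<Sum>\<alpha>\<in>S. c \<alpha> * poly_val z (P \<alpha>))"
    proof (intro sum.cong refl)
      fix \<alpha> assume "\<alpha> \<in> S"
      then have "mono_val (\<lambda>i. poly_val z (\<Psi> i)) \<alpha> = (\<Prod>i\<in>I. poly_val z (\<Psi> i) ^ ?l \<alpha> i)"
        using I by (intro mono_val_superset) (auto simp: S_def)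
      then show "c \<alpha> * mono_val (\<lambda>i. poly_val z (\<Psi> i)) \<alpha> = c \<alpha> * poly_val z (P \<alpha>)"
        by (simp add: P_def poly_val_prod poly_val_power)
    qed
    also have "\<dots> = poly_val z (\<Sum>\<alpha>\<in>S. Const (c \<alpha>) * P \<alpha>)"
      by (simp add: poly_val_sum poly_val_mult)
    finally show "poly_val (\<lambda>i. poly_val z (\<Psi> i)) F = 0" by (simp add: rel)
  qed
qed

text \<open>
  The torus of points with support \<open>A\<close> acts on coefficient vectors, and modulo this action
  the point \<open>p\<close> becomes \<open>(1, \<dots>, 1)\<close>.  Hence the union over \<open>p\<close> has dimension at most
  \<open>(card A - 1) + (card M - card R)\<close>.
\<close>

lemma torus_orbit_thin:
  fixes a :: "'r \<Rightarrow> ('v \<Rightarrow>\<^sub>0 nat) \<Rightarrow> complex"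
  assumes M: "finite M" and A: "finite A" "i0 \<in> A" and R: "finite R" "card A \<le> card R"
    and indep: "\<And>b. \<forall>m\<in>M. (\<Sum>r\<in>R. b r * a r m) = 0 \<Longrightarrow> \<forall>r\<in>R. b r = 0"
  shows "\<exists>F\<in>mpolys_in M. F \<noteq> 0 \<and> (\<forall>c p. (\<forall>i\<in>A. p i \<noteq> 0) \<longrightarrow> p i0 = 1 \<longrightarrow>
    (\<forall>r\<in>R. (\<Sum>m\<in>M. a r m * ((\<Prod>i\<in>A. p i ^ lookup m i) * c m)) = 0) \<longrightarrow> poly_val c F = 0)"
proof -
  let ?l = lookup
  have "\<exists>K \<theta>. K \<subseteq> M \<and> card K + card R = card M \<and>
    (\<forall>c. (\<forall>r\<in>R. (\<Sum>m\<in>M. a r m * c m) = 0) \<longrightarrow> (\<forall>m\<in>M. c m = (\<Sum>k\<in>K. \<theta> m k * c k)))"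
    by (rule kernel_parametrization[OF R(1) M indep])
  then obtain K \<theta> where K: "K \<subseteq> M" "card K + card R = card M"
    and \<theta>: "\<forall>c. (\<forall>r\<in>R. (\<Sum>m\<in>M. a r m * c m) = 0) \<longrightarrow> (\<forall>m\<in>M. c m = (\<Sum>k\<in>K. \<theta> m k * c k))"
    by (elim exE conjE)
  \<comment> \<open>The parameters are the torus coordinates other than \<open>i0\<close>, which is
    normalized to 1, and the free coordinates of the kernel. Losing \<open>i0\<close> makes
    \<open>card J < card M\<close> strict when \<open>card A \<le> card R\<close>.\<close>
  define J where "J = (Inl ` (A - {i0}) \<union> Inr ` K :: ('v + ('v \<Rightarrow>\<^sub>0 nat)) set)"
  define \<Psi> where "\<Psi> m = (\<Prod>i\<in>A - {i0}. Var (Inl i) ^ ?l m i) * (\<Sum>k\<in>K. Const (\<theta> m k) * Var (Inr k))"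
    for m :: "'v \<Rightarrow>\<^sub>0 nat"
  have fK: "finite K" by (rule finite_subset[OF K(1) M])
  have "card J = card (A - {i0}) + card K"
    unfolding J_def using A fK by (subst card_Un_disjoint) (auto simp: card_image)
  moreover have "card (A - {i0}) < card A" using A by (rule card_Diff1_less)
  ultimately have lt: "card J < card M" using K(2) R(2) by linarith
  have "\<exists>F\<in>mpolys_in M. F \<noteq> 0 \<and> (\<forall>z. poly_val (\<lambda>m. poly_val z (\<Psi> m)) F = 0)"
  proof (rule polynomial_image_thin[OF M _ lt])
    show "finite J" using A fK by (simp add: J_def)
    show "\<Psi> m \<in> mpolys_in J" for m
      unfolding \<Psi>_def J_def by (intro mpolys_in_mult mpolys_in_prod mpolys_in_sum mpolys_in_power) auto
  qed
  then obtain F where F: "F \<in> mpolys_in M" "F \<noteq> 0" "\<And>z. poly_val (\<lambda>m. poly_val z (\<Psi> m)) F = 0" by blast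
  have "poly_val c F = 0" if p: "\<forall>i\<in>A. p i \<noteq> 0" "p i0 = 1" and
    eq: "\<forall>r\<in>R. (\<Sum>m\<in>M. a r m * ((\<Prod>i\<in>A. p i ^ ?l m i) * c m)) = 0" for c and p :: "'v \<Rightarrow> complex"
  proof -
    define c' where "c' m = (\<Prod>i\<in>A. p i ^ ?l m i) * c m" for m
    \<comment> \<open>The linear equations hold for the twisted coefficients \<open>c'\<close>; the
      inverse torus element undoes the twist and returns \<open>c\<close>.\<close>
    define z where "z = case_sum (\<lambda>i. inverse (p i)) c'"
    have "poly_val z (\<Psi> m) = c m" if m: "m \<in> M" for m
    proof -
      have "poly_val z (\<Psi> m) = (\<Prod>i\<in>A - {i0}. inverse (p i) ^ ?l m i) * (\<Sum>k\<in>K. \<theta> m k * c' k)"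
        by (simp add: \<Psi>_def poly_val_mult poly_val_prod poly_val_power poly_val_sum z_def)
      also have "(\<Sum>k\<in>K. \<theta> m k * c' k) = c' m"
        using \<theta>[rule_format, of c' m] eq m by (simp add: c'_def)
      also have "(\<Prod>i\<in>A - {i0}. inverse (p i) ^ ?l m i) = (\<Prod>i\<in>A. inverse (p i) ^ ?l m i)"
        using A p(2) by (simp add: prod.remove[of A i0])
      also have "\<dots> * c' m = (\<Prod>i\<in>A. inverse (p i) ^ ?l m i * p i ^ ?l m i) * c m"
        by (simp add: c'_def prod.distrib)
      also have "(\<Prod>i\<in>A. inverse (p i) ^ ?l m i * p i ^ ?l m i) = 1"
        using p(1) by (intro prod.neutral) (simp flip: power_mult_distrib)
      finally show ?thesis by simp
    qed
    then show ?thesis using F(3)[of z] poly_val_cong[OF F(1), of c "\<lambda>m. poly_val z (\<Psi> m)"] by simp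
  qed
  then show ?thesis using F(1,2) by blast
qed

section \<open>Generic forms and their singular points\<close>

lemma mpderiv_in_forms:
  assumes "f \<in> forms I d"
  shows "mpderiv j f \<in> forms I (d - 1)"
  unfolding forms_def
proof (intro CollectI subsetI)
  fix m assume "m \<in> keys (mpderiv j f)"
  then have "lookup f (m + single j 1) \<noteq> 0"
    by (auto simp: in_keys_iff lookup_mpderiv)
  then have *: "m + single j 1 \<in> monoms I d"
    using assms by (auto simp: forms_def in_keys_iff)
  have "keys m \<subseteq> keys (m + single j 1)"
    by (auto simp: in_keys_iff lookup_add)
  then show "m \<in> monoms I (d - 1)"
    using * by (auto simp: monoms_def mdeg_add)
qed

lemma mono_val_on_support:
  assumes "finite V" "keys m \<subseteq> V" "A = {i \<in> V. p i \<noteq> 0}"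
  shows "mono_val p m = (if keys m \<subseteq> A then \<Prod>i\<in>A. p i ^ lookup m i else (0::complex))"
proof (cases "keys m \<subseteq> A")
  case True
  then show ?thesis using assms by (simp add: mono_val_superset[of A])
next
  case False
  then obtain i where "i \<in> keys m" "p i = 0" using assms by auto
  then show ?thesis using False by (auto simp: mono_val_def in_keys_iff)
qed

text \<open>
  At a point \<open>p\<close> with support \<open>A\<close>, the contribution of the monomial \<open>m\<close> to \<open>\<partial>f/\<partial>x\<^sub>j\<close> is
  \<open>sing_coeff A j m\<close> times the coefficient of \<open>m\<close> times the value at \<open>p\<close> of the part of \<open>m\<close> in
  the variables of \<open>A\<close>, up to the factor \<open>1 / p\<^sub>j\<close> if \<open>j \<in> A\<close>.
\<close>

definition sing_coeff :: "'v set \<Rightarrow> 'v \<Rightarrow> ('v \<Rightarrow>\<^sub>0 nat) \<Rightarrow> complex" where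
  "sing_coeff A j m = (if keys m - {j} \<subseteq> A \<and> (j \<in> A \<or> lookup m j = 1)
     then of_nat (lookup m j) else 0)"

text \<open>For \<open>j \<in> A\<close> the factor \<open>p j\<close> restores the monomial that
  differentiation lowered. For \<open>j \<notin> A\<close> the derivative survives at
  \<open>p\<close> only if it is free of x_j, that is, if x_j occurs exactly once in
  \<open>m\<close>.\<close>

lemma mono_deriv_on_support:
  assumes V: "finite V" "keys m \<subseteq> V" and A: "A = {i \<in> V. p i \<noteq> 0}"
  shows "of_nat (lookup m j) * mono_val p (m - single j 1) * (if j \<in> A then p j else 1) =
    sing_coeff A j m * (\<Prod>i\<in>A. p i ^ lookup m i)"
proof -
  let ?l = lookup and ?k = keys and ?e = "single j (1::nat)"
  show ?thesis
  proof (cases "?l m j = 0")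
    case True
    then show ?thesis by (simp add: sing_coeff_def)
  next
    case False
    then have me: "m = (m - ?e) + ?e"
      by (intro poly_mapping_eqI) (auto simp: lookup_add lookup_minus lookup_single when_def)
    have jV: "j \<in> V" using False V by (auto simp: in_keys_iff)
    show ?thesis
    proof (cases "j \<in> A")
      case True
      have "mono_val p ?e = p j" by (simp add: mono_val_def)
      then have "mono_val p (m - ?e) * p j = mono_val p m"
        using me mono_val_add[of p "m - ?e" ?e] by simp
      moreover have "?k m - {j} \<subseteq> A \<longleftrightarrow> ?k m \<subseteq> A" using True by auto
      ultimately show ?thesis
        using True mono_val_on_support[OF V A] by (simp add: sing_coeff_def mult.assoc)
    next
      case jA: False
      have lk: "v \<in> ?k (m - ?e) \<longleftrightarrow> (if v = j then ?l m j \<noteq> 1 else v \<in> ?k m)" for v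
        using False by (cases "v = j") (simp_all add: in_keys_iff lookup_minus lookup_single when_def, linarith)
      have ksub: "?k (m - ?e) \<subseteq> V"
      proof
        fix v assume "v \<in> ?k (m - ?e)"
        then show "v \<in> V" using lk[of v] V(2) jV by (cases "v = j") auto
      qed
      have "?k (m - ?e) \<subseteq> A \<longleftrightarrow> ?k m - {j} \<subseteq> A \<and> ?l m j = 1"
        using jA unfolding subset_iff lk by (metis Diff_iff singletonD singletonI)
      moreover have "(\<Prod>i\<in>A. p i ^ ?l (m - ?e) i) = (\<Prod>i\<in>A. p i ^ ?l m i)"
        using jA by (intro prod.cong) (auto simp: lookup_minus lookup_single when_def)
      ultimately show ?thesis
        using jA mono_val_on_support[OF V(1) ksub A] by (auto simp: sing_coeff_def)
    qed
  qed
qed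

lemma singular_equation:
  assumes "finite V" "finite M" "\<And>m. m \<in> M \<Longrightarrow> keys m \<subseteq> V" "keys f \<subseteq> M"
    and A: "A = {i \<in> V. p i \<noteq> 0}" and 0: "poly_val p (mpderiv j f) = 0"
  shows "(\<Sum>m\<in>M. sing_coeff A j m * ((\<Prod>i\<in>A. p i ^ lookup m i) * lookup f m)) = 0"
proof -
  let ?s = "if j \<in> A then p j else 1"
  have "poly_val p (mpderiv j f) = (\<Sum>m\<in>M. of_nat (lookup m j) *
      lookup f m * mono_val p (m - single j 1))"
    unfolding poly_val_mpderiv using assms(2,4) by (intro sum.mono_neutral_left) (auto simp: in_keys_iff)
  then have "0 = (\<Sum>m\<in>M. of_nat (lookup m j) *
      lookup f m * mono_val p (m - single j 1)) * ?s"
    using 0 by simp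
  also have "\<dots> = (\<Sum>m\<in>M. (of_nat (lookup m j) *
      mono_val p (m - single j 1) * ?s) * lookup f m)"
    by (simp add: sum_distrib_right sum_distrib_left mult_ac)
  also have "\<dots> = (\<Sum>m\<in>M. sing_coeff A j m * ((\<Prod>i\<in>A. p i ^ lookup m i) * lookup f m))"
    using mono_deriv_on_support[OF assms(1) assms(3) A] by (intro sum.cong refl) (simp add: mult.assoc)
  finally show ?thesis by simp
qed

text \<open>\<open>R\<close> selects the partial derivatives that serve as equations. It may contain
  indices outside \<open>A\<close>; supports with two elements rely on this.\<close>

lemma singular_support_thin:
  fixes V :: "'v set"
  assumes V: "finite V" and M: "M \<subseteq> monoms V d" and A: "A \<subseteq> V" "A \<noteq> {}"
    and R: "finite R" "card A \<le> card R"
    and indep: "\<And>b. \<forall>m\<in>M. (\<Sum>r\<in>R. b r * sing_coeff A r m) = 0 \<Longrightarrow> \<forall>r\<in>R. b r = 0"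
  shows "\<exists>F\<in>mpolys_in M. F \<noteq> 0 \<and> (\<forall>f p. keys f \<subseteq> M \<longrightarrow> A = {i \<in> V. p i \<noteq> 0} \<longrightarrow>
    (\<forall>j\<in>R. poly_val p (mpderiv j f) = 0) \<longrightarrow> poly_val (lookup f) F = 0)"
proof -
  obtain i0 where i0: "i0 \<in> A" using A by blast
  have fin: "finite M" "finite A"
    using finite_subset[OF M finite_monoms[OF V]] finite_subset[OF A(1) V] by auto
  have "\<exists>F\<in>mpolys_in M. F \<noteq> 0 \<and> (\<forall>c p. (\<forall>i\<in>A. p i \<noteq> 0) \<longrightarrow> p i0 = 1 \<longrightarrow>
      (\<forall>r\<in>R. (\<Sum>m\<in>M. sing_coeff A r m * ((\<Prod>i\<in>A. p i ^ lookup m i) * c m)) = 0) \<longrightarrow>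
      poly_val c F = 0)"
    by (rule torus_orbit_thin[OF fin i0 R indep])
  then obtain F where F: "F \<in> mpolys_in M" "F \<noteq> 0"
    and Fz: "\<forall>c p. (\<forall>i\<in>A. p i \<noteq> 0) \<longrightarrow> p i0 = 1 \<longrightarrow>
      (\<forall>r\<in>R. (\<Sum>m\<in>M. sing_coeff A r m * ((\<Prod>i\<in>A. p i ^ lookup m i) * c m)) = 0) \<longrightarrow>
      poly_val c F = 0" by (elim bexE conjE)
  have "poly_val (lookup f) F = 0"
    if f: "keys f \<subseteq> M" and Ap: "A = {i \<in> V. p i \<noteq> 0}"
      and sing: "\<forall>j\<in>R. poly_val p (mpderiv j f) = 0" for f and p :: "'v \<Rightarrow> complex"
  proof -
    \<comment> \<open>Partial derivatives of a form are homogeneous, so the singular point may be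
      rescaled to have coordinate 1 at \<open>i0\<close>.\<close>
    define p' where "p' i = inverse (p i0) * p i" for i
    have p0: "p i0 \<noteq> 0" using i0 Ap by auto
    have Ap': "A = {i \<in> V. p' i \<noteq> 0}" using Ap p0 by (simp add: p'_def)
    have fd: "f \<in> forms V d" using f M by (auto simp: forms_def)
    have "poly_val p' (mpderiv j f) = 0" if "j \<in> R" for j
      using poly_val_scale[OF mpderiv_in_forms[OF fd], of "inverse (p i0)" p j] sing that
      by (simp add: p'_def[abs_def])
    then have "(\<Sum>m\<in>M. sing_coeff A j m * ((\<Prod>i\<in>A. p' i ^ lookup m i) * lookup f m)) = 0"
      if "j \<in> R" for j
      using that M by (intro singular_equation[OF V fin(1) _ f Ap']) (auto simp: monoms_def)
    moreover have "\<forall>i\<in>A. p' i \<noteq> 0" "p' i0 = 1" using Ap' p0 by (auto simp: p'_def)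
    ultimately show ?thesis using Fz by blast
  qed
  then show ?thesis using F by blast
qed

lemma prod_mpolys_in_nonzero:
  fixes F :: "'i \<Rightarrow> ('v::linorder) mpoly"
  assumes "finite S" "\<forall>i\<in>S. F i \<in> mpolys_in M \<and> F i \<noteq> 0"
  shows "(\<Prod>i\<in>S. F i) \<in> mpolys_in M" "(\<Prod>i\<in>S. F i) \<noteq> 0"
    "poly_val x (\<Prod>i\<in>S. F i) \<noteq> 0 \<Longrightarrow> i \<in> S \<Longrightarrow> poly_val x (F i) \<noteq> 0"
  using assms by (auto intro: mpolys_in_prod simp: poly_val_prod)

text \<open>For each possible support \<open>A\<close> of a singular point, the monomials x_r^d with
  \<open>r \<in> A\<close> show independence: among the derivatives with index in \<open>A\<close>,
  only that in x_r involves x_r^d. The polynomial is the product over all supports.\<close>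

lemma generic_form_smooth:
  assumes d: "d \<ge> 1"
  shows "\<exists>F\<in>mpolys_in (monoms {..<N} d). F \<noteq> 0 \<and>
    (\<forall>f\<in>forms {..<N} d. poly_val (lookup f) F \<noteq> 0 \<longrightarrow> smooth_hypersurface N f)"
proof -
  let ?M = "monoms {..<N} d" and ?S = "Pow {..<N} - {{}}"
  have "\<exists>F\<in>mpolys_in ?M. F \<noteq> 0 \<and> (\<forall>f p. keys f \<subseteq> ?M \<longrightarrow> A = {i \<in> {..<N}. p i \<noteq> 0} \<longrightarrow>
    (\<forall>j\<in>A. poly_val p (mpderiv j f) = 0) \<longrightarrow> poly_val (lookup f) F = 0)" if A: "A \<in> ?S" for A
  proof (rule singular_support_thin)
    show fA: "finite A" using A finite_subset by auto
    fix b assume b: "\<forall>m\<in>?M. (\<Sum>r\<in>A. b r * sing_coeff A r m) = 0"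
    show "\<forall>r\<in>A. b r = 0"
    proof
      fix r assume r: "r \<in> A"
      let ?m = "single r d"
      have "sing_coeff A s ?m = (if s = r then of_nat d else 0)" if "s \<in> A" for s
        using that r d by (auto simp: sing_coeff_def lookup_single when_def)
      then have "(\<Sum>s\<in>A. b s * sing_coeff A s ?m) = (\<Sum>s\<in>A. if s = r then b s * of_nat d else 0)"
        by (intro sum.cong) auto
      also have "\<dots> = b r * of_nat d" using r fA by simp
      finally show "b r = 0" using b r A d by (auto simp: monoms_def)
    qed
  qed (use A in auto)
  then have "\<forall>A\<in>?S. \<exists>F. F \<in> mpolys_in ?M \<and> F \<noteq> 0 \<and> (\<forall>f p. keys f \<subseteq> ?M \<longrightarrow>
    A = {i \<in> {..<N}. p i \<noteq> 0} \<longrightarrow> (\<forall>j\<in>A. poly_val p (mpderiv j f) = 0) \<longrightarrow>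
    poly_val (lookup f) F = 0)"
    unfolding Bex_def by (intro ballI)
  from bchoice[OF this] obtain F where F0: "\<forall>A\<in>?S. F A \<in> mpolys_in ?M \<and> F A \<noteq> 0 \<and>
    (\<forall>f p. keys f \<subseteq> ?M \<longrightarrow> A = {i \<in> {..<N}. p i \<noteq> 0} \<longrightarrow>
    (\<forall>j\<in>A. poly_val p (mpderiv j f) = 0) \<longrightarrow> poly_val (lookup f) (F A) = 0)" by (elim exE)
  then have F: "\<forall>A\<in>?S. F A \<in> mpolys_in ?M \<and> F A \<noteq> 0" by blast
  have fin: "finite ?S" by simp
  note P = prod_mpolys_in_nonzero[OF fin F]
  have "smooth_hypersurface N f"
    if f: "f \<in> forms {..<N} d" and nz: "poly_val (lookup f) (\<Prod>A\<in>?S. F A) \<noteq> 0" for f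
    unfolding smooth_hypersurface_def
  proof (rule ccontr)
    assume "singular_points N f \<noteq> {}"
    then obtain v where v: "v \<in> carrier_vec N" "v \<noteq> 0\<^sub>v N"
      and sing: "\<forall>w\<in>point_class v. \<forall>i<N. poly_val (($) w) (mpderiv i f) = 0"
      by (auto simp: singular_points_def proj_points_def)
    have "1 \<cdot>\<^sub>v v \<in> point_class v" unfolding point_class_def using one_neq_zero by blast
    then have "v \<in> point_class v" by simp
    define A where "A = {i \<in> {..<N}. v $ i \<noteq> 0}"
    have "A \<noteq> {}" using v by (auto simp: A_def)
    then have A: "A \<in> ?S" by (auto simp: A_def)
    have "poly_val (lookup f) (F A) = 0"
      using f sing \<open>v \<in> point_class v\<close> F0[rule_format, OF A, THEN conjunct2, THEN conjunct2, rule_format, OF _ A_def]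
      by (auto simp: forms_def A_def)
    then show False using P(3)[OF nz A] by simp
  qed
  then show ?thesis using P(1,2) by blast
qed

text \<open>
  The forms supported on these monomials are the forms of degree \<open>d\<close> that are singular at all
  coordinate points.
\<close>

definition nodal_monoms :: "nat \<Rightarrow> nat \<Rightarrow> (nat \<Rightarrow>\<^sub>0 nat) set" where
  "nodal_monoms n d = {m \<in> monoms {..<n} d. \<forall>i. lookup m i \<le> d - 2}"

text \<open>For \<open>d = 3\<close> the nodal monomials are squarefree. At a point supported in {i,
  j, k}, only x_i x_j x_k contributes to the derivative in x_k, so its coefficient must
  vanish.\<close>

lemma extra_singularity_thin_cubic:
  assumes ijk: "i \<in> A" "j \<in> A" "A \<subseteq> {i, j, k}" "i \<noteq> j" "k \<noteq> i" "k \<noteq> j" "i < n" "j < n" "k < n"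
  shows "\<exists>F\<in>mpolys_in (nodal_monoms n 3). F \<noteq> 0 \<and> (\<forall>f p. keys f \<subseteq> nodal_monoms n 3 \<longrightarrow>
    A = {i \<in> {..<n}. p i \<noteq> 0} \<longrightarrow> (\<forall>j<n. poly_val p (mpderiv j f) = 0) \<longrightarrow> poly_val (lookup f) F = 0)"
proof -
  let ?M = "nodal_monoms n 3"
  define m0 where "m0 = single i 1 + single j 1 + single k (1::nat)"
  have lm: "lookup m0 v = (if v \<in> {i, j, k} then 1 else 0)" for v
    using ijk by (auto simp: m0_def lookup_add lookup_single when_def)
  have km: "keys m0 = {i, j, k}"
    by (auto simp: in_keys_iff lm simp del: lookup_not_eq_zero_eq_in_keys split: if_splits)
  have mM: "m0 \<in> ?M"
    using ijk by (simp add: nodal_monoms_def monoms_def km lm) (simp add: m0_def mdeg_add)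
  have fM: "finite ?M" unfolding nodal_monoms_def using finite_monoms[of "{..<n}" 3] by auto
  have uniq: "m = m0" if m: "m \<in> ?M" and "sing_coeff A k m \<noteq> 0" for m
  proof -
    have ks: "keys m \<subseteq> {i, j, k}"
      using that ijk by (auto simp: sing_coeff_def split: if_splits)
    have le: "lookup m v \<le> 1" for v
      using m by (auto simp: nodal_monoms_def dest!: spec[of _ v])
    have "mdeg m = 3" using m by (auto simp: nodal_monoms_def monoms_def)
    then have s: "lookup m i + lookup m j + lookup m k = 3"
      using mdeg_superset[OF _ ks] ijk by (simp add: add.assoc)
    show ?thesis
    proof (rule poly_mapping_eqI)
      fix v
      show "lookup m v = lookup m0 v"
        using s le[of i] le[of j] le[of k] ks unfolding lm by (cases "v \<in> {i, j, k}") (auto simp: in_keys_iff)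
    qed
  qed
  have sc: "sing_coeff A k m0 = 1"
    using ijk by (auto simp: sing_coeff_def km lm)
  show ?thesis
  proof (intro bexI[of _ "Var m0"] conjI allI impI)
    show "Var m0 \<in> mpolys_in ?M" using mM by simp
    show "Var m0 \<noteq> 0" by (metis lookup_single_eq lookup_zero one_neq_zero)
    fix f and p :: "nat \<Rightarrow> complex"
    assume f: "keys f \<subseteq> ?M" and A: "A = {i \<in> {..<n}. p i \<noteq> 0}"
      and sing: "\<forall>j<n. poly_val p (mpderiv j f) = 0"
    have "0 = (\<Sum>m\<in>?M. sing_coeff A k m * ((\<Prod>i\<in>A. p i ^ lookup m i) * lookup f m))"
      using sing ijk by (subst singular_equation[OF _ fM _ f A]) (auto simp: nodal_monoms_def monoms_def)
    also have "\<dots> = (\<Sum>m\<in>{m0}. sing_coeff A k m * ((\<Prod>i\<in>A. p i ^ lookup m i) * lookup f m))"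
      using uniq mM by (intro sum.mono_neutral_right[OF fM]) auto
    finally have "(\<Prod>i\<in>A. p i ^ lookup m0 i) * lookup f m0 = 0"
      using sc by simp
    moreover have "(\<Prod>i\<in>A. p i ^ lookup m0 i) \<noteq> 0"
      using A by (subst prod_zero_iff) auto
    ultimately show "poly_val (lookup f) (Var m0) = 0"
      unfolding poly_val_Var by simp
  qed
qed

text \<open>The count with the derivatives indexed by \<open>A\<close> works if \<open>A\<close> is
  large enough to exchange variables within nodal monomials. For \<open>d = 4\<close> and A = {i, j}
  the only monomial available inside \<open>A\<close> is x_i^2 x_j^2, so an index outside
  \<open>A\<close> replaces one of the two. Cubics with at most three coordinates in the support are
  the single-coefficient case.\<close>

lemma extra_singularity_thin:
  assumes n: "n \<ge> 3" and d: "d \<ge> 3" and A: "A \<subseteq> {..<n}" "card A \<ge> 2"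
  shows "\<exists>F\<in>mpolys_in (nodal_monoms n d). F \<noteq> 0 \<and> (\<forall>f p. keys f \<subseteq> nodal_monoms n d \<longrightarrow>
    A = {i \<in> {..<n}. p i \<noteq> 0} \<longrightarrow> (\<forall>j<n. poly_val p (mpderiv j f) = 0) \<longrightarrow> poly_val (lookup f) F = 0)"
proof -
  let ?M = "nodal_monoms n d"
  have fA: "finite A" using A finite_subset by auto
  have Mm: "?M \<subseteq> monoms {..<n} d" by (auto simp: nodal_monoms_def)
  obtain i where i: "i \<in> A" using A(2) by fastforce
  have "card (A - {i}) \<ge> 1" using A(2) i fA by simp
  then obtain j where j: "j \<in> A" "j \<noteq> i"
    by (metis card.empty DiffD1 DiffD2 ex_in_conv not_one_le_zero singletonI)
  have red: ?thesis if "finite R" "card A \<le> card R" "R \<subseteq> {..<n}"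
    "\<And>b. \<forall>m\<in>?M. (\<Sum>r\<in>R. b r * sing_coeff A r m) = 0 \<Longrightarrow> \<forall>r\<in>R. b r = 0" for R
  proof -
    have "A \<noteq> {}" using i by auto
    from singular_support_thin[OF _ Mm A(1) this that(1,2,4)]
    obtain F where F: "F \<in> mpolys_in ?M" "F \<noteq> 0"
      "\<forall>f p. keys f \<subseteq> ?M \<longrightarrow> A = {i \<in> {..<n}. p i \<noteq> 0} \<longrightarrow>
        (\<forall>j\<in>R. poly_val p (mpderiv j f) = 0) \<longrightarrow> poly_val (lookup f) F = 0" by auto
    then show ?thesis using that(3) by (intro bexI[of _ F]) blast+
  qed
  have ij: "i < n" "j < n" using i j A by auto
  consider "d = 3" "card A \<le> 3" | "d \<ge> 4" "card A = 2" | "d \<ge> 4 \<and> card A \<ge> 3 \<or> d = 3 \<and> card A \<ge> 4"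
    using d A(2) by linarith
  then show ?thesis
  proof cases
    case 1
    have "\<exists>k<n. k \<noteq> i \<and> k \<noteq> j \<and> A \<subseteq> {i, j, k}"
    proof (cases "A = {i, j}")
      case True
      have "card ({..<n} - {i, j}) \<ge> 1" using n ij j by simp
      then have "{..<n} - {i, j} \<noteq> {}" by (metis card.empty not_one_le_zero)
      then show ?thesis using True by auto
    next
      case False
      then obtain k where k: "k \<in> A" "k \<notin> {i, j}" using i j by auto
      have "card {i, j, k} = 3" using k j by simp
      then have "A = {i, j, k}" using 1 fA i j k by (metis card_seteq empty_subsetI insert_subset)
      then show ?thesis using k A by auto
    qed
    then obtain k where "k < n" "k \<noteq> i" "k \<noteq> j" "A \<subseteq> {i, j, k}" by blast
    with i j ij show ?thesis
      unfolding 1(1) by (intro extra_singularity_thin_cubic[of i A j k]) auto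
  next
    case 2
    have Aij: "A = {i, j}" using 2 i j fA by (metis card_2_iff card_seteq empty_subsetI insert_subset le_refl)
    have "card ({..<n} - {i, j}) \<ge> 1" using n ij j by simp
    then have "{..<n} - {i, j} \<noteq> {}" by (metis card.empty not_one_le_zero)
    then obtain k where k: "k < n" "k \<noteq> i" "k \<noteq> j" by auto
    show ?thesis
    proof (rule red[of "{i, k}"])
      show "card A \<le> card {i, k}" using 2 k by simp
      show "{i, k} \<subseteq> {..<n}" using k ij by auto
      fix b assume b: "\<forall>m\<in>?M. (\<Sum>r\<in>{i, k}. b r * sing_coeff A r m) = 0"
      \<comment> \<open>These two monomials decouple the system: x_i^(d-2) x_j^2 meets only the
        derivative in x_i, and x_i^(d-2) x_j x_k only the one in x_k, because x_k vanishes at the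
        point.\<close>
      define m1 where "m1 = single i (d - 2) + single j 2"
      define m2 where "m2 = single i (d - 2) + single j 1 + single k 1"
      have l1: "lookup m1 v = (if v = i then d - 2 else if v = j then 2 else 0)" for v
        using j by (simp add: m1_def lookup_add lookup_single when_def)
      have l2: "lookup m2 v = (if v = i then d - 2 else if v = j then 1 else if v = k then 1 else 0)" for v
        using j k by (simp add: m2_def lookup_add lookup_single when_def)
      have k1: "keys m1 = {i, j}"
        using 2 by (auto simp: in_keys_iff l1 simp del: lookup_not_eq_zero_eq_in_keys split: if_splits)
      have k2: "keys m2 = {i, j, k}"
        using 2 by (auto simp: in_keys_iff l2 simp del: lookup_not_eq_zero_eq_in_keys split: if_splits)
      have "m1 \<in> ?M" "m2 \<in> ?M"
        using 2 ij k by (auto simp: nodal_monoms_def monoms_def k1 k2 l1 l2)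
          (auto simp: m1_def m2_def mdeg_add)
      then have "b i * sing_coeff A i m1 + b k * sing_coeff A k m1 = 0"
        "b i * sing_coeff A i m2 + b k * sing_coeff A k m2 = 0"
        using b k by fastforce+
      moreover have "sing_coeff A i m1 = of_nat (d - 2)" "sing_coeff A k m1 = 0"
        "sing_coeff A i m2 = 0" "sing_coeff A k m2 = 1"
        using j k by (auto simp: sing_coeff_def k1 k2 l1 l2 Aij)
      moreover have "(of_nat (d - 2) :: complex) \<noteq> 0" unfolding of_nat_eq_0_iff using 2 by linarith
      ultimately show "\<forall>r\<in>{i, k}. b r = 0" by (auto simp del: of_nat_diff)
    qed simp
  next
    case 3
    show ?thesis
    proof (rule red[OF fA order.refl A(1)])
      fix b assume b: "\<forall>m\<in>?M. (\<Sum>r\<in>A. b r * sing_coeff A r m) = 0"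
      have b': "(\<Sum>r\<in>A. b r * of_nat (lookup m r)) = 0"
        if "m \<in> ?M" "keys m \<subseteq> A" for m
      proof -
        have "(\<Sum>r\<in>A. b r * of_nat (lookup m r)) = (\<Sum>r\<in>A. b r * sing_coeff A r m)"
          using that by (intro sum.cong) (auto simp: sing_coeff_def)
        then show ?thesis using b that by simp
      qed
      \<comment> \<open>Two nodal monomials that differ by exchanging one factor x_r for x_s give
        relations whose difference is b r - b s.\<close>
      have shift: "b r = b s \<and> (\<exists>m. m \<in> ?M \<and> keys m \<subseteq> A)" if rs: "r \<in> A" "s \<in> A" "r \<noteq> s" for r s
      proof -
        have "\<exists>m. keys m \<subseteq> A \<and> m + single r 1 \<in> ?M \<and> m + single s 1 \<in> ?M"
        proof -
          have c2: "card (A - {r, s}) = card A - 2" using rs fA by (simp add: card_Diff_subset)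
          then have "card (A - {r, s}) \<noteq> 0" using 3 by auto
          then obtain k where k: "k \<in> A" "k \<noteq> r" "k \<noteq> s"
            by (metis card.empty DiffD1 DiffD2 ex_in_conv insertI1 insertI2)
          have kn: "k < n" "r < n" "s < n" using k rs A by auto
          from 3 show ?thesis
          proof
            assume d4: "d \<ge> 4 \<and> card A \<ge> 3"
            \<comment> \<open>Multiplying by x_r gives the square of x_r, which is allowed because
              \<open>2 \<le> d - 2\<close>.\<close>
            define m where "m = single k (d - 2) + single r (1::nat)"
            have lm: "lookup m v = (if v = k then d - 2 else if v = r then 1 else 0)" for v
              using k by (simp add: m_def lookup_add lookup_single when_def)
            have km: "keys m \<subseteq> {k, r}"
              by (auto simp: in_keys_iff lm simp del: lookup_not_eq_zero_eq_in_keys split: if_splits)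
            have "mdeg m = d - 2 + 1" by (simp add: m_def mdeg_add)
            then have "mdeg m = d - 1" using d4 by linarith
            then show ?thesis using km k rs d4 kn Poly_Mapping.keys_add[of m]
              by (intro exI[of _ m])
                (auto simp: nodal_monoms_def monoms_def mdeg_add lookup_add lm lookup_single when_def
                  dest!: subsetD[OF Poly_Mapping.keys_add] split: if_splits)
          next
            assume d3: "d = 3 \<and> card A \<ge> 4"
            have "card (A - {r, s} - {k}) \<noteq> 0" using c2 d3 k fA by simp
            then obtain l where l: "l \<in> A" "l \<noteq> r" "l \<noteq> s" "l \<noteq> k"
              by (metis card.empty DiffD1 DiffD2 ex_in_conv insertI1 insertI2)
            have ln: "l < n" using l A by auto
            \<comment> \<open>Cubic nodal monomials are squarefree, so both remaining factors must
              avoid x_r and x_s; this takes four elements of \<open>A\<close>.\<close>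
            define m where "m = single k 1 + single l (1::nat)"
            have lm: "lookup m v = (if v = k then 1 else if v = l then 1 else 0)" for v
              using l by (simp add: m_def lookup_add lookup_single when_def)
            have km: "keys m \<subseteq> {k, l}"
              by (auto simp: in_keys_iff lm simp del: lookup_not_eq_zero_eq_in_keys split: if_splits)
            have "mdeg m = 2" by (simp add: m_def mdeg_add)
            then show ?thesis using km k l rs d3 kn ln
              by (intro exI[of _ m])
                (auto simp: nodal_monoms_def monoms_def mdeg_add lookup_add lm lookup_single when_def
                  dest!: subsetD[OF Poly_Mapping.keys_add] split: if_splits)
          qed
        qed
        then obtain m where m: "keys m \<subseteq> A" "m + single r 1 \<in> ?M"
          "m + single s 1 \<in> ?M" by blast
        have ks: "keys (m + single u 1) \<subseteq> A" if "u \<in> A" for u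
          using m(1) that Poly_Mapping.keys_add[of m "single u 1"] by auto
        have "(\<Sum>u\<in>A. b u * of_nat (lookup m u)) + b v = 0"
          if v: "v \<in> A" "m + single v 1 \<in> ?M" for v
        proof -
          have "0 = (\<Sum>u\<in>A. b u * of_nat (lookup (m + single v 1) u))"
            using b'[OF v(2) ks[OF v(1)]] by simp
          also have "\<dots> = (\<Sum>u\<in>A. b u * of_nat (lookup m u) + (if v = u then b u else 0))"
            by (intro sum.cong) (auto simp: lookup_add lookup_single when_def distrib_left)
          also have "\<dots> = (\<Sum>u\<in>A. b u * of_nat (lookup m u)) + b v"
            using v fA by (simp add: sum.distrib)
          finally show ?thesis by simp
        qed
        from this[OF rs(1) m(2)] this[OF rs(2) m(3)] have "b r = b s" by (metis add_left_cancel)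
        then show ?thesis using m ks rs by blast
      qed
      obtain m where m: "m \<in> ?M" "keys m \<subseteq> A" using shift[OF i j(1)] j(2) by auto
      have all: "b r = b i" if "r \<in> A" for r using shift[OF that i] by (cases "r = i") auto
      \<comment> \<open>As in Euler's identity: with all \<open>b r\<close> equal, the relation for
        any nodal monomial in the variables of \<open>A\<close> reads d * b i = 0.\<close>
      have "(\<Sum>r\<in>A. lookup m r) = d"
        using m mdeg_superset[OF fA m(2)] by (simp add: nodal_monoms_def monoms_def)
      then have "of_nat d * b i = (\<Sum>r\<in>A. b i * of_nat (lookup m r))"
        by (metis of_nat_sum sum_distrib_left mult.commute)
      also have "\<dots> = (\<Sum>r\<in>A. b r * of_nat (lookup m r))"
        using all by (intro sum.cong) auto
      finally have "b i = 0" using b'[OF m] d by simp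
      then show "\<forall>r\<in>A. b r = 0" using all by simp
    qed
  qed
qed

text \<open>Two non-zero coordinates characterize the points other than the coordinate points; the
  polynomial is the product over all supports of such points.\<close>

lemma generic_nodal_form:
  assumes n: "n \<ge> 3" and d: "d \<ge> 3"
  shows "\<exists>F\<in>mpolys_in (nodal_monoms n d). F \<noteq> 0 \<and> (\<forall>f p i j. keys f \<subseteq> nodal_monoms n d \<longrightarrow>
    poly_val (lookup f) F \<noteq> 0 \<longrightarrow> i < n \<longrightarrow> j < n \<longrightarrow> i \<noteq> j \<longrightarrow> p i \<noteq> 0 \<longrightarrow> p j \<noteq> 0 \<longrightarrow>
    (\<exists>k<n. poly_val p (mpderiv k f) \<noteq> 0))"
proof -
  let ?M = "nodal_monoms n d" and ?S = "{A. A \<subseteq> {..<n} \<and> card A \<ge> 2}"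
  have "\<forall>A\<in>?S. \<exists>F. F \<in> mpolys_in ?M \<and> F \<noteq> 0 \<and> (\<forall>f p. keys f \<subseteq> ?M \<longrightarrow>
    A = {i \<in> {..<n}. p i \<noteq> 0} \<longrightarrow> (\<forall>j<n. poly_val p (mpderiv j f) = 0) \<longrightarrow> poly_val (lookup f) F = 0)"
    using extra_singularity_thin[OF n d] unfolding Bex_def by (intro ballI) simp
  from bchoice[OF this] obtain F where F0: "\<forall>A\<in>?S. F A \<in> mpolys_in ?M \<and> F A \<noteq> 0 \<and>
    (\<forall>f p. keys f \<subseteq> ?M \<longrightarrow> A = {i \<in> {..<n}. p i \<noteq> 0} \<longrightarrow>
    (\<forall>j<n. poly_val p (mpderiv j f) = 0) \<longrightarrow> poly_val (lookup f) (F A) = 0)" by (elim exE)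
  then have F: "\<forall>A\<in>?S. F A \<in> mpolys_in ?M \<and> F A \<noteq> 0" by blast
  have fin: "finite ?S" by (rule finite_subset[of _ "Pow {..<n}"]) auto
  note P = prod_mpolys_in_nonzero[OF fin F]
  have "\<exists>k<n. poly_val p (mpderiv k f) \<noteq> 0"
    if f: "keys f \<subseteq> ?M" and nz: "poly_val (lookup f) (\<Prod>A\<in>?S. F A) \<noteq> 0"
      and ij: "i < n" "j < n" "i \<noteq> j" "p i \<noteq> 0" "p j \<noteq> 0" for f i j and p :: "nat \<Rightarrow> complex"
  proof (rule ccontr)
    assume sing: "\<not> ?thesis"
    define A where "A = {i \<in> {..<n}. p i \<noteq> 0}"
    have "{i, j} \<subseteq> A" "finite A" using ij by (auto simp: A_def)
    then have "card {i, j} \<le> card A" by (intro card_mono)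
    then have A: "A \<in> ?S" using ij by (auto simp: A_def)
    have "poly_val (lookup f) (F A) = 0"
      using sing F0[rule_format, OF A, THEN conjunct2, THEN conjunct2, rule_format, OF f A_def] by auto
    then show False using P(3)[OF nz A] by simp
  qed
  then show ?thesis using P(1,2) by (intro bexI[of _ "\<Prod>A\<in>?S. F A"]) blast+
qed

section \<open>Nodes at the coordinate points\<close>

text \<open>
  In the chart \<open>x\<^sub>a = 1\<close> the affine coordinate \<open>t\<^sub>i\<close> belongs to the variable of index \<open>skip a i\<close>.
\<close>

definition skip :: "nat \<Rightarrow> nat \<Rightarrow> nat" where
  "skip a i = (if i < a then i else i + 1)"

text \<open>The Hessian at the coordinate point \<open>a\<close> in the chart x_a = 1, read off from
  the coefficients of x_a^(d-2) x_b x_c so that it depends visibly polynomially on them; the 2 is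
  the second derivative of a square.\<close>

definition hessian_coeffs :: "nat \<Rightarrow> nat \<Rightarrow> nat \<Rightarrow> ((nat \<Rightarrow>\<^sub>0 nat) \<Rightarrow> complex) \<Rightarrow> complex mat" where
  "hessian_coeffs n d a c = mat (n - 1) (n - 1) (\<lambda>(i, j). (if i = j then 2 else 1) *
     c (single a (d - 2) + single (skip a i) 1 + single (skip a j) 1))"

lemma prod_Var_power:
  "finite S \<Longrightarrow> (\<Prod>i\<in>S. Var (g i) ^ e i) = single (\<Sum>i\<in>S. single (g i) (e i)) (1::complex)"
proof (induction S rule: finite_induct)
  case (insert i S)
  have "Var (g i) ^ k = single (single (g i) k) (1::complex)" for k
  proof (induction k)
    case (Suc k)
    then show ?case by (simp add: mult_single single_add[symmetric])
  qed simp
  then show ?case using insert by (simp add: mult_single)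
qed simp

context
  fixes n d a :: nat and h :: "nat mpoly"
  assumes a: "a < n" and d: "d \<ge> 3" and h: "keys h \<subseteq> nodal_monoms n d"
begin

definition dehomog :: "(nat \<Rightarrow>\<^sub>0 nat) \<Rightarrow> (nat \<Rightarrow>\<^sub>0 nat)" where
  "dehomog m = (\<Sum>i\<in>keys m - {a}.
     single (if i < a then i else i - 1) (lookup m i))"

lemma lookup_dehomog: "lookup (dehomog m) u = lookup m (skip a u)"
proof -
  have "(lookup m i when (if i < a then i else i - 1) = u) =
      (if skip a u = i then lookup m i else 0)"
    if "i \<in> keys m - {a}" for i
    using that by (auto simp: when_def skip_def)
  then have "lookup (dehomog m) u =
      (\<Sum>i\<in>keys m - {a}. if skip a u = i then lookup m i else 0)"
    unfolding dehomog_def lookup_sum lookup_single by (intro sum.cong) auto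
  also have "\<dots> = (if skip a u \<in> keys m - {a} then lookup m (skip a u) else 0)"
    by (rule sum.delta') simp
  also have "skip a u \<noteq> a" by (simp add: skip_def)
  ultimately show ?thesis by (simp add: in_keys_iff)
qed

text \<open>The total degree recovers the exponent of x_a that the chart forgets, so distinct
  monomials of one degree stay distinct there.\<close>

lemma mdeg_dehomog: "mdeg m = mdeg (dehomog m) + lookup m a"
proof -
  have 1: "mdeg (\<Sum>i\<in>S. f i) = (\<Sum>i\<in>S. mdeg (f i))" if "finite S" for S :: "nat set" and f :: "nat \<Rightarrow> nat \<Rightarrow>\<^sub>0 nat"
    using that by (induction S rule: finite_induct) (auto simp: mdeg_add, simp add: mdeg_def)
  have "mdeg m = (\<Sum>i\<in>insert a (keys m). lookup m i)"
    by (rule mdeg_superset) auto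
  also have "\<dots> = lookup m a + (\<Sum>i\<in>keys m - {a}. lookup m i)"
    by (simp add: sum.insert_remove)
  finally show ?thesis by (simp add: dehomog_def 1)
qed

text \<open>At a coordinate point all constants v_i / v_a vanish, so the substitution of the chart
  takes monomials to monomials.\<close>

lemma lookup_local_equation:
  assumes v: "v $ a \<noteq> 0" "\<And>i. i < n \<Longrightarrow> i \<noteq> a \<Longrightarrow> v $ i = 0"
  shows "lookup (local_equation a v h) x =
    (\<Sum>m\<in>keys h. if dehomog m = x then lookup h m else 0)"
proof -
  let ?\<sigma> = "\<lambda>i. if i = a then 1 else Const (v $ i / v $ a) + Var (if i < a then i else i - 1)"
  have "mono_val ?\<sigma> m = single (dehomog m) 1" if "m \<in> keys h" for m
  proof -
    have km: "keys m \<subseteq> {..<n}" using that h by (auto simp: nodal_monoms_def monoms_def)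
    have "mono_val ?\<sigma> m = (\<Prod>i\<in>insert a (keys m). ?\<sigma> i ^ lookup m i)"
      by (rule mono_val_superset) auto
    also have "\<dots> = (\<Prod>i\<in>keys m - {a}. ?\<sigma> i ^ lookup m i)"
      by (simp add: prod.insert_remove)
    also have "\<dots> = (\<Prod>i\<in>keys m - {a}. Var (if i < a then i else i - 1) ^ lookup m i)"
      using v(2) km by (intro prod.cong refl) auto
    also have "\<dots> = single (dehomog m) 1"
      unfolding dehomog_def by (rule prod_Var_power) simp
    finally show ?thesis .
  qed
  then have "local_equation a v h = (\<Sum>m\<in>keys h. single (dehomog m) (lookup h m))"
    unfolding local_equation_def poly_subst_def by (intro sum.cong) (auto simp: mult_single)
  then show ?thesis by (simp add: lookup_sum lookup_single when_def)
qed

lemma node_at_vertex: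
  assumes det: "det (hessian_coeffs n d a (lookup h)) \<noteq> 0"
  shows "node n h (point_class (unit_vec n a))"
  unfolding node_def Let_def
proof (intro ballI)
  fix v :: "complex vec" assume "v \<in> point_class (unit_vec n a)"
  then obtain c where c: "v = c \<cdot>\<^sub>v unit_vec n a" "c \<noteq> 0" by (auto simp: point_class_def)
  have va: "v $ a = c" "\<And>i. i < n \<Longrightarrow> i \<noteq> a \<Longrightarrow> v $ i = 0" using c a by auto
  have va0: "v $ a \<noteq> 0" using va c by simp
  let ?L = "local_equation a v h" and ?k = "keys" and ?l = "lookup"
  have L: "?l ?L x = (\<Sum>m\<in>?k h. if dehomog m = x then ?l h m else 0)" for x
    by (rule lookup_local_equation[OF va0 va(2)])
  have nm: "mdeg m = d" "?k m \<subseteq> {..<n}" "?l m i \<le> d - 2" if "m \<in> ?k h" for m i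
    using that h by (auto simp: nodal_monoms_def monoms_def)
  \<comment> \<open>The exponent of x_a is at most \<open>d - 2\<close>, so at least two factors of
    each monomial survive in the chart.\<close>
  have low: "?l ?L x = 0" if x: "mdeg x \<le> 1" for x
  proof -
    have "dehomog m \<noteq> x" if m: "m \<in> ?k h" for m
      using mdeg_dehomog[of m] nm(1)[OF m] nm(3)[OF m, of a] x d by auto
    then show ?thesis unfolding L by (intro sum.neutral) auto
  qed
  have "hessian_at_0 (n - 1) ?L = hessian_coeffs n d a (?l h)"
  proof (rule eq_matI)
    fix i j assume "i < dim_row (hessian_coeffs n d a (?l h))" "j < dim_col (hessian_coeffs n d a (?l h))"
    then have ij: "i < n - 1" "j < n - 1" by (auto simp: hessian_coeffs_def)
    let ?x = "single i 1 + single j (1::nat)"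
    define m0 where "m0 = single a (d - 2) + single (skip a i) 1 + single (skip a j) (1::nat)"
    have inj: "skip a u = skip a w \<longleftrightarrow> u = w" for u w by (auto simp: skip_def)
    have ska: "skip a u \<noteq> a" for u by (simp add: skip_def)
    have dm0: "dehomog m0 = ?x"
      by (rule poly_mapping_eqI)
        (auto simp: lookup_dehomog m0_def lookup_add lookup_single when_def inj ska ska[symmetric])
    have uniq: "m = m0" if m: "m \<in> ?k h" and eq: "dehomog m = ?x" for m
    proof (rule poly_mapping_eqI)
      fix w
      show "?l m w = ?l m0 w"
      proof (cases "w = a")
        case True
        have "?l m a = d - 2"
          using mdeg_dehomog[of m] nm(1)[OF m] by (simp add: eq mdeg_add)
        then show ?thesis using True by (simp add: m0_def lookup_add lookup_single when_def ska)
      next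
        case False
        define u where "u = (if w < a then w else w - 1)"
        have "w = skip a u" using False by (auto simp: u_def skip_def)
        then show ?thesis
          using arg_cong[OF trans[OF eq dm0[symmetric]], of "\<lambda>x. ?l x u"] by (simp add: lookup_dehomog)
      qed
    qed
    have "?l ?L ?x = (\<Sum>m\<in>?k h. if m0 = m then ?l h m else 0)"
      unfolding L using uniq dm0 by (intro sum.cong refl) auto
    also have "\<dots> = (if m0 \<in> ?k h then ?l h m0 else 0)" by (rule sum.delta') simp
    also have "\<dots> = ?l h m0" by (simp add: in_keys_iff)
    finally have Lx: "?l ?L ?x = ?l h m0" .
    have "poly_val (\<lambda>_. 0) (mpderiv i (mpderiv j ?L)) =
        of_nat (?l (single i 1) j + 1) * ?l ?L ?x"
      by (simp add: poly_val_at_0 lookup_mpderiv)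
    then show "hessian_at_0 (n - 1) ?L $$ (i, j) = hessian_coeffs n d a (?l h) $$ (i, j)"
      using ij Lx by (simp add: hessian_at_0_def hessian_coeffs_def m0_def lookup_single when_def)
  qed (simp_all add: hessian_at_0_def hessian_coeffs_def)
  then show "\<exists>k<n. v $ k \<noteq> 0 \<and> (\<forall>m. mdeg m \<le> 1 \<longrightarrow> ?l (local_equation k v h) m = 0) \<and>
      det (hessian_at_0 (n - 1) (local_equation k v h)) \<noteq> 0"
    using a va0 low det by (intro exI[of _ a]) simp
qed

end

section \<open>The singular points of a nodal form and their position\<close>

lemma vertex_singular:
  assumes a: "a < n" and d: "d \<ge> 3" and h: "keys h \<subseteq> nodal_monoms n d"
  shows "point_class (unit_vec n a) \<in> singular_points n h"
proof -
  let ?k = "keys" and ?l = "lookup"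
  have "poly_val (($) v) h = 0 \<and> (\<forall>i<n. poly_val (($) v) (mpderiv i h) = 0)"
    if v: "v \<in> point_class (unit_vec n a)" for v :: "complex vec"
  proof -
    obtain c where c: "v = c \<cdot>\<^sub>v unit_vec n a" "c \<noteq> 0" using v by (auto simp: point_class_def)
    have supp: "{a} = {i \<in> {..<n}. v $ i \<noteq> 0}" using c a by (auto split: if_splits)
    have nm: "mdeg m = d" "?k m \<subseteq> {..<n}" "?l m i \<le> d - 2" if "m \<in> ?k h" for m i
      using that h by (auto simp: nodal_monoms_def monoms_def)
    \<comment> \<open>Such a monomial contains a variable other than x_a. The bound
      \<open>d - 1\<close> on the degree covers the monomials of \<open>h\<close> and those of its
      derivatives.\<close>
    have zero: "mono_val (($) v) m = 0" if "?k m \<subseteq> {..<n}" "mdeg m \<ge> d - 1" "?l m a \<le> d - 2" for m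
    proof -
      have "\<not> ?k m \<subseteq> {a}" using mdeg_superset[of "{a}" m] that d by auto
      then show ?thesis using mono_val_on_support[OF _ that(1) supp] by simp
    qed
    have "poly_val (($) v) h = 0"
      unfolding poly_val_def using zero nm by (intro sum.neutral) auto
    moreover have "poly_val (($) v) (mpderiv i h) = 0" for i
      unfolding poly_val_mpderiv
    proof (intro sum.neutral ballI)
      fix m assume m: "m \<in> ?k h"
      show "of_nat (?l m i) * ?l h m * mono_val (($) v) (m - single i 1) = 0"
      proof (cases "?l m i = 0")
        case False
        define m' where "m' = m - single i 1"
        have mm: "m = m' + single i 1"
          using False by (intro poly_mapping_eqI) (auto simp: m'_def lookup_add lookup_minus lookup_single when_def)
        have lm: "?l m w = ?l m' w + (if i = w then 1 else 0)" for w
          by (subst mm) (simp add: lookup_add lookup_single when_def)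
        have "?k m' \<subseteq> ?k m" by (auto simp: in_keys_iff lm)
        moreover have "mdeg m' = d - 1" using nm(1)[OF m] mm by (metis add_diff_cancel_right' mdeg_add mdeg_single)
        moreover have "?l m' a \<le> d - 2" using nm(3)[OF m, of a] lm[of a] by linarith
        ultimately have "mono_val (($) v) m' = 0" using nm(2)[OF m] by (intro zero) auto
        then show ?thesis by (simp add: m'_def)
      qed simp
    qed
    ultimately show ?thesis by simp
  qed
  moreover have "(unit_vec n a :: complex vec) \<noteq> 0\<^sub>v n"
    using a by (metis index_unit_vec(1) index_zero_vec(1) one_neq_zero)
  then have "point_class (unit_vec n a) \<in> proj_points n"
    by (auto simp: proj_points_def)
  ultimately show ?thesis by (simp add: singular_points_def)
qed

lemma point_class_smult:
  assumes "c \<noteq> 0"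
  shows "point_class (c \<cdot>\<^sub>v v) = point_class v"
proof (intro equalityI subsetI)
  fix w assume "w \<in> point_class (c \<cdot>\<^sub>v v)"
  then obtain b where "w = b \<cdot>\<^sub>v (c \<cdot>\<^sub>v v)" "b \<noteq> 0" by (auto simp: point_class_def)
  then show "w \<in> point_class v"
    using assms by (auto simp: point_class_def smult_smult_assoc intro!: exI[of _ "b * c"])
next
  fix w assume "w \<in> point_class v"
  then obtain b where "w = b \<cdot>\<^sub>v v" "b \<noteq> 0" by (auto simp: point_class_def)
  then show "w \<in> point_class (c \<cdot>\<^sub>v v)"
    using assms by (auto simp: point_class_def smult_smult_assoc intro!: exI[of _ "b / c"])
qed

lemma singular_points_eq_vertices:
  assumes d: "d \<ge> 3" and h: "keys h \<subseteq> nodal_monoms n d"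
    and no: "\<And>p i j. i < n \<Longrightarrow> j < n \<Longrightarrow> i \<noteq> j \<Longrightarrow> p i \<noteq> 0 \<Longrightarrow> p j \<noteq> 0 \<Longrightarrow>
      \<exists>k<n. poly_val p (mpderiv k h) \<noteq> 0"
  shows "singular_points n h = (\<lambda>a. point_class (unit_vec n a)) ` {..<n}"
proof (intro equalityI subsetI)
  fix P assume "P \<in> singular_points n h"
  then obtain v where v: "v \<in> carrier_vec n" "v \<noteq> 0\<^sub>v n" "P = point_class v"
    and sing: "\<forall>w\<in>point_class v. \<forall>i<n. poly_val (($) w) (mpderiv i h) = 0"
    by (auto simp: singular_points_def proj_points_def)
  have "1 \<cdot>\<^sub>v v \<in> point_class v" unfolding point_class_def using one_neq_zero by blast
  then have sv: "\<forall>i<n. poly_val (($) v) (mpderiv i h) = 0" using sing by simp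
  have "\<exists>a<n. v $ a \<noteq> 0"
  proof (rule ccontr)
    assume "\<not> ?thesis"
    then have "v = 0\<^sub>v n" using v(1) by (intro eq_vecI) auto
    then show False using v(2) by contradiction
  qed
  then obtain a where a: "a < n" "v $ a \<noteq> 0" by blast
  have "v $ i = 0" if "i < n" "i \<noteq> a" for i
    using no[of i a "($) v"] that a sv by auto
  then have "v = v $ a \<cdot>\<^sub>v unit_vec n a"
    using v(1) a by (intro eq_vecI) auto
  then have "P = point_class (unit_vec n a)"
    using point_class_smult[OF a(2)] v(3) by metis
  then show "P \<in> (\<lambda>a. point_class (unit_vec n a)) ` {..<n}" using a by blast
qed (use vertex_singular[OF _ d h] in auto)

lemma vertices_inj: "inj_on (\<lambda>a. point_class (unit_vec n a :: complex vec)) {..<n}"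
proof (rule inj_onI)
  fix a b assume ab: "a \<in> {..<n}" "b \<in> {..<n}"
    and eq: "point_class (unit_vec n a :: complex vec) = point_class (unit_vec n b)"
  have "1 \<cdot>\<^sub>v unit_vec n a \<in> point_class (unit_vec n a :: complex vec)"
    unfolding point_class_def using one_neq_zero by blast
  then obtain c where c: "1 \<cdot>\<^sub>v unit_vec n a = c \<cdot>\<^sub>v (unit_vec n b :: complex vec)"
    unfolding eq by (auto simp: point_class_def)
  show "a = b" using arg_cong[OF c, of "\<lambda>v. v $ a"] ab by (auto split: if_splits)
qed

lemma vertices_general_position:
  "general_position n ((\<lambda>a. point_class (unit_vec n a)) ` {..<n})"
  unfolding general_position_def
proof (intro allI impI)
  fix r :: "complex vec set \<Rightarrow> complex vec"
  assume r: "\<forall>P\<in>(\<lambda>a. point_class (unit_vec n a)) ` {..<n}. r P \<in> P"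
  let ?P = "\<lambda>a. point_class (unit_vec n a :: complex vec)"
  have "\<forall>a\<in>{..<n}. \<exists>c. c \<noteq> 0 \<and> r (?P a) = c \<cdot>\<^sub>v unit_vec n a"
  proof
    fix a assume "a \<in> {..<n}"
    then have "r (?P a) \<in> ?P a" using r by blast
    then show "\<exists>c. c \<noteq> 0 \<and> r (?P a) = c \<cdot>\<^sub>v unit_vec n a" unfolding point_class_def by blast
  qed
  from bchoice[OF this] obtain c where c: "\<And>a. a < n \<Longrightarrow> c a \<noteq> 0 \<and> r (?P a) = c a \<cdot>\<^sub>v unit_vec n a"
    by auto
  \<comment> \<open>Any representatives of the coordinate points are the rows of an invertible
    diagonal matrix.\<close>
  define D where "D = mat n n (\<lambda>(i, j). if i = j then c i else 0)"
  have D: "D \<in> carrier_mat n n" by (simp add: D_def)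
  have row: "row D a = r (?P a)" if "a < n" for a
    using c[OF that] that by (intro eq_vecI) (auto simp: D_def)
  have "set (rows D) = (\<lambda>a. row D a) ` {..<n}"
    using D by (auto simp: rows_def)
  also have "\<dots> = r ` ?P ` {..<n}"
    unfolding image_image using row by (intro image_cong) auto
  finally have "r ` ?P ` {..<n} = set (rows D)" by simp
  moreover have "upper_triangular D" by (auto simp: upper_triangular_def D_def)
  moreover have "0 \<notin> set (diag_mat D)" using c by (auto simp: diag_mat_def D_def)
  ultimately show "\<not> module.lin_dep class_ring (module_vec TYPE(complex) n) (r ` ?P ` {..<n})"
    using idom_vec.upper_triangular_imp_lin_indpt_rows[OF D] by simp
qed

section \<open>Coefficients of families of forms\<close>

text \<open>The index sets may exceed the supports, so fixed ones serve a whole family; this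
  exhibits the coefficients of a product as polynomials in the parameters.\<close>

lemma lookup_mult_superset:
  assumes "finite K" "keys p \<subseteq> K" "finite L" "keys q \<subseteq> L"
  shows "lookup (p * q) m = (\<Sum>a\<in>K. \<Sum>b\<in>L.
    if a + b = m then lookup p a * lookup q b else (0 :: 'b::comm_semiring_1))"
proof -
  have expand: "r = (\<Sum>a\<in>S. single a (lookup r a))"
    if "finite S" "keys r \<subseteq> S" for r :: "'a \<Rightarrow>\<^sub>0 'b" and S
    using that by (intro poly_mapping_eqI) (auto simp: lookup_sum_single in_keys_iff)
  have "p * q = (\<Sum>a\<in>K. \<Sum>b\<in>L. single (a + b) (lookup p a * lookup q b))"
    by (subst expand[OF assms(1,2)], subst expand[OF assms(3,4)]) (simp add: sum_product mult_single)
  then show ?thesis by (simp add: lookup_sum lookup_single when_def)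
qed

lemma lookup_mult_Var_shift:
  "lookup (p * Var i) (m + single i 1) = lookup (p :: 'v mpoly) m"
proof -
  have "lookup (p * Var i) (m + single i 1) =
      (\<Sum>a\<in>keys p. if m = a then lookup p a else 0)"
    by (subst lookup_mult_superset[of "keys p" _ "{single i 1}"])
      (auto intro!: sum.cong)
  then show ?thesis by (simp add: in_keys_iff)
qed

lemma lookup_mult_Var_0:
  assumes "lookup m i = 0"
  shows "lookup ((p :: 'v mpoly) * Var i) m = 0"
proof -
  have "a + single i 1 \<noteq> m" for a
    using assms by (auto simp: lookup_add)
  then show ?thesis
    by (subst lookup_mult_superset[of "keys p" _ "{single i 1}"]) auto
qed

lemma forms_1: "1 \<in> forms V 0"
  by (simp add: forms_def monoms_def mdeg_def)

lemma forms_add: "p \<in> forms V k \<Longrightarrow> q \<in> forms V k \<Longrightarrow> p + q \<in> forms V k"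
  unfolding forms_def using Poly_Mapping.keys_add[of p q] by blast

lemma forms_sum: "(\<And>i. i \<in> S \<Longrightarrow> p i \<in> forms V k) \<Longrightarrow> (\<Sum>i\<in>S. p i) \<in> forms V k"
  by (induction S rule: infinite_finite_induct) (auto intro: forms_add, auto simp: forms_def)

lemma forms_Const_mult: "p \<in> forms V k \<Longrightarrow> Const c * p \<in> forms V k"
  unfolding forms_def by (auto simp: in_keys_iff lookup_Const_mult)

lemma forms_Var: "i \<in> V \<Longrightarrow> Var i \<in> forms V 1"
  by (simp add: forms_def monoms_def)

definition form_family :: "'i set \<Rightarrow> 'v set \<Rightarrow> nat \<Rightarrow> (('i \<Rightarrow> complex) \<Rightarrow> 'v mpoly) \<Rightarrow> bool" where
  "form_family I V k p \<longleftrightarrow> (\<forall>z. p z \<in> forms V k) \<and> (\<forall>m. polyfun I (\<lambda>z. lookup (p z) m))"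

lemma form_family_const: "p \<in> forms V k \<Longrightarrow> form_family I V k (\<lambda>z. p)"
  by (auto simp: form_family_def)

lemma form_family_mult:
  assumes "finite V" "form_family I V k p" "form_family I V l q"
  shows "form_family I V (k + l) (\<lambda>z. p z * q z)"
  unfolding form_family_def
proof (intro conjI allI)
  show "p z * q z \<in> forms V (k + l)" for z using assms by (auto simp: form_family_def intro: forms_mult)
  fix m
  have "lookup (p z * q z) m = (\<Sum>a\<in>monoms V k. \<Sum>b\<in>monoms V l.
      (if a + b = m then 1 else 0) * (lookup (p z) a * lookup (q z) b))" for z
    using assms by (subst lookup_mult_superset[of "monoms V k" _ "monoms V l"])
      (auto simp: form_family_def forms_def finite_monoms intro!: sum.cong)
  moreover have "polyfun I (\<lambda>z. \<Sum>a\<in>monoms V k. \<Sum>b\<in>monoms V l.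
      (if a + b = m then 1 else 0) * (lookup (p z) a * lookup (q z) b))"
    using assms(2,3) unfolding form_family_def
    by (intro polyfun_sum polyfun_mult polyfun_const) auto
  ultimately show "polyfun I (\<lambda>z. lookup (p z * q z) m)" by simp
qed

lemma form_family_sum:
  assumes "\<And>s. s \<in> S \<Longrightarrow> form_family I V k (p s)"
  shows "form_family I V k (\<lambda>z. \<Sum>s\<in>S. p s z)"
  using assms by (auto simp: form_family_def lookup_sum intro!: forms_sum polyfun_sum)

lemma form_family_scale:
  assumes "polyfun I c" "form_family I V k p"
  shows "form_family I V k (\<lambda>z. Const (c z) * p z)"
  using assms by (auto simp: form_family_def lookup_Const_mult intro!: forms_Const_mult polyfun_mult)

lemma form_family_power:
  assumes "finite V" "form_family I V 1 p"
  shows "form_family I V k (\<lambda>z. p z ^ k)"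
proof (induction k)
  case 0
  show ?case using form_family_const[OF forms_1] by simp
next
  case (Suc k)
  show ?case using form_family_mult[OF assms(1,2) Suc] by simp
qed

lemma form_family_mono_val:
  assumes V: "finite V" and "\<And>v. v \<in> keys m \<Longrightarrow> form_family I V 1 (\<lambda>z. \<sigma> z v)"
  shows "form_family I V (mdeg m) (\<lambda>z. mono_val (\<sigma> z) m)"
proof -
  have "form_family I V (\<Sum>v\<in>S. lookup m v) (\<lambda>z. \<Prod>v\<in>S. \<sigma> z v ^ lookup m v)"
    if "finite S" "S \<subseteq> keys m" for S
    using that
  proof (induction S rule: finite_induct)
    case empty
    show ?case using form_family_const[OF forms_1] by simp
  next
    case (insert v S)
    then show ?case
      using form_family_mult[OF V form_family_power[OF V assms(2)]] by simp
  qed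
  from this[of "keys m"] show ?thesis by (simp add: mono_val_def mdeg_def)
qed

lemma poly_subst_superset:
  assumes "finite K" "keys p \<subseteq> K"
  shows "poly_subst \<sigma> p = (\<Sum>m\<in>K. Const (lookup p m) * mono_val \<sigma> m)"
  unfolding poly_subst_def using assms by (intro sum.mono_neutral_left) (auto simp: in_keys_iff)

section \<open>Derivatives of values and of coefficients\<close>

lemma poly_val_on_line:
  "\<exists>q. \<forall>t. poly_val (\<lambda>v. z v + t * w v) p = poly q t"
proof
  let ?q = "\<Sum>m\<in>keys p. Polynomial.smult (lookup p m)
    (\<Prod>v\<in>keys m. [:z v, w v:] ^ lookup m v)"
  show "\<forall>t. poly_val (\<lambda>v. z v + t * w v) p = poly ?q t"
    by (simp add: poly_val_def mono_val_def poly_sum poly_prod poly_power)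
qed

lemma mono_val_has_derivative:
  assumes "finite V" "keys m \<subseteq> V"
  shows "((\<lambda>t. mono_val (\<lambda>j. x j + t * \<tau> j) m) has_field_derivative
    (\<Sum>j\<in>V. of_nat (lookup m j) * mono_val x (m - single j 1) * \<tau> j)) (at (0::complex))"
proof -
  let ?l = lookup
  have "((\<lambda>t. \<Prod>j\<in>V. (x j + t * \<tau> j) ^ ?l m j) has_field_derivative
    (\<Sum>j\<in>V. (of_nat (?l m j) * (x j + 0 * \<tau> j) ^ (?l m j - 1) * \<tau> j) *
      (\<Prod>i\<in>V - {j}. (x i + 0 * \<tau> i) ^ ?l m i))) (at 0)"
    by (rule has_field_derivative_prod) (auto intro!: derivative_eq_intros)
  also have "(\<lambda>t. \<Prod>j\<in>V. (x j + t * \<tau> j) ^ ?l m j) = (\<lambda>t. mono_val (\<lambda>j. x j + t * \<tau> j) m)"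
    using assms by (simp add: mono_val_superset[of V])
  also have "(\<Sum>j\<in>V. (of_nat (?l m j) * (x j + 0 * \<tau> j) ^ (?l m j - 1) * \<tau> j) *
      (\<Prod>i\<in>V - {j}. (x i + 0 * \<tau> i) ^ ?l m i)) =
      (\<Sum>j\<in>V. of_nat (?l m j) * mono_val x (m - single j 1) * \<tau> j)"
  proof (intro sum.cong refl)
    fix j assume j: "j \<in> V"
    have "keys (m - single j 1) \<subseteq> V"
    proof
      fix v assume "v \<in> keys (m - single j 1)"
      then have "v \<in> keys m" by (auto simp: in_keys_iff lookup_minus)
      then show "v \<in> V" using assms by blast
    qed
    then have "mono_val x (m - single j 1) = (\<Prod>i\<in>V. x i ^ ?l (m - single j 1) i)"
      by (rule mono_val_superset[OF assms(1)])
    also have "\<dots> = x j ^ (?l m j - 1) * (\<Prod>i\<in>V - {j}. x i ^ ?l (m - single j 1) i)"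
      using assms(1) j by (subst prod.remove[of V j]) (simp_all add: lookup_minus)
    also have "(\<Prod>i\<in>V - {j}. x i ^ ?l (m - single j 1) i) = (\<Prod>i\<in>V - {j}. x i ^ ?l m i)"
      by (intro prod.cong) (auto simp: lookup_minus lookup_single when_def)
    finally show "(of_nat (?l m j) * (x j + 0 * \<tau> j) ^ (?l m j - 1) * \<tau> j) *
      (\<Prod>i\<in>V - {j}. (x i + 0 * \<tau> i) ^ ?l m i) = of_nat (?l m j) * mono_val x (m - single j 1) * \<tau> j"
      by simp
  qed
  finally show ?thesis .
qed

text \<open>Coefficients are determined by values, so derivatives of coefficients can be read off from
  derivatives of values.\<close>

lemma coefficient_derivative:
  assumes V: "finite V" and p: "\<And>t. p t \<in> forms V d" and Q: "Q \<in> forms V d"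
    and q: "\<And>m. \<exists>q. \<forall>t. lookup (p t) m = poly q t"
    and der: "\<And>x. ((\<lambda>t. poly_val x (p t)) has_field_derivative poly_val x Q) (at 0)"
  shows "((\<lambda>t. lookup (p t) m) has_field_derivative lookup Q m) (at 0)"
proof -
  let ?l = lookup
  have "\<forall>m. \<exists>q. \<forall>t. ?l (p t) m = poly q t" using q by blast
  then obtain q where q: "\<And>m t. ?l (p t) m = poly (q m) t" by metis
  define D where "D m = poly (pderiv (q m)) 0" for m
  have D: "((\<lambda>t. ?l (p t) m) has_field_derivative D m) (at 0)" for m
    unfolding q D_def by (rule poly_DERIV)
  \<comment> \<open>The form built from the derivatives of the coefficients has the same values as
    \<open>Q\<close>, by uniqueness of derivatives, hence equals \<open>Q\<close>.\<close>
  define P where "P = (\<Sum>m\<in>monoms V d. single m (D m))"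
  have fin: "finite (monoms V d)" by (rule finite_monoms[OF V])
  have "poly_val x P = poly_val x Q" for x
  proof (rule DERIV_unique)
    have "poly_val x (p t) = (\<Sum>m\<in>monoms V d. ?l (p t) m * mono_val x m)" for t
      using p[of t] by (intro poly_val_superset[OF fin]) (auto simp: forms_def)
    moreover have "((\<lambda>t. \<Sum>m\<in>monoms V d. ?l (p t) m * mono_val x m) has_field_derivative
        (\<Sum>m\<in>monoms V d. D m * mono_val x m)) (at 0)"
      by (intro DERIV_sum DERIV_cmult_right D)
    ultimately show "((\<lambda>t. poly_val x (p t)) has_field_derivative poly_val x P) (at 0)"
      by (simp add: P_def poly_val_sum poly_val_single)
  qed (rule der)
  then have PQ: "P = Q" by (rule mpoly_eqI)
  show ?thesis
  proof (cases "m \<in> monoms V d")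
    case True
    then have "?l Q m = D m" unfolding PQ[symmetric] P_def lookup_sum_single[OF fin] by simp
    then show ?thesis using D by simp
  next
    case False
    then have "m \<notin> keys Q" "\<And>t. m \<notin> keys (p t)"
      using p Q by (auto simp: forms_def)
    then have "?l Q m = 0" "\<And>t. ?l (p t) m = 0"
      by (simp_all add: not_in_keys_iff_lookup_eq_zero)
    then show ?thesis by simp
  qed
qed

section \<open>The parametrization\<close>

text \<open>
  The parameter space of the pairs (form, shear) is identified with the coefficient space of all
  forms of degree \<open>d\<close>: a free monomial carries a coefficient of a form whose restriction to
  \<open>x\<^sub>n = 0\<close> is singular at the coordinate points, and the remaining \<open>n\<^sup>2\<close> monomials
  \<open>x\<^sub>i\<^bsup>d-1\<^esup> x\<^sub>j\<close> and \<open>x\<^sub>i\<^bsup>d\<^esup>\<close> (the latter for \<open>j = n\<close>) carry the entries of the shear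
  \<open>x\<^sub>j \<mapsto> x\<^sub>j + \<Sum>\<^sub>i z\<^sub>i\<^sub>j x\<^sub>i\<close>.
\<close>

definition edge_monom :: "nat \<Rightarrow> nat \<Rightarrow> nat \<Rightarrow> nat \<Rightarrow> (nat \<Rightarrow>\<^sub>0 nat)" where
  "edge_monom n d i j = single i (d - 1) + single (if j = n then i else j) 1"

definition shear_pairs :: "nat \<Rightarrow> (nat \<times> nat) set" where
  "shear_pairs n = {(i, j). i < n \<and> j \<le> n \<and> j \<noteq> i}"

definition edge_monoms :: "nat \<Rightarrow> nat \<Rightarrow> (nat \<Rightarrow>\<^sub>0 nat) set" where
  "edge_monoms n d = (\<lambda>(i, j). edge_monom n d i j) ` shear_pairs n"

definition free_monoms :: "nat \<Rightarrow> nat \<Rightarrow> (nat \<Rightarrow>\<^sub>0 nat) set" where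
  "free_monoms n d = monoms {..<n + 1} d - edge_monoms n d"

text \<open>No multiple of x_n is added to another variable: such a change fixes the hyperplane x_n
  = 0 pointwise and does not affect the section.\<close>

definition shear :: "nat \<Rightarrow> nat \<Rightarrow> ((nat \<Rightarrow>\<^sub>0 nat) \<Rightarrow> complex) \<Rightarrow> nat \<Rightarrow> nat \<Rightarrow> complex" where
  "shear n d z j i = (if i = j then 1 else if i < n then z (edge_monom n d i j) else 0)"

definition base_form :: "nat \<Rightarrow> nat \<Rightarrow> ((nat \<Rightarrow>\<^sub>0 nat) \<Rightarrow> complex) \<Rightarrow> nat mpoly" where
  "base_form n d z = (\<Sum>m\<in>free_monoms n d. single m (z m))"

definition sheared_form :: "nat \<Rightarrow> nat \<Rightarrow> ((nat \<Rightarrow>\<^sub>0 nat) \<Rightarrow> complex) \<Rightarrow> nat mpoly" where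
  "sheared_form n d z = poly_subst (\<lambda>j. \<Sum>i<n + 1. Const (shear n d z j i) * Var i) (base_form n d z)"

text \<open>
  The form \<open>\<Sum> x\<^sub>a\<^bsup>d-2\<^esup> x\<^sub>b x\<^sub>c + \<Sum> x\<^sub>a\<^bsup>d-1\<^esup> x\<^sub>n\<close> over distinct \<open>a, b, c < n\<close>, with the identity as shear.
\<close>

definition base_point :: "nat \<Rightarrow> nat \<Rightarrow> (nat \<Rightarrow>\<^sub>0 nat) \<Rightarrow> complex" where
  "base_point n d m = (if
     lookup m n = 1 \<and> (\<exists>a<n. lookup m a = d - 1) \<or>
     lookup m n = 0 \<and> (\<exists>a<n. lookup m a = d - 2 \<and>
       (\<forall>i. i \<noteq> a \<longrightarrow> lookup m i \<le> 1)) then 1 else 0)"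

context
  fixes n d :: nat
  assumes n: "n \<ge> 3" and d: "d \<ge> 3"
begin

declare sum.lessThan_Suc [simp del] lessThan_Suc [simp del]

lemma lookup_edge_monom:
  assumes "(i, j) \<in> shear_pairs n"
  shows "lookup (edge_monom n d i j) v =
    (if v = i then (if j = n then d else d - 1) else if v = j \<and> j \<noteq> n then 1 else 0)"
  using assms d by (auto simp: edge_monom_def shear_pairs_def lookup_add lookup_single when_def)

lemma edge_monom_in: "(i, j) \<in> shear_pairs n \<Longrightarrow> edge_monom n d i j \<in> monoms {..<n + 1} d"
proof -
  assume ij: "(i, j) \<in> shear_pairs n"
  have "keys (edge_monom n d i j) \<subseteq> {..<n + 1}"
  proof
    fix v assume "v \<in> keys (edge_monom n d i j)"
    then have "lookup (edge_monom n d i j) v \<noteq> 0" by (simp add: in_keys_iff)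
    then show "v \<in> {..<n + 1}" using ij unfolding lookup_edge_monom[OF ij]
      by (auto simp: shear_pairs_def split: if_splits)
  qed
  then show ?thesis using d by (simp add: monoms_def) (simp add: edge_monom_def mdeg_add)
qed

text \<open>As \<open>d - 1 \<ge> 2\<close>, the first index is the only one whose exponent reaches
  \<open>d - 1\<close>. So distinct shear entries occupy distinct coordinates.\<close>

lemma edge_monom_inj:
  assumes "(i, j) \<in> shear_pairs n" "(k, l) \<in> shear_pairs n" "edge_monom n d i j = edge_monom n d k l"
  shows "i = k \<and> j = l"
proof -
  have e: "(if v = i then (if j = n then d else d - 1) else if v = j \<and> j \<noteq> n then 1 else 0) =
      (if v = k then (if l = n then d else d - 1) else if v = l \<and> l \<noteq> n then 1 else 0)" for v
    using lookup_edge_monom[OF assms(1), of v] lookup_edge_monom[OF assms(2), of v] assms(3) by simp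
  have ik: "i = k" using e[of i] d by (auto split: if_splits)
  have "j = l"
    using e[of j] e[of l] e[of i] d assms(1,2) ik by (auto simp: shear_pairs_def split: if_splits)
  with ik show ?thesis by simp
qed

lemma finite_free_monoms: "finite (free_monoms n d)"
  unfolding free_monoms_def using finite_monoms[of "{..<n + 1}" d] by simp

lemma lookup_base_form: "lookup (base_form n d z) m = (if m \<in> free_monoms n d then z m else 0)"
  unfolding base_form_def by (rule lookup_sum_single[OF finite_free_monoms])

lemma keys_base_form: "keys (base_form n d z) \<subseteq> free_monoms n d"
  using lookup_base_form by (metis in_keys_iff subsetI)

lemma keys_free_monoms: "m \<in> free_monoms n d \<Longrightarrow> keys m \<subseteq> {..<n + 1}"
  by (simp add: free_monoms_def monoms_def)

lemma sheared_form_eq: "sheared_form n d z = (\<Sum>m\<in>free_monoms n d.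
    Const (z m) * mono_val (\<lambda>j. \<Sum>i<n + 1. Const (shear n d z j i) * Var i) m)"
  unfolding sheared_form_def poly_subst_superset[OF finite_free_monoms keys_base_form]
  by (intro sum.cong) (auto simp: lookup_base_form)

lemma polyfun_shear:
  assumes "j < n + 1" "i < n + 1"
  shows "polyfun (monoms {..<n + 1} d) (\<lambda>z. shear n d z j i)"
proof (cases "i = j \<or> \<not> i < n")
  case True
  then show ?thesis by (cases "i = j") (simp_all add: shear_def polyfun_const)
next
  case False
  then have "(i, j) \<in> shear_pairs n" using assms by (auto simp: shear_pairs_def)
  then show ?thesis using False polyfun_var[OF edge_monom_in] by (simp add: shear_def)
qed

lemma sheared_form_family: "form_family (monoms {..<n + 1} d) {..<n + 1} d (sheared_form n d)"
  unfolding sheared_form_eq[abs_def]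
proof (rule form_family_sum)
  let ?I = "monoms {..<n + 1} d"
  fix m assume m: "m \<in> free_monoms n d"
  have mI: "m \<in> ?I" and md: "mdeg m = d" using m by (auto simp: free_monoms_def monoms_def)
  have "form_family ?I {..<n + 1} 1 (\<lambda>z. \<Sum>i<n + 1. Const (shear n d z j i) * Var i)" if "j < n + 1" for j
  proof (intro form_family_sum form_family_scale)
    fix i assume i: "i \<in> {..<n + 1}"
    show "form_family ?I {..<n + 1} 1 (\<lambda>z. Var i)" by (rule form_family_const[OF forms_Var[OF i]])
    show "polyfun ?I (\<lambda>z. shear n d z j i)" using that i by (intro polyfun_shear) auto

  qed
  then have "form_family ?I {..<n + 1} (mdeg m) (\<lambda>z. mono_val (\<lambda>j. \<Sum>i<n + 1. Const (shear n d z j i) * Var i) m)"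
    using keys_free_monoms[OF m] by (intro form_family_mono_val) auto
  then show "form_family ?I {..<n + 1} d (\<lambda>z. Const (z m) *
      mono_val (\<lambda>j. \<Sum>i<n + 1. Const (shear n d z j i) * Var i) m)"
    unfolding md by (intro form_family_scale polyfun_var[OF mI])
qed

lemma sheared_form_in_forms: "sheared_form n d z \<in> forms {..<n + 1} d"
  using sheared_form_family by (simp add: form_family_def)

lemma poly_val_sheared_form:
  "poly_val x (sheared_form n d z) =
    poly_val (\<lambda>j. \<Sum>i<n + 1. shear n d z j i * x i) (base_form n d z)"
  by (simp add: sheared_form_def poly_val_subst poly_val_sum poly_val_mult)

lemma poly_val_base_form:
  "poly_val x (base_form n d z) = (\<Sum>m\<in>free_monoms n d. z m * mono_val x m)"
  by (simp add: base_form_def poly_val_sum poly_val_single)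

section \<open>Coefficients of the test form and the derivative there\<close>

lemma base_point_edge:
  assumes "(i, j) \<in> shear_pairs n"
  shows "base_point n d (edge_monom n d i j) = 0"
  using assms d unfolding base_point_def lookup_edge_monom[OF assms]
  by (auto simp: shear_pairs_def split: if_splits)

lemma base_point_linear:
  assumes "a < n"
  shows "base_point n d (single a (d - 1) + single n 1) = 1"
  using assms d by (auto simp: base_point_def lookup_add lookup_single when_def)

lemma base_point_quadratic:
  assumes "a < n" "b < n" "c < n" "a \<noteq> b" "a \<noteq> c"
  shows "base_point n d (single a (d - 2) + single b 1 + single c 1) =
    (if b = c then 0 else 1)"
proof (cases "b = c")
  case True
  then show ?thesis using assms d
    by (auto simp: base_point_def lookup_add lookup_single when_def split: if_splits)
next
  case False
  let ?m = "single a (d - 2) + single b 1 + single c 1"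
  have "lookup ?m n = 0" "lookup ?m a = d - 2"
    "\<forall>i. i \<noteq> a \<longrightarrow> lookup ?m i \<le> 1"
    using False assms by (auto simp: lookup_add lookup_single when_def)
  then have "base_point n d ?m = 1" unfolding base_point_def using assms(1) by auto
  then show ?thesis using False by simp
qed

lemma base_point_mixed:
  assumes "a < n" "b < n" "a \<noteq> b"
  shows "base_point n d (single a (d - 2) + single b 1 + single n 1) = 0"
  using assms d by (auto simp: base_point_def lookup_add lookup_single when_def split: if_splits)

lemma lookup_base_point:
  assumes "m \<in> monoms {..<n + 1} d"
  shows "lookup (base_form n d (base_point n d)) m = base_point n d m"
  using assms base_point_edge by (auto simp: lookup_base_form free_monoms_def edge_monoms_def)

text \<open>The tangent vector, in direction \<open>u\<close> at the identity, to the orbit of the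
  test form under the shears: each partial derivative times the increment of its variable.\<close>

definition shear_deriv :: "(nat \<Rightarrow> nat \<Rightarrow> complex) \<Rightarrow> nat mpoly" where
  "shear_deriv u = (\<Sum>j<n + 1. mpderiv j (base_form n d (base_point n d)) * (\<Sum>i\<in>{..<n} - {j}. Const (u i j) * Var i))"

lemma poly_val_shear_deriv:
  "poly_val x (shear_deriv u) = (\<Sum>j<n + 1. (\<Sum>m\<in>free_monoms n d. of_nat (lookup m j) * base_point n d m *
     mono_val x (m - single j 1)) * (\<Sum>i\<in>{..<n} - {j}. u i j * x i))"
proof -
  have "poly_val x (mpderiv j (base_form n d (base_point n d))) = (\<Sum>m\<in>free_monoms n d.
     of_nat (lookup m j) * base_point n d m * mono_val x (m - single j 1))" for j
  proof -
    let ?f = "base_form n d (base_point n d)"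
    have "poly_val x (mpderiv j ?f) = (\<Sum>m\<in>free_monoms n d. of_nat (lookup m j) *
       lookup ?f m * mono_val x (m - single j 1))"
      unfolding poly_val_mpderiv using keys_base_form finite_free_monoms
      by (intro sum.mono_neutral_left) (auto simp: in_keys_iff)
    also have "\<dots> = (\<Sum>m\<in>free_monoms n d.
       of_nat (lookup m j) * base_point n d m * mono_val x (m - single j 1))"
      by (intro sum.cong) (auto simp: lookup_base_form)
    finally show ?thesis .
  qed
  then show ?thesis by (simp add: shear_deriv_def poly_val_sum poly_val_mult)
qed

text \<open>Product rule at the identity shear: varying the form contributes
  \<open>base_form n d w\<close>, varying the shear contributes
  \<open>shear_deriv u\<close>.\<close>

lemma sheared_form_value_derivative:
  fixes w :: "(nat \<Rightarrow>\<^sub>0 nat) \<Rightarrow> complex"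
  assumes u: "\<And>i j. (i, j) \<in> shear_pairs n \<Longrightarrow> w (edge_monom n d i j) = u i j"
  shows "((\<lambda>t. poly_val x (sheared_form n d (\<lambda>m. base_point n d m + t * w m))) has_field_derivative
    poly_val x (base_form n d w + shear_deriv u)) (at 0)"
proof -
  define \<tau> where "\<tau> j = (\<Sum>i\<in>{..<n} - {j}. u i j * x i)" for j
  have sh: "(\<Sum>i<n + 1. shear n d (\<lambda>m. base_point n d m + t * w m) j i * x i) = x j + t * \<tau> j"
    if j: "j < n + 1" for t j
  proof -
    let ?s = "\<lambda>i. shear n d (\<lambda>m. base_point n d m + t * w m) j i * x i"
    have "(\<Sum>i<n + 1. ?s i) = ?s j + (\<Sum>i\<in>{..<n + 1} - {j}. ?s i)"
      using j by (intro sum.remove) auto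
    also have "(\<Sum>i\<in>{..<n + 1} - {j}. ?s i) = (\<Sum>i\<in>{..<n} - {j}. ?s i)"
      by (intro sum.mono_neutral_right) (auto simp: shear_def)
    also have "\<dots> = (\<Sum>i\<in>{..<n} - {j}. t * (u i j * x i))"
    proof (intro sum.cong refl)
      fix i assume i: "i \<in> {..<n} - {j}"
      then have "(i, j) \<in> shear_pairs n" using j by (auto simp: shear_pairs_def)
      then show "?s i = t * (u i j * x i)" using i base_point_edge u by (simp add: shear_def)
    qed
    finally show ?thesis by (simp add: shear_def \<tau>_def sum_distrib_left)
  qed
  have val: "poly_val x (sheared_form n d (\<lambda>m. base_point n d m + t * w m)) =
      (\<Sum>m\<in>free_monoms n d. (base_point n d m + t * w m) * mono_val (\<lambda>j. x j + t * \<tau> j) m)" for t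
    unfolding poly_val_sheared_form poly_val_base_form
  proof (intro sum.cong refl arg_cong2[where f = "(*)"] mono_val_cong)
    fix m j assume "m \<in> free_monoms n d" "j \<in> keys m"
    then show "(\<Sum>i<n + 1. shear n d (\<lambda>m. base_point n d m + t * w m) j i * x i) = x j + t * \<tau> j"
      using keys_free_monoms by (intro sh) auto
  qed
  let ?D = "\<lambda>m. \<Sum>j<n + 1. of_nat (lookup m j) * mono_val x (m - single j 1) * \<tau> j"
  have "((\<lambda>t. \<Sum>m\<in>free_monoms n d. (base_point n d m + t * w m) * mono_val (\<lambda>j. x j + t * \<tau> j) m)
    has_field_derivative (\<Sum>m\<in>free_monoms n d. w m * mono_val (\<lambda>j. x j + 0 * \<tau> j) m + ?D m * (base_point n d m + 0 * w m))) (at 0)"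
    using keys_free_monoms by (intro DERIV_sum DERIV_mult mono_val_has_derivative) (auto intro!: derivative_eq_intros)
  moreover have "(\<Sum>m\<in>free_monoms n d. w m * mono_val (\<lambda>j. x j + 0 * \<tau> j) m + ?D m * (base_point n d m + 0 * w m)) =
    poly_val x (base_form n d w + shear_deriv u)"
  proof -
    have "(\<Sum>m\<in>free_monoms n d. ?D m * base_point n d m) = poly_val x (shear_deriv u)"
      unfolding poly_val_shear_deriv \<tau>_def[symmetric] sum_distrib_right
      by (subst sum.swap) (simp add: mult_ac)
    then show ?thesis
      by (simp add: poly_val_add poly_val_base_form sum.distrib)
  qed
  ultimately show ?thesis unfolding val by simp
qed

text \<open>\<open>W i\<close> gathers the terms whose increment contributes the factor x_i, so it
  reaches only monomials divisible by x_i. An edge monomial has at most two variables, hence at most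
  two rows contribute to it.\<close>

lemma shear_deriv_row:
  fixes u :: "nat \<Rightarrow> nat \<Rightarrow> complex"
  defines "W \<equiv> \<lambda>i s. \<Sum>j\<in>{..<n + 1} - {i}. u i j *
    lookup (mpderiv j (base_form n d (base_point n d)) * Var i) s"
  shows "lookup (shear_deriv u) s = (\<Sum>i<n. W i s)"
    and "lookup s i = 0 \<Longrightarrow> W i s = 0"
    and "W i (m + single i 1) = (\<Sum>j\<in>{..<n + 1} - {i}. u i j *
      (of_nat (lookup m j + 1) *
       lookup (base_form n d (base_point n d)) (m + single j 1)))"
proof -
  let ?f = "base_form n d (base_point n d)"
  have "shear_deriv u = (\<Sum>j<n + 1. \<Sum>i\<in>{..<n} - {j}. Const (u i j) * (mpderiv j ?f * Var i))"
    unfolding shear_deriv_def sum_distrib_left by (intro sum.cong refl) (simp add: mult_ac)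
  then have "lookup (shear_deriv u) s =
      (\<Sum>j<n + 1. \<Sum>i\<in>{..<n} - {j}. u i j * lookup (mpderiv j ?f * Var i) s)"
    by (simp add: lookup_sum lookup_Const_mult)
  also have "\<dots> = (\<Sum>j<n + 1. \<Sum>i<n. if i \<noteq> j then u i j * lookup (mpderiv j ?f * Var i) s else 0)"
    by (rule sum.cong[OF refl], rule sum.mono_neutral_cong_left) auto
  also have "\<dots> = (\<Sum>i<n. \<Sum>j<n + 1. if i \<noteq> j then u i j * lookup (mpderiv j ?f * Var i) s else 0)"
    by (rule sum.swap)
  also have "\<dots> = (\<Sum>i<n. W i s)"
    unfolding W_def by (rule sum.cong[OF refl], rule sum.mono_neutral_cong_right) auto
  finally show "lookup (shear_deriv u) s = (\<Sum>i<n. W i s)" .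
  show "W i s = 0" if "lookup s i = 0"
    using lookup_mult_Var_0[OF that] by (simp add: W_def)
  show "W i (m + single i 1) = (\<Sum>j\<in>{..<n + 1} - {i}. u i j *
      (of_nat (lookup m j + 1) * lookup ?f (m + single j 1)))"
    unfolding W_def lookup_mult_Var_shift lookup_mpderiv ..
qed

text \<open>The terms x_a^(d-1) x_n of the test form produce \<open>u b n\<close> (the tilt, through
  the non-zero derivative in x_n), and the terms x_a^(d-2) x_b x_j produce the sum of the
  \<open>u a j\<close> (the motion of the point \<open>a\<close>, through its Hessian).\<close>

lemma lookup_shear_deriv_edge:
  assumes ab: "(a, b) \<in> shear_pairs n"
  shows "lookup (shear_deriv u) (edge_monom n d a b) =
    (if b = n then u a n else u b n + (\<Sum>j\<in>{..<n} - {a, b}. u a j))"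
proof -
  let ?f = "base_form n d (base_point n d)" and ?l = lookup and ?e = "\<lambda>i. single i (1::nat)"
  define W where "W i s = (\<Sum>j\<in>{..<n + 1} - {i}. u i j * ?l (mpderiv j ?f * Var i) s)" for i s
  note W = shear_deriv_row[where u = u, folded W_def]
  have an: "a < n" "b \<le> n" "b \<noteq> a" using ab by (auto simp: shear_pairs_def)
  have linear: "W c (single a (d - 1) + ?e c) = u c n" if c: "c < n" for c
  proof -
    have g: "?l ?f (single a (d - 1) + ?e j) = (if j = n then 1 else 0)" if "j < n + 1" for j
    proof -
      have "single a (d - 1) + ?e j \<in> monoms {..<n + 1} d"
      proof -
        have "keys (single a (d - 1) + ?e j) \<subseteq> {a, j}"
          using Poly_Mapping.keys_add[of "single a (d - 1)" "?e j"] by (auto split: if_splits)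
        then show ?thesis using an that d by (auto simp: monoms_def mdeg_add)
      qed
      from lookup_base_point[OF this] have "?l ?f (single a (d - 1) + ?e j) =
        base_point n d (single a (d - 1) + ?e j)" .
      also have "\<dots> = (if j = n then 1 else 0)"
      proof (cases "j = n")
        case True
        then show ?thesis using base_point_linear[OF an(1)] by simp
      next
        case False
        \<comment> \<open>x_a^(d-1) x_j is an edge monomial for every \<open>j < n\<close>; in the
          case \<open>j = a\<close> it is x_a^d, which is encoded by the second index
          \<open>n\<close>.\<close>
        define j' where "j' = (if j = a then n else j)"
        have "(a, j') \<in> shear_pairs n" using an that False by (auto simp: shear_pairs_def j'_def)
        moreover have "edge_monom n d a j' = single a (d - 1) + ?e j"
          using False an by (auto simp: edge_monom_def j'_def)
        ultimately show ?thesis using base_point_edge False by fastforce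
      qed
      finally show ?thesis .
    qed
    have "W c (single a (d - 1) + ?e c) = (\<Sum>j\<in>{..<n + 1} - {c}. u c j *
      (of_nat (?l (single a (d - 1)) j + 1) * ?l ?f (single a (d - 1) + ?e j)))"
      by (rule W(3))
    also have "\<dots> = (\<Sum>j\<in>{..<n + 1} - {c}. if n = j then u c j else 0)"
    proof (intro sum.cong refl)
      fix j assume "j \<in> {..<n + 1} - {c}"
      then show "u c j * (of_nat (?l (single a (d - 1)) j + 1) *
          ?l ?f (single a (d - 1) + ?e j)) = (if n = j then u c j else 0)"
        using g[of j] an by (cases "j = n") (simp_all add: lookup_single)
    qed
    also have "\<dots> = u c n" using c by (subst sum.delta') auto
    finally show ?thesis .
  qed
  show ?thesis
  proof (cases "b = n")
    case True
    have e: "edge_monom n d a b = single a (d - 1) + ?e a" using True by (simp add: edge_monom_def)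
    have "?l (shear_deriv u) (edge_monom n d a b) = (\<Sum>i<n. W i (edge_monom n d a b))" by (rule W(1))
    also have "\<dots> = (\<Sum>i\<in>{a}. W i (edge_monom n d a b))"
    proof (rule sum.mono_neutral_right)
      show "\<forall>i\<in>{..<n} - {a}. W i (edge_monom n d a b) = 0"
        using W(2) lookup_edge_monom[OF ab] True by auto
    qed (use an in auto)
    also have "\<dots> = u a n" using linear[OF an(1)] e by simp
    finally show ?thesis using True by simp
  next
    case False
    then have bn: "b < n" using an by simp
    have e: "edge_monom n d a b = single a (d - 1) + ?e b" using False by (simp add: edge_monom_def)
    define m where "m = single a (d - 2) + ?e b"
    have e': "edge_monom n d a b = m + ?e a"
      unfolding e m_def using d by (intro poly_mapping_eqI) (auto simp: lookup_add lookup_single when_def)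
    have g: "u a j * (of_nat (?l m j + 1) * ?l ?f (m + ?e j)) = (if j < n \<and> j \<noteq> b then u a j else 0)"
      if j: "j < n + 1" "j \<noteq> a" for j
    proof -
      have "m + ?e j \<in> monoms {..<n + 1} d"
      proof -
        have "keys (m + ?e j) \<subseteq> {a, b, j}"
          using Poly_Mapping.keys_add[of m "?e j"] Poly_Mapping.keys_add[of "single a (d - 2)" "?e b"]
          by (auto simp: m_def split: if_splits)
        then show ?thesis using an bn j d by (auto simp: monoms_def mdeg_add m_def)
      qed
      from lookup_base_point[OF this] have f: "?l ?f (m + ?e j) = base_point n d (m + ?e j)" .
      show ?thesis
      proof (cases "j = n")
        case True
        then have "?l ?f (m + ?e j) = 0" using f base_point_mixed[OF an(1) bn] an by (simp add: m_def)
        then show ?thesis using True by simp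
      next
        case jn: False
        then have "base_point n d (m + ?e j) = (if b = j then 0 else 1)"
          unfolding m_def using an bn j by (intro base_point_quadratic) auto
        moreover have "j \<noteq> b \<Longrightarrow> ?l m j = 0" using j by (simp add: m_def lookup_add lookup_single)
        ultimately show ?thesis using jn j f by auto
      qed
    qed
    have "W a (edge_monom n d a b) = (\<Sum>j\<in>{..<n + 1} - {a}. u a j * (of_nat (?l m j + 1) * ?l ?f (m + ?e j)))"
      unfolding e' by (rule W(3))
    also have "\<dots> = (\<Sum>j\<in>{..<n + 1} - {a}. if j < n \<and> j \<noteq> b then u a j else 0)"
      using g by (intro sum.cong) auto
    also have "\<dots> = (\<Sum>j\<in>{..<n} - {a, b}. u a j)"
      by (intro sum.mono_neutral_cong_right) auto
    finally have Wa: "W a (edge_monom n d a b) = (\<Sum>j\<in>{..<n} - {a, b}. u a j)" .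
    have "?l (shear_deriv u) (edge_monom n d a b) = (\<Sum>i<n. W i (edge_monom n d a b))" by (rule W(1))
    also have "\<dots> = (\<Sum>i\<in>{a, b}. W i (edge_monom n d a b))"
      using an bn W(2) by (intro sum.mono_neutral_right) (auto simp: lookup_edge_monom[OF ab])
    also have "\<dots> = u b n + (\<Sum>j\<in>{..<n} - {a, b}. u a j)"
      using an linear[OF bn] Wa e by simp
    finally show ?thesis using False by simp
  qed
qed

text \<open>
  For fixed \<open>a\<close> the unknowns \<open>u a b\<close> enter through \<open>s - u a b\<close> with \<open>s\<close> the sum of all of them,
  which is determined by \<open>(n - 2) s\<close>.
\<close>

lemma shear_deriv_solvable:
  "\<exists>u. \<forall>(a, b)\<in>shear_pairs n. lookup (shear_deriv u) (edge_monom n d a b) = y (edge_monom n d a b)"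
proof -
  \<comment> \<open>The coefficient of x_a^d fixes the tilt \<open>u a n\<close>. With the tilts
    moved to the right-hand side \<open>r\<close>, there remain for each \<open>a\<close> equations
    in the \<open>u a j\<close> with \<open>j < n\<close> alone.\<close>
  define v where "v a = y (edge_monom n d a n)" for a
  define r where "r a b = y (edge_monom n d a b) - v b" for a b
  define s where "s a = (\<Sum>b\<in>{..<n} - {a}. r a b) / of_nat (n - 2)" for a
  define u where "u a b = (if b = n then v a else s a - r a b)" for a b
  have "(\<Sum>j\<in>{..<n} - {a, b}. u a j) = r a b" if ab: "a < n" "b < n" "a \<noteq> b" for a b
  proof -
    have "(\<Sum>j\<in>{..<n} - {a}. u a j) = (\<Sum>j\<in>{..<n} - {a}. s a - r a j)"
      by (intro sum.cong) (auto simp: u_def)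
    also have "\<dots> = of_nat (n - 1) * s a - (\<Sum>j\<in>{..<n} - {a}. r a j)"
      using ab by (simp add: sum_subtractf)
    also have "(\<Sum>j\<in>{..<n} - {a}. r a j) = of_nat (n - 2) * s a"
    proof -
      have "(of_nat (n - 2) :: complex) \<noteq> 0" unfolding of_nat_eq_0_iff using n by linarith
      then show ?thesis by (simp add: s_def del: of_nat_diff)
    qed
    also have "of_nat (n - 1) * s a - of_nat (n - 2) * s a = s a"
    proof -
      have "n - 1 = (n - 2) + 1" using n by simp
      then show ?thesis by (metis add_diff_cancel_left' distrib_right mult_1 of_nat_1 of_nat_add)
    qed
    finally have "(\<Sum>j\<in>{..<n} - {a}. u a j) = s a" .
    moreover have "(\<Sum>j\<in>{..<n} - {a}. u a j) = u a b + (\<Sum>j\<in>{..<n} - {a} - {b}. u a j)"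
      using ab by (intro sum.remove) auto
    moreover have "{..<n} - {a} - {b} = {..<n} - {a, b}" by auto
    moreover have "u a b = s a - r a b" using ab by (simp add: u_def)
    ultimately show ?thesis by (simp add: algebra_simps)
  qed
  then have "lookup (shear_deriv u) (edge_monom n d a b) = y (edge_monom n d a b)"
    if "(a, b) \<in> shear_pairs n" for a b
    unfolding lookup_shear_deriv_edge[OF that] using that
    by (auto simp: shear_pairs_def u_def r_def v_def)
  then show ?thesis by blast
qed

text \<open>The shear directions are chosen first, to produce the edge coefficients, which a change
  of the form within L leaves alone; the direction of the form then corrects the free
  coefficients.\<close>

lemma sheared_form_coefficients_submersive:
  "\<exists>w. \<forall>m\<in>monoms {..<n + 1} d.
    ((\<lambda>t. lookup (sheared_form n d (\<lambda>m. base_point n d m + t * w m)) m) has_field_derivative y m) (at 0)"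
proof -
  obtain u where u: "\<forall>(a, b)\<in>shear_pairs n.
      lookup (shear_deriv u) (edge_monom n d a b) = y (edge_monom n d a b)"
    using shear_deriv_solvable by blast
  define w where "w m = (if m \<in> edge_monoms n d
    then (case inv_into (shear_pairs n) (\<lambda>(i, j). edge_monom n d i j) m of (i, j) \<Rightarrow> u i j)
    else y m - lookup (shear_deriv u) m)" for m
  have inj: "inj_on (\<lambda>(i, j). edge_monom n d i j) (shear_pairs n)"
    using edge_monom_inj by (auto simp: inj_on_def)
  have wu: "w (edge_monom n d i j) = u i j" if "(i, j) \<in> shear_pairs n" for i j
  proof -
    have "edge_monom n d i j \<in> edge_monoms n d" using that by (auto simp: edge_monoms_def)
    moreover have "inv_into (shear_pairs n) (\<lambda>(i, j). edge_monom n d i j) (edge_monom n d i j) = (i, j)"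
      using inv_into_f_f[OF inj that] by simp
    ultimately show ?thesis by (simp add: w_def)
  qed
  let ?p = "\<lambda>t. sheared_form n d (\<lambda>m. base_point n d m + t * w m)"
  let ?Q = "base_form n d w + shear_deriv u"
  have fin: "finite {..<n + 1}" by simp
  have fam: "form_family (monoms {..<n + 1} d) {..<n + 1} d (sheared_form n d)" by (rule sheared_form_family)
  have bf: "base_form n d z \<in> forms {..<n + 1} d" for z
    using keys_base_form by (auto simp: forms_def free_monoms_def)
  have "shear_deriv u \<in> forms {..<n + 1} (d - 1 + 1)"
    unfolding shear_deriv_def
    by (intro forms_sum forms_mult mpderiv_in_forms bf forms_Const_mult forms_Var) auto
  then have Q: "?Q \<in> forms {..<n + 1} d" using d bf by (intro forms_add) auto
  have line: "\<exists>q. \<forall>t. lookup (?p t) m = poly q t" for m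
  proof -
    have "polyfun (monoms {..<n + 1} d) (\<lambda>z. lookup (sheared_form n d z) m)"
      using fam by (auto simp: form_family_def)
    then obtain P where "\<And>z. lookup (sheared_form n d z) m = poly_val z P"
      by (auto simp: polyfun_def)
    then show ?thesis using poly_val_on_line[of "base_point n d" w P] by simp
  qed
  have der: "((\<lambda>t. lookup (?p t) m) has_field_derivative lookup ?Q m) (at 0)" for m
    by (rule coefficient_derivative[OF fin sheared_form_in_forms Q line sheared_form_value_derivative[where w = w and u = u, OF wu]])
  have val: "lookup ?Q m = y m" if m: "m \<in> monoms {..<n + 1} d" for m
  proof (cases "m \<in> edge_monoms n d")
    case True
    then obtain a b where "(a, b) \<in> shear_pairs n" "m = edge_monom n d a b" by (auto simp: edge_monoms_def)
    then show ?thesis using u True by (auto simp: lookup_add lookup_base_form free_monoms_def)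
  next
    case False
    then have "m \<in> free_monoms n d" using m by (simp add: free_monoms_def)
    then show ?thesis using False by (simp add: lookup_add lookup_base_form w_def)
  qed
  show ?thesis
  proof (intro exI[of _ w] ballI)
    fix m assume "m \<in> monoms {..<n + 1} d"
    then show "((\<lambda>t. lookup (?p t) m) has_field_derivative y m) (at 0)"
      using der[of m] val[of m] by simp
  qed
qed

end

section \<open>Nodal hyperplane sections\<close>

definition nodal_form :: "nat \<Rightarrow> nat \<Rightarrow> nat mpoly \<Rightarrow> bool" where
  "nodal_form n d h \<longleftrightarrow> keys h \<subseteq> nodal_monoms n d \<and>
     (\<forall>a<n. det (hessian_coeffs n d a (lookup h)) \<noteq> 0) \<and>
     (\<forall>p i j. i < n \<longrightarrow> j < n \<longrightarrow> i \<noteq> j \<longrightarrow> p i \<noteq> 0 \<longrightarrow> p j \<noteq> 0 \<longrightarrow>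
       (\<exists>k<n. poly_val p (mpderiv k h) \<noteq> 0))"

lemma nodal_form_singular_points:
  assumes d: "d \<ge> 3" and h: "nodal_form n d h"
  shows "card (singular_points n h) = n" "\<forall>P\<in>singular_points n h. node n h P"
    "general_position n (singular_points n h)"
proof -
  have sp: "singular_points n h = (\<lambda>a. point_class (unit_vec n a)) ` {..<n}"
    using h by (intro singular_points_eq_vertices[OF d]) (auto simp: nodal_form_def)
  show "card (singular_points n h) = n" unfolding sp by (simp add: card_image[OF vertices_inj])
  show "\<forall>P\<in>singular_points n h. node n h P"
    unfolding sp using h node_at_vertex[OF _ d] by (auto simp: nodal_form_def)
  show "general_position n (singular_points n h)" unfolding sp by (rule vertices_general_position)
qed

lemma mpderiv_Const_mult: "mpderiv i (Const c * f) = Const c * mpderiv i f"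
  by (rule poly_mapping_eqI) (simp add: lookup_mpderiv lookup_Const_mult)

text \<open>The final argument reaches a given form only up to a non-zero scalar, which this
  removes.\<close>

lemma nodal_form_scale:
  assumes c: "c \<noteq> 0" and h: "nodal_form n d h"
  shows "nodal_form n d (Const c * h)"
  unfolding nodal_form_def
proof (intro conjI allI impI)
  show "keys (Const c * h) \<subseteq> nodal_monoms n d"
    using h by (auto simp: nodal_form_def in_keys_iff lookup_Const_mult)
next
  fix a assume "a < n"
  have "hessian_coeffs n d a (lookup (Const c * h)) = c \<cdot>\<^sub>m hessian_coeffs n d a (lookup h)"
    by (rule eq_matI) (auto simp: hessian_coeffs_def lookup_Const_mult)
  then show "det (hessian_coeffs n d a (lookup (Const c * h))) \<noteq> 0"
    using c h \<open>a < n\<close> by (simp add: nodal_form_def det_smult)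
next
  fix p :: "nat \<Rightarrow> complex" and i j assume "i < n" "j < n" "i \<noteq> j" "p i \<noteq> 0" "p j \<noteq> 0"
  then have "\<exists>k<n. poly_val p (mpderiv k h) \<noteq> 0" using h by (auto simp: nodal_form_def)
  then show "\<exists>k<n. poly_val p (mpderiv k (Const c * h)) \<noteq> 0"
    using c by (simp add: mpderiv_Const_mult poly_val_mult)
qed

lemma singular_points_scale:
  assumes "c \<noteq> 0"
  shows "singular_points N (Const c * f) = singular_points N f"
  using assms by (simp add: singular_points_def mpderiv_Const_mult poly_val_mult)

lemma polyfun_det:
  assumes "\<And>i j. i < k \<Longrightarrow> j < k \<Longrightarrow> polyfun I (\<lambda>z. e z i j)"
  shows "polyfun I (\<lambda>z. det (mat k k (\<lambda>(i, j). e z i j)))"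
proof -
  have "det (mat k k (\<lambda>(i, j). e z i j)) =
      (\<Sum>p | p permutes {0..<k}. signof p * (\<Prod>i = 0..<k. e z i (p i)))" for z
    unfolding det_def
    by (auto intro!: sum.cong prod.cong arg_cong2[where f = "(*)"] dest: permutes_in_image)
  moreover have "polyfun I (\<lambda>z. \<Sum>p | p permutes {0..<k}. signof p * (\<Prod>i = 0..<k. e z i (p i)))"
    using assms by (intro polyfun_sum polyfun_mult polyfun_const polyfun_prod)
      (auto dest: permutes_in_image)
  ultimately show ?thesis by simp
qed

text \<open>Every entry of a kernel vector equals the sum \<open>s\<close> of all entries, so s = k
  s with \<open>k\<close> different from 1.\<close>

lemma det_all_ones_minus_one:
  assumes "k \<ge> 2"
  shows "det (mat k k (\<lambda>(i, j). if i = j then 0 else 1 :: complex)) \<noteq> 0"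
proof
  let ?A = "mat k k (\<lambda>(i, j). if i = j then 0 else 1 :: complex)"
  assume "det ?A = 0"
  then obtain v where v: "v \<in> carrier_vec k" "v \<noteq> 0\<^sub>v k" "?A *\<^sub>v v = 0\<^sub>v k"
    using det_0_iff_vec_prod_zero[of ?A k] by auto
  define s where "s = (\<Sum>i<k. v $ i)"
  have vs: "v $ i = s" if i: "i < k" for i
  proof -
    have "0 = (?A *\<^sub>v v) $ i" using v i by simp
    also have "\<dots> = (\<Sum>j<k. (if i = j then 0 else 1) * v $ j)"
      using i v(1) by (auto simp: scalar_prod_def lessThan_atLeast0 intro!: sum.cong)
    also have "\<dots> = (\<Sum>j<k. v $ j - (if i = j then v $ j else 0))"
      by (intro sum.cong) auto
    also have "\<dots> = s - v $ i" using i by (simp add: sum_subtractf s_def)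
    finally show ?thesis by simp
  qed
  have "(\<Sum>i<k. v $ i) = (\<Sum>i<k. s)" by (rule sum.cong) (simp_all add: vs)
  then have "of_nat k * s = 1 * s" by (simp flip: s_def)
  moreover have "(of_nat k :: complex) \<noteq> 1" using assms of_nat_eq_1_iff[where ?'a = complex, of k] by simp
  ultimately have "s = 0" by (metis mult_cancel_right)
  then have "v = 0\<^sub>v k" using v(1) vs by (intro eq_vecI) auto
  then show False using v(2) by contradiction
qed

section \<open>From an invertible shear to a nodal hyperplane section\<close>

definition hyperplane_form :: "nat \<Rightarrow> nat \<Rightarrow> ((nat \<Rightarrow>\<^sub>0 nat) \<Rightarrow> complex) \<Rightarrow> nat mpoly" where
  "hyperplane_form n d z = (\<Sum>m\<in>nodal_monoms n d. single m (z m))"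

definition shear_matrix :: "nat \<Rightarrow> nat \<Rightarrow> ((nat \<Rightarrow>\<^sub>0 nat) \<Rightarrow> complex) \<Rightarrow> complex mat" where
  "shear_matrix n d z = mat (n + 1) (n + 1) (\<lambda>(j, i). shear n d z j i)"

lemma finite_nodal_monoms: "finite (nodal_monoms n d)"
  unfolding nodal_monoms_def using finite_monoms[of "{..<n}" d] by simp

lemma lookup_hyperplane_form:
  "lookup (hyperplane_form n d z) m = (if m \<in> nodal_monoms n d then z m else 0)"
  unfolding hyperplane_form_def by (rule lookup_sum_single[OF finite_nodal_monoms])

lemma keys_hyperplane_form: "keys (hyperplane_form n d z) \<subseteq> nodal_monoms n d"
  using lookup_hyperplane_form by (metis in_keys_iff subsetI)

lemma nodal_monoms_subset: "nodal_monoms n d \<subseteq> monoms {..<n + 1} d"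
  by (auto simp: nodal_monoms_def monoms_def)

context
  fixes n d :: nat
  assumes n: "n \<ge> 3" and d: "d \<ge> 3"
begin

declare sum.lessThan_Suc [simp del] lessThan_Suc [simp del]

text \<open>An exponent of at least \<open>d - 1\<close> leaves room for just one more factor, so
  among the monomials without x_n those of \<open>edge_monoms\<close> are exactly the ones violating
  the bound \<open>d - 2\<close>.\<close>

lemma nodal_monoms_eq: "nodal_monoms n d = {m \<in> free_monoms n d. lookup m n = 0}"
proof (intro equalityI subsetI)
  fix m assume m: "m \<in> nodal_monoms n d"
  have "m \<notin> edge_monoms n d"
  proof
    assume "m \<in> edge_monoms n d"
    then obtain i j where ij: "(i, j) \<in> shear_pairs n" "m = edge_monom n d i j" by (auto simp: edge_monoms_def)
    have "lookup m i \<ge> d - 1" unfolding ij(2) lookup_edge_monom[OF n d ij(1)] by simp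
    moreover have "lookup m i \<le> d - 2" using m by (simp add: nodal_monoms_def)
    ultimately show False using d by linarith
  qed
  moreover have "n \<notin> keys m" using m by (auto simp: nodal_monoms_def monoms_def)
  ultimately show "m \<in> {m \<in> free_monoms n d. lookup m n = 0}"
    using m nodal_monoms_subset[of n d] by (auto simp: free_monoms_def not_in_keys_iff_lookup_eq_zero)
next
  fix m assume "m \<in> {m \<in> free_monoms n d. lookup m n = 0}"
  then have m: "m \<in> monoms {..<n + 1} d" "m \<notin> edge_monoms n d" "lookup m n = 0"
    by (auto simp: free_monoms_def)
  have km: "keys m \<subseteq> {..<n}"
  proof
    fix v assume "v \<in> keys m"
    then have "v < n + 1" "v \<noteq> n" using m by (auto simp: monoms_def in_keys_iff[of n])
    then show "v \<in> {..<n}" by simp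
  qed
  have deg: "mdeg m = d" using m by (simp add: monoms_def)
  have "lookup m a \<le> d - 2" for a
  proof (rule ccontr)
    assume big: "\<not> ?thesis"
    then have "a \<in> keys m" by (simp add: in_keys_iff)
    then have a: "a < n" using km by auto
    define m' where "m' = m - single a (d - 1)"
    have mm: "m = single a (d - 1) + m'"
      using big by (intro poly_mapping_eqI) (auto simp: m'_def lookup_add lookup_minus lookup_single when_def)
    have "mdeg m' = 1" using deg d mdeg_add[of "single a (d - 1)" m'] mm by simp
    then obtain b where b: "b \<in> keys m'"
      by (metis One_nat_def ex_in_conv mdeg_def n_not_Suc_n sum.empty)
    have lb: "lookup m' b = 1"
      using b lookup_le_mdeg[of m' b] \<open>mdeg m' = 1\<close> by (simp add: in_keys_iff)
    define m'' where "m'' = m' - single b 1"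
    have mm': "m' = single b 1 + m''"
      using lb by (intro poly_mapping_eqI) (auto simp: m''_def lookup_add lookup_minus lookup_single when_def)
    have "mdeg m'' = 0" using \<open>mdeg m' = 1\<close> mdeg_add[of "single b 1" m''] mm' by simp
    then have "m'' = 0"
      using lookup_le_mdeg[of m''] by (intro poly_mapping_eqI) simp
    then have m_eq: "m = single a (d - 1) + single b 1" using mm mm' by simp
    have "b \<in> keys m" using m_eq by (simp add: in_keys_iff lookup_add)
    then have "b < n" using km by auto
    define j where "j = (if b = a then n else b)"
    have "(a, j) \<in> shear_pairs n" using a \<open>b < n\<close> by (auto simp: shear_pairs_def j_def)
    moreover have "m = edge_monom n d a j" using m_eq \<open>b < n\<close> a by (auto simp: edge_monom_def j_def)
    ultimately show False using m(2) by (auto simp: edge_monoms_def)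
  qed
  then show "m \<in> nodal_monoms n d" using km deg by (simp add: nodal_monoms_def monoms_def)
qed

text \<open>The assumption \<open>inv\<close> says that the shear carries B y to (y, 0), and setting
  x_n = 0 in \<open>base_form\<close> leaves the nodal monomials.\<close>

lemma restrict_sheared_form:
  assumes B: "B \<in> carrier_mat (n + 1) n"
    and inv: "\<And>(y :: nat \<Rightarrow> complex) j. j < n + 1 \<Longrightarrow>
      (\<Sum>i<n + 1. shear n d z j i * (\<Sum>l<n. B $$ (i, l) * y l)) = (if j < n then y j else 0)"
  shows "restrict_form B (Const c * sheared_form n d z) = Const c * hyperplane_form n d z"
proof (rule mpoly_eqI)
  fix y :: "nat \<Rightarrow> complex"
  let ?x = "\<lambda>i. \<Sum>l<n. B $$ (i, l) * y l" and ?y = "\<lambda>j. if j < n then y j else 0"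
  have "poly_val y (restrict_form B (Const c * sheared_form n d z)) = c * poly_val ?x (sheared_form n d z)"
    using B by (simp add: restrict_form_def poly_val_subst poly_val_sum poly_val_mult)
  also have "poly_val ?x (sheared_form n d z) = poly_val ?y (base_form n d z)"
    unfolding poly_val_sheared_form[OF n d] poly_val_base_form[OF n d]
  proof (intro sum.cong refl arg_cong2[where f = "(*)"] mono_val_cong)
    fix m j assume "m \<in> free_monoms n d" "j \<in> keys m"
    then have "j < n + 1" using keys_free_monoms[OF n d] by auto
    then show "(\<Sum>i<n + 1. shear n d z j i * ?x i) = ?y j" by (rule inv)
  qed
  also have "\<dots> = (\<Sum>m\<in>nodal_monoms n d. z m * mono_val ?y m)"
    unfolding poly_val_base_form[OF n d]
  proof (rule sum.mono_neutral_right[OF finite_free_monoms[OF n d]])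
    show "nodal_monoms n d \<subseteq> free_monoms n d" by (auto simp: nodal_monoms_eq)
    show "\<forall>m\<in>free_monoms n d - nodal_monoms n d. z m * mono_val ?y m = 0"
    proof
      fix m assume "m \<in> free_monoms n d - nodal_monoms n d"
      then have "n \<in> keys m" "lookup m n \<noteq> 0" by (auto simp: nodal_monoms_eq in_keys_iff)
      then have "mono_val ?y m = 0" unfolding mono_val_def by (intro prod_zero) (auto intro!: bexI[of _ n])
      then show "z m * mono_val ?y m = 0" by simp
    qed
  qed
  also have "\<dots> = (\<Sum>m\<in>nodal_monoms n d. z m * mono_val y m)"
    by (intro sum.cong refl arg_cong2[where f = "(*)"] mono_val_cong)
      (auto simp: nodal_monoms_def monoms_def)
  finally show "poly_val y (restrict_form B (Const c * sheared_form n d z)) = poly_val y (Const c * hyperplane_form n d z)"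
    by (simp add: poly_val_mult hyperplane_form_def poly_val_sum poly_val_single mono_val_zero)
qed

text \<open>The hyperplane is the preimage of x_n = 0 under the shear, that is, the kernel of its
  last row. The first \<open>n\<close> columns of the inverse matrix parametrize it. The same
  \<open>H\<close> and \<open>B\<close> serve all scalar multiples of the form.\<close>

lemma sheared_form_hyperplane_section:
  assumes det: "det (shear_matrix n d z) \<noteq> 0"
  shows "\<exists>H B. hyperplane (n + 1) H \<and> hyperplane_coords (n + 1) H B \<and>
    (\<forall>c. restrict_form B (Const c * sheared_form n d z) = Const c * hyperplane_form n d z)"
proof -
  let ?G = "shear_matrix n d z"
  have G: "?G \<in> carrier_mat (n + 1) (n + 1)" by (simp add: shear_matrix_def)
  from det_non_zero_imp_unit[OF G det, of "()"] obtain K where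
    K: "K \<in> carrier_mat (n + 1) (n + 1)" "?G * K = 1\<^sub>m (n + 1)" "K * ?G = 1\<^sub>m (n + 1)"
    by (auto simp: Units_def ring_mat_def)
  define B where "B = mat (n + 1) n (\<lambda>(i, j). K $$ (i, j))"
  have B: "B \<in> carrier_mat (n + 1) n" by (simp add: B_def)
  define ext where "ext y = vec (n + 1) (\<lambda>i. if i < n then y $ i else 0 :: complex)" for y
  have By: "B *\<^sub>v y = K *\<^sub>v ext y" if y: "y \<in> carrier_vec n" for y
  proof (rule eq_vecI)
    fix i assume "i < dim_vec (K *\<^sub>v ext y)"
    then have i: "i < n + 1" using K(1) by simp
    have "(K *\<^sub>v ext y) $ i = (\<Sum>j<n + 1. K $$ (i, j) * (if j < n then y $ j else 0))"
      using i K(1) by (auto simp: scalar_prod_def ext_def lessThan_atLeast0 intro!: sum.cong)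
    also have "\<dots> = (\<Sum>j<n. K $$ (i, j) * y $ j)"
      by (rule sum.mono_neutral_cong_right) auto
    also have "\<dots> = (B *\<^sub>v y) $ i"
      using i y by (auto simp: B_def scalar_prod_def lessThan_atLeast0 intro!: sum.cong)
    finally show "(B *\<^sub>v y) $ i = (K *\<^sub>v ext y) $ i" by simp
  qed (use B K(1) in simp)
  have ext: "ext y \<in> carrier_vec (n + 1)" for y by (simp add: ext_def)
  have GB: "?G *\<^sub>v (B *\<^sub>v y) = ext y" if "y \<in> carrier_vec n" for y
  proof -
    have "?G *\<^sub>v (K *\<^sub>v ext y) = (?G * K) *\<^sub>v ext y"
      using assoc_mult_mat_vec[OF G K(1) ext] by simp
    then show ?thesis using By[OF that] K(2) ext[of y] by simp
  qed
  have KG: "K *\<^sub>v (?G *\<^sub>v x) = x" if "x \<in> carrier_vec (n + 1)" for x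
    using assoc_mult_mat_vec[OF K(1) G that] K(3) that by simp
  define H where "H = {x \<in> carrier_vec (n + 1). row ?G n \<bullet> x = 0}"
  have rG: "row ?G n \<in> carrier_vec (n + 1)" by (simp add: shear_matrix_def)
  have Hn: "x \<in> H \<longleftrightarrow> x \<in> carrier_vec (n + 1) \<and> (?G *\<^sub>v x) $ n = 0" for x
    using G by (auto simp: H_def)
  have "row ?G n \<noteq> 0\<^sub>v (n + 1)"
  proof
    assume "row ?G n = 0\<^sub>v (n + 1)"
    moreover have "0\<^sub>v (n + 1) \<bullet> col K n = 0" using K(1) by (intro scalar_prod_left_zero carrier_vecI) auto
    ultimately have "(?G * K) $$ (n, n) = 0" using G K(1) by simp
    then show False unfolding K(2) by simp
  qed
  then have "hyperplane (n + 1) H" unfolding hyperplane_def H_def using rG by blast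
  moreover have "bij_betw (\<lambda>y. B *\<^sub>v y) (carrier_vec n) H"
    unfolding bij_betw_def
  proof
    show "inj_on (\<lambda>y. B *\<^sub>v y) (carrier_vec n)"
    proof (rule inj_onI)
      fix y y' assume yy: "y \<in> carrier_vec n" "y' \<in> carrier_vec n" "B *\<^sub>v y = B *\<^sub>v y'"
      then have e: "ext y = ext y'" using GB by metis
      show "y = y'"
      proof (rule eq_vecI)
        fix i assume "i < dim_vec y'"
        then have "i < n" using yy by simp
        then show "y $ i = y' $ i" using arg_cong[OF e, of "\<lambda>v. v $ i"] by (simp add: ext_def)
      qed (use yy in simp)
    qed
    show "(\<lambda>y. B *\<^sub>v y) ` carrier_vec n = H"
    proof (intro equalityI subsetI)
      fix x assume "x \<in> (\<lambda>y. B *\<^sub>v y) ` carrier_vec n"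
      then obtain y where y: "y \<in> carrier_vec n" "x = B *\<^sub>v y" by blast
      then show "x \<in> H" unfolding Hn using B GB[OF y(1)] by (simp add: ext_def)
    next
      fix x assume x: "x \<in> H"
      define y where "y = vec n (\<lambda>i. (?G *\<^sub>v x) $ i)"
      have "ext y = ?G *\<^sub>v x"
        using x G unfolding Hn by (intro eq_vecI) (auto simp: ext_def y_def less_Suc_eq)
      then have "B *\<^sub>v y = x" using By[of y] KG[of x] x by (simp add: Hn y_def)
      moreover have "y \<in> carrier_vec n" by (simp add: y_def)
      ultimately show "x \<in> (\<lambda>y. B *\<^sub>v y) ` carrier_vec n" by blast
    qed
  qed
  then have "hyperplane_coords (n + 1) H B" using B by (simp add: hyperplane_coords_def)
  moreover have "restrict_form B (Const c * sheared_form n d z) = Const c * hyperplane_form n d z" for c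
  proof (rule restrict_sheared_form[OF B])
    fix y :: "nat \<Rightarrow> complex" and j assume j: "j < n + 1"
    have "(\<Sum>i<n + 1. shear n d z j i * (\<Sum>l<n. B $$ (i, l) * y l)) = (?G *\<^sub>v (B *\<^sub>v vec n y)) $ j"
      using j B by (auto simp: scalar_prod_def shear_matrix_def lessThan_atLeast0 intro!: sum.cong)
    also have "\<dots> = (if j < n then y j else 0)" using j GB[of "vec n y"] by (simp add: ext_def)
    finally show "(\<Sum>i<n + 1. shear n d z j i * (\<Sum>l<n. B $$ (i, l) * y l)) = (if j < n then y j else 0)" .
  qed
  ultimately show ?thesis by blast
qed

text \<open>In the test form every x_a^(d-2) x_b x_c with distinct indices has coefficient 1 and no
  x_a^(d-2) x_b^2 occurs.\<close>

lemma base_point_hessian: 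
  assumes a: "a < n"
  shows "hessian_coeffs n d a (lookup (hyperplane_form n d (base_point n d))) =
    mat (n - 1) (n - 1) (\<lambda>(i, j). if i = j then 0 else 1)"
proof (rule eq_matI)
  fix i j
  assume "i < dim_row (mat (n - 1) (n - 1) (\<lambda>(i, j). if i = j then 0 else 1 :: complex))"
    "j < dim_col (mat (n - 1) (n - 1) (\<lambda>(i, j). if i = j then 0 else 1 :: complex))"
  then have ij: "i < n - 1" "j < n - 1" by auto
  let ?m = "single a (d - 2) + single (skip a i) 1 + single (skip a j) (1::nat)"
  have sk: "skip a i < n" "skip a j < n" "a \<noteq> skip a i" "a \<noteq> skip a j" "skip a i = skip a j \<longleftrightarrow> i = j"
    using ij by (auto simp: skip_def)
  have bp: "base_point n d ?m = (if i = j then 0 else 1)"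
    using base_point_quadratic[OF n d a sk(1,2,3,4)] sk(5) by simp
  have "?m \<in> nodal_monoms n d" if "i \<noteq> j"
  proof -
    have l: "lookup ?m v = (if v = a then d - 2 else if v = skip a i \<or> v = skip a j then 1 else 0)" for v
      using sk that by (auto simp: lookup_add lookup_single when_def)
    have "keys ?m \<subseteq> {..<n}"
    proof
      fix v assume "v \<in> keys ?m"
      then have "lookup ?m v \<noteq> 0" by (simp add: in_keys_iff)
      then show "v \<in> {..<n}" unfolding l using a sk by (auto split: if_splits)
    qed
    moreover have "mdeg ?m = d" using d by (simp add: mdeg_add)
    moreover have "\<forall>v. lookup ?m v \<le> d - 2" unfolding l using d by auto
    ultimately show ?thesis unfolding nodal_monoms_def monoms_def by blast
  qed
  then have "lookup (hyperplane_form n d (base_point n d)) ?m = (if i = j then 0 else 1)"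
    unfolding lookup_hyperplane_form bp by auto
  then show "hessian_coeffs n d a (lookup (hyperplane_form n d (base_point n d))) $$ (i, j) =
      mat (n - 1) (n - 1) (\<lambda>(i, j). if i = j then 0 else 1) $$ (i, j)"
    using ij by (simp add: hessian_coeffs_def)
qed (simp_all add: hessian_coeffs_def)

lemma generic_sheared_form:
  "\<exists>F\<in>mpolys_in (monoms {..<n + 1} d). F \<noteq> 0 \<and> (\<forall>y. poly_val y F \<noteq> 0 \<longrightarrow>
    (\<exists>z. (\<forall>m\<in>monoms {..<n + 1} d. lookup (sheared_form n d z) m = y m) \<and>
      nodal_form n d (hyperplane_form n d z) \<and> det (shear_matrix n d z) \<noteq> 0))"
proof -
  let ?M = "monoms {..<n + 1} d"
  have finM: "finite ?M" by (rule finite_monoms) simp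
  from generic_nodal_form[OF n d] obtain Fn where Fn: "Fn \<in> mpolys_in (nodal_monoms n d)" "Fn \<noteq> 0"
    and Fn_nz: "\<forall>f p i j. keys f \<subseteq> nodal_monoms n d \<longrightarrow>
      poly_val (lookup f) Fn \<noteq> 0 \<longrightarrow> i < n \<longrightarrow> j < n \<longrightarrow> i \<noteq> j \<longrightarrow> p i \<noteq> 0 \<longrightarrow> p j \<noteq> 0 \<longrightarrow>
      (\<exists>k<n. poly_val p (mpderiv k f) \<noteq> 0)" by (elim bexE conjE)
  define hess where "hess z a = det (hessian_coeffs n d a (lookup (hyperplane_form n d z)))" for z a
  have "polyfun ?M (\<lambda>z. hess z a)" for a
  proof -
    have "polyfun ?M (\<lambda>z. lookup (hyperplane_form n d z) m)" for m
    proof (cases "m \<in> nodal_monoms n d")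
      case True
      then have "m \<in> ?M" using nodal_monoms_subset by blast
      then show ?thesis using True polyfun_var by (simp add: lookup_hyperplane_form)
    next
      case False
      then show ?thesis by (simp add: lookup_hyperplane_form polyfun_const)
    qed
    then show ?thesis unfolding hess_def hessian_coeffs_def
      by (intro polyfun_det polyfun_mult polyfun_const) 
  qed
  moreover have "polyfun ?M (\<lambda>z. det (shear_matrix n d z))"
    unfolding shear_matrix_def by (intro polyfun_det polyfun_shear[OF n d])
  ultimately have "polyfun ?M (\<lambda>z. (\<Prod>a<n. hess z a) * det (shear_matrix n d z))"
    by (intro polyfun_mult polyfun_prod)
  then obtain qd where qd: "qd \<in> mpolys_in ?M" "\<And>z. (\<Prod>a<n. hess z a) * det (shear_matrix n d z) = poly_val z qd"
    by (auto simp: polyfun_def)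
  have "qd \<noteq> 0"
  proof -
    have "shear_matrix n d (base_point n d) = 1\<^sub>m (n + 1)"
    proof (rule eq_matI)
      fix j i assume "j < dim_row (1\<^sub>m (n + 1) :: complex mat)" "i < dim_col (1\<^sub>m (n + 1) :: complex mat)"
      then have ji: "j < n + 1" "i < n + 1" by auto
      then have "i \<noteq> j \<Longrightarrow> i < n \<Longrightarrow> (i, j) \<in> shear_pairs n" by (auto simp: shear_pairs_def)
      then show "shear_matrix n d (base_point n d) $$ (j, i) = 1\<^sub>m (n + 1) $$ (j, i)"
        using ji base_point_edge[OF n d] by (simp add: shear_matrix_def shear_def)
    qed (simp_all add: shear_matrix_def)
    then have "det (shear_matrix n d (base_point n d)) \<noteq> 0" by simp
    moreover have "hess (base_point n d) a \<noteq> 0" if "a < n" for a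
      unfolding hess_def base_point_hessian[OF that] using n by (intro det_all_ones_minus_one) simp
    ultimately have "poly_val (base_point n d) qd \<noteq> 0" unfolding qd(2)[symmetric] by simp
    then show ?thesis by auto
  qed
  \<comment> \<open>The base point witnesses only that \<open>qd\<close> is non-zero, while
    \<open>Fn\<close> is non-zero by the dimension count; the product then provides points where all
    conditions hold together.\<close>
  define q where "q = Fn * qd"
  have FnM: "Fn \<in> mpolys_in ?M" using Fn(1) nodal_monoms_subset[of n d] by (auto simp: mpolys_in_def)
  have q: "q \<in> mpolys_in ?M" "q \<noteq> 0"
    using FnM qd(1) Fn(2) \<open>qd \<noteq> 0\<close> by (auto simp: q_def intro: mpolys_in_mult)
  have "\<forall>m. \<exists>P\<in>mpolys_in ?M. \<forall>z. lookup (sheared_form n d z) m = poly_val z P"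
    using sheared_form_family[OF n d] by (simp add: form_family_def polyfun_def)
  then obtain \<Phi> where \<Phi>: "\<And>m. \<Phi> m \<in> mpolys_in ?M"
    "\<And>m z. lookup (sheared_form n d z) m = poly_val z (\<Phi> m)" by metis
  have indep: "G = 0" if "G \<in> mpolys_in ?M" "poly_subst \<Phi> G = 0" for G
  proof (rule algebraically_independent_of_derivative[OF _ that])
    fix y
    show "\<exists>w. \<forall>m\<in>?M. ((\<lambda>t. poly_val (\<lambda>v. base_point n d v + t * w v) (\<Phi> m)) has_field_derivative y m) (at 0)"
      using sheared_form_coefficients_submersive[OF n d, of y] by (simp add: \<Phi>(2))
  qed
  have "\<exists>F\<in>mpolys_in ?M. F \<noteq> 0 \<and> (\<forall>y. poly_val y F \<noteq> 0 \<longrightarrow>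
      (\<exists>z. (\<forall>m\<in>?M. poly_val z (\<Phi> m) = y m) \<and> poly_val z q \<noteq> 0))"
    by (rule polynomial_map_dominant[OF finM \<Phi>(1) indep q])
  then obtain F where F: "F \<in> mpolys_in ?M" "F \<noteq> 0" and Fz: "\<forall>y. poly_val y F \<noteq> 0 \<longrightarrow>
    (\<exists>z. (\<forall>m\<in>?M. poly_val z (\<Phi> m) = y m) \<and> poly_val z q \<noteq> 0)" by (elim bexE conjE)
  show ?thesis
  proof (intro bexI[of _ F] conjI allI impI)
    fix y assume "poly_val y F \<noteq> 0"
    with Fz obtain z where z: "\<forall>m\<in>?M. poly_val z (\<Phi> m) = y m" "poly_val z q \<noteq> 0" by blast
    from z(2) have nz: "poly_val z Fn \<noteq> 0" "\<And>a. a < n \<Longrightarrow> hess z a \<noteq> 0" "det (shear_matrix n d z) \<noteq> 0"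
      by (auto simp: q_def poly_val_mult qd(2)[symmetric])
    have "poly_val (lookup (hyperplane_form n d z)) Fn = poly_val z Fn"
      by (rule poly_val_cong[OF Fn(1)]) (simp add: lookup_hyperplane_form)
    then have nz': "poly_val (lookup (hyperplane_form n d z)) Fn \<noteq> 0" using nz(1) by simp
    have "nodal_form n d (hyperplane_form n d z)"
      unfolding nodal_form_def
      using keys_hyperplane_form nz(2) Fn_nz[rule_format, OF keys_hyperplane_form nz']
      by (simp add: hess_def)
    then show "\<exists>z. (\<forall>m\<in>?M. lookup (sheared_form n d z) m = y m) \<and>
        nodal_form n d (hyperplane_form n d z) \<and> det (shear_matrix n d z) \<noteq> 0"
      using z(1) nz(3) \<Phi>(2) by auto
  qed (use F in auto)
qed

end

section \<open>From coefficient space to the projective parameter space\<close>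

lemma zariski_open_nonvanishing:
  assumes H: "H \<in> forms (monoms {..<N} d) e"
  shows "zariski_open N d {C \<in> proj_forms N d. \<forall>f\<in>C. poly_val (lookup f) H \<noteq> 0}"
    (is "zariski_open N d ?U")
proof -
  have G: "{H} \<subseteq> (\<Union>e. forms (monoms {..<N} d) e)" using H by auto
  have "C \<in> ?U \<longleftrightarrow> C \<notin> zero_locus N d {H}" if C: "C \<in> proj_forms N d" for C
  proof -
    obtain f where f: "f \<in> forms {..<N} d - {0}" "C = form_class f" using C by (auto simp: proj_forms_def)
    have "Const 1 * f \<in> form_class f" unfolding form_class_def using one_neq_zero by blast
    then have "f \<in> form_class f" by simp
    then have "(\<forall>g\<in>form_class f. poly_val (lookup g) H \<noteq> 0) \<longleftrightarrow> poly_val (lookup f) H \<noteq> 0"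
      using H by (auto simp: form_class_def lookup_Const_mult poly_val_scale)
    then show ?thesis using C zero_locus_class[OF f(1) G] unfolding f(2) by simp
  qed
  moreover have "zero_locus N d {H} \<subseteq> proj_forms N d" by (auto simp: zero_locus_def)
  ultimately have "proj_forms N d - ?U = zero_locus N d {H}" by blast
  then show ?thesis unfolding zariski_open_def using G by (intro conjI exI[of _ "{H}"]) auto
qed

text \<open>This is irreducibility of the parameter space: an open set around a class contains the
  non-vanishing locus of some \<open>F\<close>, and the product of \<open>F\<close> with
  \<open>H\<close> is a non-zero polynomial, hence non-zero somewhere.\<close>

lemma zariski_dense_nonvanishing:
  assumes N: "N \<ge> 1" and H: "H \<in> forms (monoms {..<N} d) e" "H \<noteq> 0"
  shows "zariski N d closure_of {C \<in> proj_forms N d. \<forall>f\<in>C. poly_val (lookup f) H \<noteq> 0} =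
    topspace (zariski N d)" (is "_ closure_of ?U = _")
proof (intro equalityI closure_of_subset_topspace subsetI)
  let ?M = "monoms {..<N} d"
  fix C assume C: "C \<in> topspace (zariski N d)"
  show "C \<in> zariski N d closure_of ?U"
    unfolding in_closure_of
  proof (intro conjI C allI impI)
    fix T assume T: "C \<in> T \<and> openin (zariski N d) T"
    then obtain G where G: "G \<subseteq> (\<Union>e. forms ?M e)" "proj_forms N d - T = zero_locus N d G"
      by (auto simp: openin_zariski zariski_open_def)
    obtain f where f: "f \<in> forms {..<N} d - {0}" "C = form_class f"
      using C by (auto simp: topspace_zariski proj_forms_def)
    have "form_class f \<notin> zero_locus N d G" using T G(2) f(2) by blast
    then obtain F where F: "F \<in> G" "poly_val (lookup f) F \<noteq> 0"
      using zero_locus_class[OF f(1) G(1)] by blast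
    obtain e' where Fe: "F \<in> forms ?M e'" using F(1) G(1) by blast
    \<comment> \<open>The extra factor \<open>Var m0\<close> forces the coefficient vector to be
      non-zero, also when \<open>F\<close> and \<open>H\<close> are constants.\<close>
    define m0 :: "nat \<Rightarrow>\<^sub>0 nat" where "m0 = single 0 d"
    have m0: "m0 \<in> ?M" using N by (auto simp: m0_def monoms_def)
    have "F \<noteq> 0" using F(2) by auto
    moreover have "Var m0 \<noteq> 0" by (metis lookup_single_eq lookup_zero one_neq_zero)
    ultimately have "F * H * Var m0 \<noteq> 0" using H(2) by (simp only: mult_eq_0_iff simp_thms)
    then obtain y where "poly_val y (F * H * Var m0) \<noteq> 0" using poly_val_eq_0_imp by blast
    then have y: "poly_val y F \<noteq> 0" "poly_val y H \<noteq> 0" "y m0 \<noteq> 0" by (auto simp: poly_val_mult)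
    define g where "g = (\<Sum>m\<in>?M. single m (y m))"
    have lg: "lookup g m = (if m \<in> ?M then y m else 0)" for m
      unfolding g_def by (rule lookup_sum_single) (simp add: finite_monoms)
    have "keys g \<subseteq> ?M" using lg by (metis in_keys_iff subsetI)
    moreover have "g \<noteq> 0" using lg[of m0] m0 y(3) by auto
    ultimately have g: "g \<in> forms {..<N} d - {0}" by (simp add: forms_def)
    have val: "poly_val (lookup g) P = poly_val y P" if "P \<in> forms ?M k" for P k
      using that forms_subset_mpolys_in lg by (intro poly_val_cong[of P ?M]) auto
    have "form_class g \<in> proj_forms N d" using g by (simp add: proj_forms_def)
    moreover have "form_class g \<notin> zero_locus N d G"
      using zero_locus_class[OF g G(1)] F(1) val[OF Fe] y(1) by auto
    ultimately have "form_class g \<in> T" using G(2) by blast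
    moreover have "form_class g \<in> ?U"
      using \<open>form_class g \<in> proj_forms N d\<close> val[OF H(1)] y(2) H(1)
      by (auto simp: form_class_def lookup_Const_mult poly_val_scale)
    ultimately show "\<exists>y. y \<in> ?U \<and> y \<in> T" by blast
  qed
qed

text \<open>On the line through \<open>y\<close>, \<open>F\<close> is a polynomial in the scalar
  \<open>c\<close> whose coefficient of c^e is the value of the homogeneous part at
  \<open>y\<close>. So a condition on classes still guarantees non-vanishing of \<open>F\<close> at
  some representative.\<close>

lemma homog_part_nonvanishing_scale:
  assumes F: "F \<in> mpolys_in M" "F \<noteq> 0"
  obtains e where "homog_part e F \<noteq> 0"
    "\<And>y. poly_val y (homog_part e F) \<noteq> 0 \<Longrightarrow> \<exists>c. c \<noteq> 0 \<and> poly_val (\<lambda>m. c * y m) F \<noteq> 0"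
proof -
  obtain D where D: "\<And>y. poly_val y F = (\<Sum>e\<le>D. poly_val y (homog_part e F))"
    using poly_val_homog_parts by blast
  obtain y0 where "poly_val y0 F \<noteq> 0" using F(2) poly_val_eq_0_imp by blast
  then obtain e where e: "e \<le> D" "poly_val y0 (homog_part e F) \<noteq> 0"
    unfolding D by (meson atMost_iff sum.neutral)
  show thesis
  proof (rule that[of e])
    show "homog_part e F \<noteq> 0" using e(2) by auto
    fix y assume y: "poly_val y (homog_part e F) \<noteq> 0"
    define p where "p = (\<Sum>k\<le>D. Polynomial.monom (poly_val y (homog_part k F)) k)"
    have "poly.coeff p e = poly_val y (homog_part e F)"
      using e(1) by (simp add: p_def coeff_sum)
    then have "p \<noteq> 0" using y by auto
    \<comment> \<open>The factor \<open>[:0, 1:]\<close> makes the chosen non-root \<open>c\<close>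
      itself non-zero.\<close>
    then have "p * [:0, 1:] \<noteq> 0" by simp
    then obtain c where "poly (p * [:0, 1:]) c \<noteq> 0" using poly_all_0_iff_0 by blast
    then have c: "c \<noteq> 0" "poly p c \<noteq> 0" by auto
    have "poly_val (\<lambda>m. c * y m) F = poly p c"
      unfolding D p_def poly_sum poly_monom
      using poly_val_scale[OF homog_part_in_forms[OF F(1)]] by (intro sum.cong) (simp_all add: mult.commute)
    then show "\<exists>c. c \<noteq> 0 \<and> poly_val (\<lambda>m. c * y m) F \<noteq> 0" using c by auto
  qed
qed

theorem theorem1p1:
  fixes n d :: nat
  assumes "n \<ge> 3" and "d \<ge> 3"
  shows "\<exists>U. openin (zariski (n + 1) d) U
    \<and> (zariski (n + 1) d) closure_of U = topspace (zariski (n + 1) d)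
    \<and> (\<forall>C\<in>U. \<forall>f\<in>C. smooth_hypersurface (n + 1) f
        \<and> (\<exists>H B. hyperplane (n + 1) H \<and> hyperplane_coords (n + 1) H B
            \<and> card (singular_points n (restrict_form B f)) = n
            \<and> (\<forall>P\<in>singular_points n (restrict_form B f). node n (restrict_form B f) P)
            \<and> general_position n (singular_points n (restrict_form B f))))"
proof -
  let ?M = "monoms {..<n + 1} d"
  from generic_sheared_form[OF assms] obtain F1 where F1: "F1 \<in> mpolys_in ?M" "F1 \<noteq> 0"
    and F1z: "\<forall>y. poly_val y F1 \<noteq> 0 \<longrightarrow>
      (\<exists>z. (\<forall>m\<in>?M. lookup (sheared_form n d z) m = y m) \<and>
        nodal_form n d (hyperplane_form n d z) \<and> det (shear_matrix n d z) \<noteq> 0)" by (elim bexE conjE)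
  have "d \<ge> 1" using assms by simp
  from generic_form_smooth[OF this, of "n + 1"] obtain F2 where F2: "F2 \<in> mpolys_in ?M" "F2 \<noteq> 0"
    and F2s: "\<forall>f\<in>forms {..<n + 1} d. poly_val (lookup f) F2 \<noteq> 0 \<longrightarrow> smooth_hypersurface (n + 1) f"
    by (elim bexE conjE)
  have F: "F1 * F2 \<in> mpolys_in ?M" "F1 * F2 \<noteq> 0" using F1 F2 by (auto intro: mpolys_in_mult)
  obtain e where e: "homog_part e (F1 * F2) \<noteq> 0"
    and scale: "\<And>y. poly_val y (homog_part e (F1 * F2)) \<noteq> 0 \<Longrightarrow>
      \<exists>c. c \<noteq> 0 \<and> poly_val (\<lambda>m. c * y m) (F1 * F2) \<noteq> 0"
    using homog_part_nonvanishing_scale[OF F] by blast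
  let ?H = "homog_part e (F1 * F2)"
  have H: "?H \<in> forms ?M e" by (rule homog_part_in_forms[OF F(1)])
  let ?U = "{C \<in> proj_forms (n + 1) d. \<forall>f\<in>C. poly_val (lookup f) ?H \<noteq> 0}"
  have good: "smooth_hypersurface (n + 1) f
        \<and> (\<exists>H B. hyperplane (n + 1) H \<and> hyperplane_coords (n + 1) H B
            \<and> card (singular_points n (restrict_form B f)) = n
            \<and> (\<forall>P\<in>singular_points n (restrict_form B f). node n (restrict_form B f) P)
            \<and> general_position n (singular_points n (restrict_form B f)))"
    if C: "C \<in> ?U" and fC: "f \<in> C" for C f
  proof -
    obtain f0 where f0: "f0 \<in> forms {..<n + 1} d" "C = form_class f0" using C by (auto simp: proj_forms_def)
    have f: "f \<in> forms {..<n + 1} d"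
      using fC f0 forms_Const_mult by (auto simp: form_class_def)
    have "poly_val (lookup f) ?H \<noteq> 0" using C fC by blast
    \<comment> \<open>The inhomogeneous conditions are available only for the multiple
      \<open>Const c * f\<close>. Smoothness and the nodal section are obtained there and carried
      back to \<open>f\<close>, whose zero locus is the same.\<close>
    from scale[OF this] obtain c where c: "c \<noteq> 0"
      and nz: "poly_val (lookup (Const c * f)) (F1 * F2) \<noteq> 0"
      by (auto simp: lookup_Const_mult)
    have cf: "Const c * f \<in> forms {..<n + 1} d" by (rule forms_Const_mult[OF f])
    have nz12: "poly_val (lookup (Const c * f)) F1 \<noteq> 0"
      "poly_val (lookup (Const c * f)) F2 \<noteq> 0" using nz by (auto simp: poly_val_mult)
    have "smooth_hypersurface (n + 1) (Const c * f)" using F2s cf nz12(2) by blast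
    then have smooth: "smooth_hypersurface (n + 1) f"
      by (simp add: smooth_hypersurface_def singular_points_scale[OF c])
    from F1z nz12(1) obtain z where
      z: "\<And>m. m \<in> ?M \<Longrightarrow> lookup (sheared_form n d z) m = lookup (Const c * f) m"
      and nodal: "nodal_form n d (hyperplane_form n d z)" and det: "det (shear_matrix n d z) \<noteq> 0" by blast
    have "sheared_form n d z = Const c * f"
    proof (rule poly_mapping_eqI)
      fix m
      show "lookup (sheared_form n d z) m = lookup (Const c * f) m"
      proof (cases "m \<in> ?M")
        case False
        then have "m \<notin> keys (sheared_form n d z)" "m \<notin> keys (Const c * f)"
          using sheared_form_in_forms[OF assms, of z] cf by (auto simp: forms_def)
        then show ?thesis by (simp add: not_in_keys_iff_lookup_eq_zero)
      qed (rule z)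
    qed
    then have "Const (inverse c) * sheared_form n d z = (Const (inverse c) * Const c) * f"
      by (simp add: mult.assoc)
    then have fz: "f = Const (inverse c) * sheared_form n d z" using c by (simp add: mult_single)
    from sheared_form_hyperplane_section[OF assms det] obtain H B where
      HB: "hyperplane (n + 1) H" "hyperplane_coords (n + 1) H B"
      and B: "\<And>c. restrict_form B (Const c * sheared_form n d z) = Const c * hyperplane_form n d z" by blast
    have "nodal_form n d (restrict_form B f)"
      unfolding fz B using c nodal by (intro nodal_form_scale) auto
    from nodal_form_singular_points[OF assms(2) this] show ?thesis using smooth HB by blast
  qed
  show ?thesis
  proof (intro exI[of _ ?U] conjI)
    show "openin (zariski (n + 1) d) ?U" unfolding openin_zariski by (rule zariski_open_nonvanishing[OF H])
    show "zariski (n + 1) d closure_of ?U = topspace (zariski (n + 1) d)"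
      by (rule zariski_dense_nonvanishing[OF _ H e]) simp
  qed (intro ballI good)
qed

end
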